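(* Let $(R,\mathfrak{m},k)$ be a one-dimensional analytically unramified non-Gorenstein Noetherian local domain with infinite residue field $k$, and assume that $\overline{R}$ is a DVR. Let $\omega_R$ denote the canonical module of $R$. Then $\operatorname{tr}_R(\omega_R)=\mathfrak{C}$ if and only if $\mathrm{h}(\omega_R)=2\lambda(R/\mathfrak{C})$.
   Context: $R$ is analytically unramified if its $\mathfrak{m}$-adic completion is reduced; then a canonical module $\omega_R$ exists and is isomorphic to an ideal of $R$. $Q$ is the fraction field of $R$, $\overline{R}$ is the integral closure of $R$ in $Q$, and $\mathfrak{C}=R:_Q\overline{R}$ is the conductor ideal. $\lambda(\cdot)$ denotes length as an $R$-module. The trace ideal of an $R$-module $M$ is $\operatorname{tr}_R(M)=\sum_{f\in\operatorname{Hom}_R(M,R)}f(M)$. For a finitely generated $R$-module $M$, $$\mathrm{h}(M):=\min\{\lambda(R/J)\mid J\subseteq R \text{ an ideal such that there is a surjection } M\to J\}.$$ *)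

theory Defs
  imports "HOL-Algebra.Algebra" "HOL-Library.Extended_Nat"
begin

text \<open>
  The ring fields \<open>mult\<close> and \<open>one\<close> of a module record play no role in the module axioms, and
  are \<open>undefined\<close> wherever there is no natural choice.
\<close>

definition self_module :: "('a, 'm) ring_scheme \<Rightarrow> ('a, 'a) module"
  where "self_module R =
    \<lparr>carrier = carrier R, monoid.mult = monoid.mult R, one = one R,
     ring.zero = ring.zero R, ring.add = ring.add R,
     smult = monoid.mult R\<rparr>"

definition ideal_module :: "('a, 'm) ring_scheme \<Rightarrow> 'a set \<Rightarrow> ('a, 'a) module"
  where "ideal_module R J = (self_module R)\<lparr>carrier := J\<rparr>"

definition quot_module :: "('a, 'b) module \<Rightarrow> 'b set \<Rightarrow> ('a, 'b set) module"
  where "quot_module M N =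
    \<lparr>carrier = a_rcosets\<^bsub>M\<^esub> N, monoid.mult = undefined, one = undefined, ring.zero = N,
     ring.add = set_add M, smult = (\<lambda>r A. \<Union>x\<in>A. N +>\<^bsub>M\<^esub> (r \<odot>\<^bsub>M\<^esub> x))\<rparr>"

definition submodule_span :: "('a, 'm) ring_scheme \<Rightarrow> ('a, 'b) module \<Rightarrow> 'b set \<Rightarrow> 'b set"
  where "submodule_span R M S = \<Inter>{N. submodule N R M \<and> S \<subseteq> N}"

definition finitely_generated_module :: "('a, 'm) ring_scheme \<Rightarrow> ('a, 'b) module \<Rightarrow> bool"
  where "finitely_generated_module R M \<longleftrightarrow>
    module R M \<and> (\<exists>S. finite S \<and> S \<subseteq> carrier M \<and> submodule_span R M S = carrier M)"

text \<open>Homomorphisms are extensional, so that equality in the Hom module is equality of maps.\<close>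

definition module_hom ::
    "('a, 'm) ring_scheme \<Rightarrow> ('a, 'b) module \<Rightarrow> ('a, 'c) module \<Rightarrow> ('b \<Rightarrow> 'c) set"
  where "module_hom R M N =
    {f \<in> carrier M \<rightarrow>\<^sub>E carrier N.
      (\<forall>x\<in>carrier M. \<forall>y\<in>carrier M. f (x \<oplus>\<^bsub>M\<^esub> y) = f x \<oplus>\<^bsub>N\<^esub> f y) \<and>
      (\<forall>r\<in>carrier R. \<forall>x\<in>carrier M. f (r \<odot>\<^bsub>M\<^esub> x) = r \<odot>\<^bsub>N\<^esub> f x)}"

definition Hom_module ::
    "('a, 'm) ring_scheme \<Rightarrow> ('a, 'b) module \<Rightarrow> ('a, 'c) module \<Rightarrow> ('a, 'b \<Rightarrow> 'c) module"
  where "Hom_module R M N =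
    \<lparr>carrier = module_hom R M N, monoid.mult = undefined, one = undefined,
     ring.zero = (\<lambda>x\<in>carrier M. \<zero>\<^bsub>N\<^esub>),
     ring.add = (\<lambda>f g. \<lambda>x\<in>carrier M. f x \<oplus>\<^bsub>N\<^esub> g x),
     smult = (\<lambda>r f. \<lambda>x\<in>carrier M. r \<odot>\<^bsub>N\<^esub> f x)\<rparr>"

definition module_length :: "('a, 'm) ring_scheme \<Rightarrow> ('a, 'b) module \<Rightarrow> enat"
  where "module_length R M =
    Sup {enat n | n. \<exists>N :: nat \<Rightarrow> 'b set.
      (\<forall>i\<le>n. submodule (N i) R M) \<and> (\<forall>i<n. N i \<subset> N (Suc i))}"

definition krull_dim :: "('a, 'm) ring_scheme \<Rightarrow> enat"
  where "krull_dim R =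
    Sup {enat n | n. \<exists>P :: nat \<Rightarrow> 'a set.
      (\<forall>i\<le>n. primeideal (P i) R) \<and> (\<forall>i<n. P i \<subset> P (Suc i))}"

definition local_ring :: "('a, 'm) ring_scheme \<Rightarrow> 'a set \<Rightarrow> bool"
  where "local_ring R m \<longleftrightarrow>
    cring R \<and> maximalideal m R \<and> (\<forall>n. maximalideal n R \<longrightarrow> n = m)"

definition residue_module :: "('a, 'm) ring_scheme \<Rightarrow> 'a set \<Rightarrow> ('a, 'a set) module"
  where "residue_module R m = quot_module (self_module R) m"

definition discrete_valuation_ring :: "('a, 'm) ring_scheme \<Rightarrow> bool"
  where "discrete_valuation_ring R \<longleftrightarrow>
    principal_domain R \<and> (\<exists>m. local_ring R m) \<and> \<not> field R"

primrec ideal_power :: "('a, 'm) ring_scheme \<Rightarrow> 'a set \<Rightarrow> nat \<Rightarrow> 'a set"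
  where
    "ideal_power R I 0 = carrier R"
  | "ideal_power R I (Suc n) = ideal_prod R I (ideal_power R I n)"

text \<open>
  The inverse limit of the rings \<open>R / I\<^sup>n\<close>: a coset of \<open>I\<^sup>n\<^sup>+\<^sup>1\<close> is mapped to a coset of
  \<open>I\<^sup>n\<close> under the transition map if and only if it is contained in it.
\<close>

definition adic_completion :: "('a, 'm) ring_scheme \<Rightarrow> 'a set \<Rightarrow> (nat \<Rightarrow> 'a set) ring"
  where "adic_completion R I =
    \<lparr>carrier = {f. (\<forall>n. f n \<in> carrier (R Quot ideal_power R I n)) \<and> (\<forall>n. f (Suc n) \<subseteq> f n)},
     monoid.mult = (\<lambda>f g n. f n \<otimes>\<^bsub>R Quot ideal_power R I n\<^esub> g n),
     one = (\<lambda>n. \<one>\<^bsub>R Quot ideal_power R I n\<^esub>),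
     ring.zero = (\<lambda>n. \<zero>\<^bsub>R Quot ideal_power R I n\<^esub>),
     ring.add = (\<lambda>f g n. f n \<oplus>\<^bsub>R Quot ideal_power R I n\<^esub> g n)\<rparr>"

definition reduced_ring :: "('a, 'm) ring_scheme \<Rightarrow> bool"
  where "reduced_ring R \<longleftrightarrow>
    (\<forall>x\<in>carrier R. \<forall>n::nat. x [^]\<^bsub>R\<^esub> n = \<zero>\<^bsub>R\<^esub> \<longrightarrow> x = \<zero>\<^bsub>R\<^esub>)"

definition analytically_unramified :: "('a, 'm) ring_scheme \<Rightarrow> 'a set \<Rightarrow> bool"
  where "analytically_unramified R m \<longleftrightarrow> reduced_ring (adic_completion R m)"

text \<open>The domain \<open>R\<close> is viewed as a subring of its fraction field \<open>Q\<close>.\<close>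

definition fraction_field :: "'a ring \<Rightarrow> 'a ring \<Rightarrow> bool"
  where "fraction_field R Q \<longleftrightarrow>
    field Q \<and> subring (carrier R) Q \<and> R = Q\<lparr>carrier := carrier R\<rparr> \<and>
    (\<forall>x\<in>carrier Q. \<exists>a\<in>carrier R. \<exists>b\<in>carrier R - {\<zero>\<^bsub>R\<^esub>}. x = a \<otimes>\<^bsub>Q\<^esub> inv\<^bsub>Q\<^esub> b)"

definition integral_closure :: "'a ring \<Rightarrow> 'a ring \<Rightarrow> 'a set"
  where "integral_closure R Q =
    {x \<in> carrier Q. \<exists>p. polynomial\<^bsub>Q\<^esub> (carrier R) p \<and> p \<noteq> [] \<and> lead_coeff p = \<one>\<^bsub>Q\<^esub> \<and>
      ring.eval Q p x = \<zero>\<^bsub>Q\<^esub>}"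

definition integral_closure_ring :: "'a ring \<Rightarrow> 'a ring \<Rightarrow> 'a ring"
  where "integral_closure_ring R Q = Q\<lparr>carrier := integral_closure R Q\<rparr>"

definition conductor :: "'a ring \<Rightarrow> 'a ring \<Rightarrow> 'a set"
  where "conductor R Q =
    {x \<in> carrier Q. \<forall>y\<in>integral_closure R Q. x \<otimes>\<^bsub>Q\<^esub> y \<in> carrier R}"

text \<open>
  The submodule \<open>(x\<^sub>1, \<dots>, x\<^sub>n) M\<close>; the conditions on a regular sequence below are those on the
  quotients of \<open>M\<close> by these submodules, pulled back to \<open>M\<close>.
\<close>

definition sequence_submodule ::
    "('a, 'm) ring_scheme \<Rightarrow> ('a, 'b) module \<Rightarrow> 'a list \<Rightarrow> 'b set"
  where "sequence_submodule R M xs =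
    submodule_span R M {x \<odot>\<^bsub>M\<^esub> z | x z. x \<in> set xs \<and> z \<in> carrier M}"

definition regular_sequence ::
    "('a, 'm) ring_scheme \<Rightarrow> ('a, 'b) module \<Rightarrow> 'a list \<Rightarrow> bool"
  where "regular_sequence R M xs \<longleftrightarrow>
    set xs \<subseteq> carrier R \<and>
    (\<forall>i<length xs. \<forall>z\<in>carrier M.
      xs ! i \<odot>\<^bsub>M\<^esub> z \<in> sequence_submodule R M (take i xs) \<longrightarrow>
      z \<in> sequence_submodule R M (take i xs)) \<and>
    sequence_submodule R M xs \<noteq> carrier M"

definition module_depth ::
    "('a, 'm) ring_scheme \<Rightarrow> 'a set \<Rightarrow> ('a, 'b) module \<Rightarrow> enat"
  where "module_depth R m M =
    Sup {enat (length xs) | xs. set xs \<subseteq> m \<and> regular_sequence R M xs}"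

text \<open>
  Injectivity is stated in Baer's form, extension of maps from ideals, because a formula cannot
  quantify over the modules in all types.
\<close>

definition injective_module :: "('a, 'm) ring_scheme \<Rightarrow> ('a, 'b) module \<Rightarrow> bool"
  where "injective_module R E \<longleftrightarrow>
    module R E \<and>
    (\<forall>J. ideal J R \<longrightarrow> (\<forall>f\<in>module_hom R (ideal_module R J) E.
      \<exists>g\<in>module_hom R (self_module R) E. \<forall>x\<in>J. g x = f x))"

definition injective_resolution ::
    "('a, 'm) ring_scheme \<Rightarrow> ('a, 'b) module \<Rightarrow> (nat \<Rightarrow> ('a, 'c) module) \<Rightarrow>
      (nat \<Rightarrow> 'c \<Rightarrow> 'c) \<Rightarrow> ('b \<Rightarrow> 'c) \<Rightarrow> bool"
  where "injective_resolution R M E d e \<longleftrightarrow>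
    (\<forall>n. injective_module R (E n)) \<and>
    e \<in> module_hom R M (E 0) \<and>
    (\<forall>n. d n \<in> module_hom R (E n) (E (Suc n))) \<and>
    inj_on e (carrier M) \<and>
    e ` carrier M = {x \<in> carrier (E 0). d 0 x = \<zero>\<^bsub>E 1\<^esub>} \<and>
    (\<forall>n. d n ` carrier (E n) =
      {x \<in> carrier (E (Suc n)). d (Suc n) x = \<zero>\<^bsub>E (Suc (Suc n))\<^esub>})"

text \<open>
  If \<open>E\<close>, \<open>d\<close> is an injective resolution of \<open>M\<close>, then \<open>Ext R N E d n\<close> is \<open>Ext\<^sup>n(N, M)\<close>,
  the \<open>n\<close>-th cohomology of the complex \<open>Hom(N, E)\<close>.
\<close>

definition Ext_cocycles ::
    "('a, 'm) ring_scheme \<Rightarrow> ('a, 'b) module \<Rightarrow> (nat \<Rightarrow> ('a, 'c) module) \<Rightarrow>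
      (nat \<Rightarrow> 'c \<Rightarrow> 'c) \<Rightarrow> nat \<Rightarrow> ('b \<Rightarrow> 'c) set"
  where "Ext_cocycles R N E d n =
    {f \<in> module_hom R N (E n). \<forall>x\<in>carrier N. d n (f x) = \<zero>\<^bsub>E (Suc n)\<^esub>}"

definition Ext_coboundaries ::
    "('a, 'm) ring_scheme \<Rightarrow> ('a, 'b) module \<Rightarrow> (nat \<Rightarrow> ('a, 'c) module) \<Rightarrow>
      (nat \<Rightarrow> 'c \<Rightarrow> 'c) \<Rightarrow> nat \<Rightarrow> ('b \<Rightarrow> 'c) set"
  where "Ext_coboundaries R N E d n =
    (case n of
      0 \<Rightarrow> {\<zero>\<^bsub>Hom_module R N (E 0)\<^esub>}
    | Suc k \<Rightarrow> (\<lambda>g. compose (carrier N) (d k) g) ` module_hom R N (E k))"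

definition Ext ::
    "('a, 'm) ring_scheme \<Rightarrow> ('a, 'b) module \<Rightarrow> (nat \<Rightarrow> ('a, 'c) module) \<Rightarrow>
      (nat \<Rightarrow> 'c \<Rightarrow> 'c) \<Rightarrow> nat \<Rightarrow> ('a, ('b \<Rightarrow> 'c) set) module"
  where "Ext R N E d n =
    quot_module ((Hom_module R N (E n))\<lparr>carrier := Ext_cocycles R N E d n\<rparr>)
      (Ext_coboundaries R N E d n)"

text \<open>
  Resolutions are taken in the type \<open>nat \<Rightarrow> 'a\<close>. This is no restriction: if \<open>R\<close> is Noetherian
  and \<open>M\<close> is finitely generated, each term of the minimal injective resolution of \<open>M\<close> is a
  direct sum of finitely many copies of each of the injective hulls of the \<open>R/p\<close>, which has
  cardinality at most \<open>max \<bar>R\<bar> \<aleph>\<^sub>0\<close>, and \<open>nat \<Rightarrow> 'a\<close> is at least that large.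
\<close>

definition finite_injective_resolution ::
    "('a, 'm) ring_scheme \<Rightarrow> ('a, 'b) module \<Rightarrow> (nat \<Rightarrow> ('a, nat \<Rightarrow> 'a) module) \<Rightarrow>
      (nat \<Rightarrow> (nat \<Rightarrow> 'a) \<Rightarrow> (nat \<Rightarrow> 'a)) \<Rightarrow> ('b \<Rightarrow> (nat \<Rightarrow> 'a)) \<Rightarrow> bool"
  where "finite_injective_resolution R M E d e \<longleftrightarrow>
    injective_resolution R M E d e \<and> (\<exists>k. \<forall>n>k. carrier (E n) = {\<zero>\<^bsub>E n\<^esub>})"

definition gorenstein :: "('a, 'm) ring_scheme \<Rightarrow> bool"
  where "gorenstein R \<longleftrightarrow> (\<exists>E d e. finite_injective_resolution R (self_module R) E d e)"

text \<open>
  A canonical module of a Cohen-Macaulay local ring is a maximal Cohen-Macaulay module of finite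
  injective dimension and of type 1. The type, \<open>dim\<^sub>k Ext\<^sup>t(k, M)\<close> where \<open>t\<close> is the depth of \<open>M\<close>,
  is the length of \<open>Ext\<^sup>t(k, M)\<close>, since this module is annihilated by \<open>m\<close>; it does not depend on
  the resolution, so the one of finite length serves.
\<close>

definition canonical_module ::
    "('a, 'm) ring_scheme \<Rightarrow> 'a set \<Rightarrow> ('a, 'b) module \<Rightarrow> bool"
  where "canonical_module R m W \<longleftrightarrow>
    finitely_generated_module R W \<and>
    (\<exists>t E d e. krull_dim R = enat t \<and> module_depth R m W = enat t \<and>
      finite_injective_resolution R W E d e \<and>
      module_length R (Ext R (residue_module R m) E d t) = 1)"

definition trace_ideal :: "('a, 'm) ring_scheme \<Rightarrow> ('a, 'b) module \<Rightarrow> 'a set"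
  where "trace_ideal R M =
    genideal R (\<Union>f\<in>module_hom R M (self_module R). f ` carrier M)"

text \<open>The infimum of a nonempty set in \<open>enat\<close> is attained; \<open>J = 0\<close> is always admissible.\<close>

definition h_invariant :: "('a, 'm) ring_scheme \<Rightarrow> ('a, 'b) module \<Rightarrow> enat"
  where "h_invariant R M =
    Inf {module_length R (quot_module (self_module R) J) | J.
      ideal J R \<and> (\<exists>f\<in>module_hom R M (ideal_module R J). f ` carrier M = J)}"

end

theory Submission
  imports Defs
begin

text \<open>
  Let \<open>V\<close> be the integral closure of \<open>R\<close> and \<open>C\<close> the conductor. The canonical module is isomorphic
  to a fractional ideal \<open>\<omega>\<close>, and dividing by an element of least value one may take
  \<open>R \<subseteq> \<omega> \<subseteq> V\<close>. Both sides of the theorem then turn out to say that \<open>R : \<omega>\<close>, which always contains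
  \<open>C\<close>, equals \<open>C\<close>.

  For the trace this is direct: the maps from \<open>\<omega>\<close> to \<open>R\<close> are the multiplications by elements of
  \<open>R : \<omega>\<close>, so that the trace is \<open>\<omega> (R : \<omega>)\<close>, and \<open>1 \<in> \<omega> \<subseteq> V\<close> while \<open>C V = C\<close>
  (\<open>trace_ideal_eq_conductor_iff\<close>).

  For \<open>h\<close>, the nonzero images of \<open>\<omega>\<close> in \<open>R\<close> are the ideals \<open>a \<omega>\<close> with \<open>a \<in> R : \<omega>\<close>, and their
  colengths are computed by duality. The map \<open>I \<mapsto> \<omega> : I\<close> is an inclusion-reversing involution of
  the nonzero fractional ideals, which exchanges \<open>R \<subseteq> V\<close> with \<open>\<omega> : V \<subseteq> \<omega>\<close>; moreover
  \<open>\<omega> : V = (\<omega> : \<omega>) : V = C\<close>. Suppose \<open>C \<noteq> 0\<close>. Then \<open>V / R\<close> and \<open>\<omega> / C\<close> have the same finite length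
  (\<open>length_duality\<close>), hence so do \<open>V / \<omega>\<close> and \<open>R / C\<close>; call the latter length \<open>q\<close>. Counting
  \<open>V / a\<omega>\<close> once through \<open>R\<close> and once through \<open>aV\<close> gives
  \<open>\<lambda>(R / a\<omega>) + \<lambda>(V / R) = q + \<lambda>(V / aV)\<close>. This grows with the value of \<open>a\<close>, and it gives
  \<open>\<lambda>(R / a\<omega>) = 2q\<close> when \<open>aV = C\<close>. So the minimum is \<open>2q\<close> exactly if no element of \<open>R : \<omega>\<close> has smaller
  value than \<open>C\<close>, that is, if \<open>R : \<omega> \<subseteq> C\<close> (\<open>h_invariant_iff_nonzero_conductor\<close>). If \<open>C = 0\<close>, both
  sides fail: the trace is nonzero, and \<open>h\<close> is finite while \<open>R\<close> has infinite length.

  It remains to obtain \<open>\<omega>\<close> and its duality from a finite injective resolution of the canonical module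
  \<open>W\<close>. Over a one-dimensional local domain the first cosyzygy in such a resolution is already injective
  (\<open>first_cosyzygy_injective\<close>), depth one makes \<open>W\<close> torsion-free, and the length of
  \<open>Ext\<^sup>1(R / m, W)\<close> is read off from the socle of that cosyzygy (\<open>Ext_residue_socle\<close>). This yields
  the properties collected in the locale \<open>canonical_over\<close>. The simplicity of the socle of \<open>W / xW\<close> bounds
  the length of \<open>W / xW\<close> by that of \<open>R / xR\<close>, which leaves no room for a second dimension and
  embeds \<open>W\<close> into \<open>Q\<close> (\<open>functional_injective\<close>); the other property, that annihilators in \<open>W / xW\<close> tell
  ideals apart, is the reflexivity of fractional ideals (\<open>separates_fractional\<close>).
\<close>

section \<open>Lengths of intervals of sets\<close>

text \<open>
  Chains live in an arbitrary family \<open>S\<close> of sets: lengths are compared along maps between the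
  submodule lattices of different modules, some of which reverse inclusions.
\<close>

definition has_chain :: "'b set set \<Rightarrow> 'b set \<Rightarrow> 'b set \<Rightarrow> nat \<Rightarrow> bool"
  where "has_chain S A B n \<longleftrightarrow> (\<exists>N :: nat \<Rightarrow> 'b set.
    (\<forall>i\<le>n. N i \<in> S \<and> A \<subseteq> N i \<and> N i \<subseteq> B) \<and> (\<forall>i<n. N i \<subset> N (Suc i)))"

definition chain_length :: "'b set set \<Rightarrow> 'b set \<Rightarrow> 'b set \<Rightarrow> enat"
  where "chain_length S A B = Sup {enat n | n. has_chain S A B n}"

lemma has_chain_truncate: "has_chain S A B n \<Longrightarrow> k \<le> n \<Longrightarrow> has_chain S A B k"
  unfolding has_chain_def by (meson le_trans less_le_trans)

lemma has_chain_0: "N \<in> S \<Longrightarrow> A \<subseteq> N \<Longrightarrow> N \<subseteq> B \<Longrightarrow> has_chain S A B 0"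
  unfolding has_chain_def by (rule exI[of _ "\<lambda>_. N"]) simp

text \<open>
  A supremum of natural numbers that is at least \<open>n\<close> is at least \<open>n\<close> at some member, and longer
  chains can be truncated.
\<close>

lemma le_chain_length_iff:
  assumes "has_chain S A B 0"
  shows "enat n \<le> chain_length S A B \<longleftrightarrow> has_chain S A B n"
proof
  assume "has_chain S A B n"
  then show "enat n \<le> chain_length S A B"
    unfolding chain_length_def by (intro Sup_upper) auto
next
  assume le: "enat n \<le> chain_length S A B"
  show "has_chain S A B n"
  proof (cases n)
    case 0
    then show ?thesis using assms by simp
  next
    case (Suc k)
    have "\<exists>l>k. has_chain S A B l"
    proof (rule ccontr)
      assume no: "\<not> ?thesis"
      have "chain_length S A B \<le> enat k"
        unfolding chain_length_def
      proof (rule Sup_least)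
        fix x assume "x \<in> {enat n | n. has_chain S A B n}"
        then show "x \<le> enat k" using no by (auto simp: not_less)
      qed
      then have "enat n \<le> enat k" using le by (rule order_trans[rotated])
      then show False using Suc by simp
    qed
    then show ?thesis using Suc has_chain_truncate by (metis Suc_leI)
  qed
qed

lemma enat_le_iff_nat: "a \<le> (b::enat) \<longleftrightarrow> (\<forall>n. enat n \<le> a \<longrightarrow> enat n \<le> b)"
proof
  assume *: "\<forall>n. enat n \<le> a \<longrightarrow> enat n \<le> b"
  show "a \<le> b"
  proof (cases a)
    case (enat n) then show ?thesis using * by simp
  next
    case infinity
    have "b = \<infinity>"
    proof (rule ccontr)
      assume "b \<noteq> \<infinity>"
      then obtain k where "b = enat k" by auto
      then show False using *[rule_format, of "Suc k"] infinity by simp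
    qed
    then show ?thesis by simp
  qed
qed auto

lemma chain_length_le_map:
  assumes map: "\<And>N. N \<in> S \<Longrightarrow> A \<subseteq> N \<Longrightarrow> N \<subseteq> B \<Longrightarrow> f N \<in> S' \<and> A' \<subseteq> f N \<and> f N \<subseteq> B'"
    and strict: "\<And>N N'. N \<in> S \<Longrightarrow> A \<subseteq> N \<Longrightarrow> N' \<in> S \<Longrightarrow> N' \<subseteq> B \<Longrightarrow> N \<subset> N' \<Longrightarrow> f N \<subset> f N'"
  shows "chain_length S A B \<le> chain_length S' A' B'"
  unfolding chain_length_def
proof (rule Sup_subset_mono, clarify)
  fix n assume "has_chain S A B n"
  then obtain N where N: "\<forall>i\<le>n. N i \<in> S \<and> A \<subseteq> N i \<and> N i \<subseteq> B" "\<forall>i<n. N i \<subset> N (Suc i)"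
    unfolding has_chain_def by blast
  have "has_chain S' A' B' n"
    unfolding has_chain_def
  proof (rule exI[of _ "\<lambda>i. f (N i)"], intro conjI allI impI)
    fix i assume "i < n"
    then show "f (N i) \<subset> f (N (Suc i))" using strict[of "N i" "N (Suc i)"] N by (simp add: Suc_leI)
  qed (use map N(1) in blast)+
  then show "\<exists>k. enat n = enat k \<and> has_chain S' A' B' k" by blast
qed

lemma chain_length_le_antitone_map:
  assumes map: "\<And>N. N \<in> S \<Longrightarrow> A \<subseteq> N \<Longrightarrow> N \<subseteq> B \<Longrightarrow> f N \<in> S' \<and> A' \<subseteq> f N \<and> f N \<subseteq> B'"
    and strict: "\<And>N N'. N \<in> S \<Longrightarrow> A \<subseteq> N \<Longrightarrow> N' \<in> S \<Longrightarrow> N' \<subseteq> B \<Longrightarrow> N \<subset> N' \<Longrightarrow> f N' \<subset> f N"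
  shows "chain_length S A B \<le> chain_length S' A' B'"
  unfolding chain_length_def
proof (rule Sup_subset_mono, clarify)
  fix n assume "has_chain S A B n"
  then obtain N where N: "\<forall>i\<le>n. N i \<in> S \<and> A \<subseteq> N i \<and> N i \<subseteq> B" "\<forall>i<n. N i \<subset> N (Suc i)"
    unfolding has_chain_def by blast
  have "has_chain S' A' B' n"
    unfolding has_chain_def
  proof (rule exI[of _ "\<lambda>i. f (N (n - i))"], intro conjI allI impI)
    fix i assume i: "i < n"
    then have "n - i = Suc (n - Suc i)" by simp
    then show "f (N (n - i)) \<subset> f (N (n - Suc i))"
      using strict[of "N (n - Suc i)" "N (n - i)"] N i by simp
  qed (use map N(1) in \<open>meson diff_le_self\<close>)+
  then show "\<exists>k. enat n = enat k \<and> has_chain S' A' B' k" by blast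
qed

lemma chain_length_mono: "A' \<subseteq> A \<Longrightarrow> B \<subseteq> B' \<Longrightarrow> chain_length S A B \<le> chain_length S A' B'"
  by (rule chain_length_le_map[of _ _ _ "\<lambda>N. N"]) auto

text \<open>
  Two chains can be concatenated. The junction costs nothing even if they do not meet, because
  the end of the first is dropped.
\<close>

lemma chain_length_add_le:
  assumes "A \<in> S" "B \<in> S" "C \<in> S" "A \<subseteq> B" "B \<subseteq> C"
  shows "chain_length S A B + chain_length S B C \<le> chain_length S A C"
proof -
  have conc: "enat (n + k) \<le> chain_length S A C"
    if n: "has_chain S A B n" and k: "has_chain S B C k" for n k
  proof -
    obtain N where N: "\<forall>i\<le>n. N i \<in> S \<and> A \<subseteq> N i \<and> N i \<subseteq> B" "\<forall>i<n. N i \<subset> N (Suc i)"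
      using n unfolding has_chain_def by blast
    obtain K where K: "\<forall>i\<le>k. K i \<in> S \<and> B \<subseteq> K i \<and> K i \<subseteq> C" "\<forall>i<k. K i \<subset> K (Suc i)"
      using k unfolding has_chain_def by blast
    define L where "L i = (if i < n then N i else K (i - n))" for i
    have "has_chain S A C (n + k)"
      unfolding has_chain_def
    proof (rule exI[of _ L], intro conjI allI impI)
      fix i assume i: "i < n + k"
      consider "Suc i < n" | "Suc i = n" | "n \<le> i" by linarith
      then show "L i \<subset> L (Suc i)"
      proof cases
        case 1 then show ?thesis using N(2) by (simp add: L_def)
      next
        case 2
        then have "N i \<subset> N n" "N n \<subseteq> B" "B \<subseteq> K 0" using N K by auto
        then show ?thesis using 2 by (auto simp: L_def)
      next
        case 3
        then show ?thesis using K(2) i by (simp add: L_def Suc_diff_le)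
      qed
    next
      fix i assume i: "i \<le> n + k"
      have "i < n \<Longrightarrow> N i \<in> S \<and> A \<subseteq> N i \<and> N i \<subseteq> B"
        and "\<not> i < n \<Longrightarrow> K (i - n) \<in> S \<and> B \<subseteq> K (i - n) \<and> K (i - n) \<subseteq> C"
        using N(1) K(1) i by auto
      then have "L i \<in> S \<and> A \<subseteq> L i \<and> L i \<subseteq> C"
        using assms by (cases "i < n") (auto simp: L_def)
      then show "L i \<in> S" "A \<subseteq> L i" "L i \<subseteq> C" by simp_all
    qed
    then show ?thesis
      using le_chain_length_iff has_chain_truncate by blast
  qed
  have AB: "has_chain S A B 0" and BC: "has_chain S B C 0"
    using has_chain_0[of B S] has_chain_0[of B S] assms by auto
  show ?thesis
  proof (cases "chain_length S A B")
    case (enat a)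
    note a = this
    show ?thesis
    proof (cases "chain_length S B C")
      case (enat b)
      have "has_chain S A B a" "has_chain S B C b"
        using le_chain_length_iff[OF AB, of a] le_chain_length_iff[OF BC, of b] a enat by auto
      then show ?thesis using conc[of a b] a enat by simp
    next
      case infinity
      have "enat n \<le> chain_length S A C" for n
      proof -
        have "has_chain S B C n" using le_chain_length_iff[OF BC, of n] infinity by simp
        then show ?thesis using conc[OF AB] by simp
      qed
      then show ?thesis using infinity enat_le_iff_nat by blast
    qed
  next
    case infinity
    have "enat n \<le> chain_length S A C" for n
    proof -
      have "has_chain S A B n" using le_chain_length_iff[OF AB, of n] infinity by simp
      then show ?thesis using conc[OF _ BC, of n] by simp
    qed
    then show ?thesis using infinity enat_le_iff_nat by blast
  qed
qed

lemma chain_length_self: "chain_length S A A = 0"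
proof -
  have "has_chain S A A n \<Longrightarrow> n = 0" for n
  proof (rule ccontr)
    assume "has_chain S A A n" and n: "n \<noteq> 0"
    then obtain N where "\<forall>i\<le>n. N i \<in> S \<and> A \<subseteq> N i \<and> N i \<subseteq> A" "\<forall>i<n. N i \<subset> N (Suc i)"
      unfolding has_chain_def by blast
    with n have "N 0 = A" "N (Suc 0) = A" "N 0 \<subset> N (Suc 0)"
      by (auto simp: subset_antisym Suc_le_eq)
    then show False by simp
  qed
  then have "chain_length S A A \<le> 0"
    unfolding chain_length_def by (intro Sup_least) (auto simp: zero_enat_def)
  then show ?thesis by simp
qed

lemma one_le_chain_length:
  assumes "A \<in> S" "B \<in> S" "A \<subset> B"
  shows "1 \<le> chain_length S A B"
proof -
  have "has_chain S A B 1"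
    unfolding has_chain_def
    by (rule exI[of _ "\<lambda>i. if i = 0 then A else B"]) (use assms in auto)
  then have "enat 1 \<le> chain_length S A B"
    unfolding chain_length_def by (intro Sup_upper) auto
  then show ?thesis by (simp add: one_enat_def)
qed

lemma chain_length_le_one:
  assumes "\<And>N. N \<in> S \<Longrightarrow> A \<subseteq> N \<Longrightarrow> N \<subseteq> B \<Longrightarrow> N = A \<or> N = B"
  shows "chain_length S A B \<le> 1"
proof -
  have "n \<le> 1" if c: "has_chain S A B n" for n
  proof (rule ccontr)
    assume n: "\<not> n \<le> 1"
    obtain N where N: "\<forall>i\<le>n. N i \<in> S \<and> A \<subseteq> N i \<and> N i \<subseteq> B" "\<forall>i<n. N i \<subset> N (Suc i)"
      using c unfolding has_chain_def by blast
    have "N 0 \<subset> N 1" "N 1 \<subset> N 2" using N(2) n by (auto simp: numeral_2_eq_2)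
    moreover have "N 0 = A \<or> N 0 = B" "N 1 = A \<or> N 1 = B" "N 2 = A \<or> N 2 = B"
      using N(1) n assms by auto
    ultimately show False by blast
  qed
  then show ?thesis
    unfolding chain_length_def by (intro Sup_least) (auto simp: one_enat_def)
qed

lemma chain_length_less_two_cases:
  assumes "chain_length S A B \<le> 1" "A \<in> S" "B \<in> S" "N \<in> S" "A \<subseteq> N" "N \<subseteq> B"
  shows "N = A \<or> N = B"
proof (rule ccontr)
  assume no: "\<not> ?thesis"
  have "1 \<le> chain_length S A N" "1 \<le> chain_length S N B"
    using no assms by (auto intro!: one_le_chain_length)
  then have "1 + 1 \<le> chain_length S A N + chain_length S N B" by (rule add_mono)
  also have "\<dots> \<le> chain_length S A B" by (rule chain_length_add_le) (use assms in auto)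
  finally have "1 + 1 \<le> (1::enat)" using assms(1) by (rule order_trans)
  then show False by (simp add: one_enat_def)
qed

text \<open>
  Additivity of length in a modular lattice: along a chain, each strict step is strict after
  meeting with \<open>B\<close> or after joining with \<open>B\<close>.
\<close>

lemma chain_length_add:
  fixes join :: "'b set \<Rightarrow> 'b set"
  assumes ABC: "A \<in> S" "B \<in> S" "C \<in> S" "A \<subseteq> B" "B \<subseteq> C"
    and meet: "\<And>U. U \<in> S \<Longrightarrow> U \<inter> B \<in> S"
    and join: "\<And>U. U \<in> S \<Longrightarrow> join U \<in> S \<and> B \<subseteq> join U"
    and join_le: "\<And>U. U \<in> S \<Longrightarrow> U \<subseteq> C \<Longrightarrow> join U \<subseteq> C"
    and join_mono: "\<And>U U'. U \<in> S \<Longrightarrow> U' \<in> S \<Longrightarrow> U \<subseteq> U' \<Longrightarrow> join U \<subseteq> join U'"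
    and modular: "\<And>U U'. U \<in> S \<Longrightarrow> U' \<in> S \<Longrightarrow> U \<subseteq> U' \<Longrightarrow> U \<inter> B = U' \<inter> B \<Longrightarrow>
      join U = join U' \<Longrightarrow> U = U'"
  shows "chain_length S A C = chain_length S A B + chain_length S B C"
proof (rule antisym)
  have "enat n \<le> chain_length S A B + chain_length S B C" if c: "has_chain S A C n" for n
  proof -
    obtain N where N: "\<forall>i\<le>n. N i \<in> S \<and> A \<subseteq> N i \<and> N i \<subseteq> C" "\<forall>i<n. N i \<subset> N (Suc i)"
      using c unfolding has_chain_def by blast
    have "enat k \<le> chain_length S A (N k \<inter> B) + chain_length S B (join (N k))" if "k \<le> n" for k
      using that
    proof (induction k)
      case 0
      then show ?case by (simp add: zero_enat_def[symmetric])
    next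
      case (Suc k)
      let ?U = "N k" and ?U' = "N (Suc k)"
      have XY: "?U \<in> S" "?U' \<in> S" "A \<subseteq> ?U" "?U \<subseteq> ?U'" "?U \<noteq> ?U'" using N(1) N(2)[rule_format, of k] Suc.prems by auto
      have step: "chain_length S D E + 1 \<le> chain_length S D F"
        if "D \<in> S" "E \<in> S" "F \<in> S" "D \<subseteq> E" "E \<subset> F" for D E F
      proof -
        have "chain_length S D E + 1 \<le> chain_length S D E + chain_length S E F"
          using one_le_chain_length[of E S F] that by (intro add_left_mono) auto
        also have "\<dots> \<le> chain_length S D F" using chain_length_add_le that by blast
        finally show ?thesis .
      qed
      have IH: "enat k \<le> chain_length S A (?U \<inter> B) + chain_length S B (join ?U)"
        using Suc by simp
      have m1: "chain_length S A (?U \<inter> B) \<le> chain_length S A (?U' \<inter> B)"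
        using XY by (intro chain_length_mono) auto
      have m2: "chain_length S B (join ?U) \<le> chain_length S B (join ?U')"
        using XY join_mono by (intro chain_length_mono) auto
      have "?U \<inter> B \<subset> ?U' \<inter> B \<or> join ?U \<subset> join ?U'"
        using modular[of ?U ?U'] join_mono[of ?U ?U'] XY by blast
      then have "chain_length S A (?U \<inter> B) + chain_length S B (join ?U) + 1
          \<le> chain_length S A (?U' \<inter> B) + chain_length S B (join ?U')"
      proof
        assume "?U \<inter> B \<subset> ?U' \<inter> B"
        then have "chain_length S A (?U \<inter> B) + 1 \<le> chain_length S A (?U' \<inter> B)"
          using step[of A "?U \<inter> B" "?U' \<inter> B"] XY ABC meet by auto
        from add_mono[OF this m2] show ?thesis by (simp add: ac_simps)
      next
        assume "join ?U \<subset> join ?U'"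
        then have "chain_length S B (join ?U) + 1 \<le> chain_length S B (join ?U')"
          using step[of B "join ?U" "join ?U'"] XY ABC join by auto
        from add_mono[OF m1 this] show ?thesis by (simp add: ac_simps)
      qed
      moreover have "enat (Suc k) \<le> chain_length S A (?U \<inter> B) + chain_length S B (join ?U) + 1"
        using add_right_mono[OF IH, of 1] by (simp add: one_enat_def)
      ultimately show ?case by (rule order_trans[rotated])
    qed
    then have "enat n \<le> chain_length S A (N n \<inter> B) + chain_length S B (join (N n))" by simp
    also have "\<dots> \<le> chain_length S A B + chain_length S B C"
      using N(1) join_le by (intro add_mono chain_length_mono) auto
    finally show ?thesis .
  qed
  then show "chain_length S A C \<le> chain_length S A B + chain_length S B C"
    unfolding chain_length_def[of S A C] by (intro Sup_least) auto
qed (rule chain_length_add_le[OF ABC])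

section \<open>Submodules and quotient modules\<close>

definition interval_length ::
    "('a, 'm) ring_scheme \<Rightarrow> ('a, 'b, 'z) module_scheme \<Rightarrow> 'b set \<Rightarrow> 'b set \<Rightarrow> enat"
  where "interval_length R M A B = chain_length {N. submodule N R M} A B"

definition cyclic_submodule :: "('a, 'm) ring_scheme \<Rightarrow> ('a, 'b, 'z) module_scheme \<Rightarrow> 'b \<Rightarrow> 'b set"
  where "cyclic_submodule R M y = (\<lambda>r. r \<odot>\<^bsub>M\<^esub> y) ` carrier R"

definition colon :: "('a, 'm) ring_scheme \<Rightarrow> ('a, 'b, 'z) module_scheme \<Rightarrow> 'b set \<Rightarrow> 'b \<Rightarrow> 'a set"
  where "colon R M N y = {r \<in> carrier R. r \<odot>\<^bsub>M\<^esub> y \<in> N}"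

lemma self_module_simps [simp]:
  "carrier (self_module R) = carrier R" "monoid.mult (self_module R) = monoid.mult R"
  "one (self_module R) = one R" "ring.zero (self_module R) = ring.zero R"
  "ring.add (self_module R) = ring.add R" "smult (self_module R) = monoid.mult R"
  by (simp_all add: self_module_def)

context module
begin

lemma submodule_zero: "submodule N R M \<Longrightarrow> \<zero>\<^bsub>M\<^esub> \<in> N"
  using submodule.axioms(1) subgroup.one_closed by fastforce

lemma submodule_carrier: "submodule N R M \<Longrightarrow> x \<in> N \<Longrightarrow> x \<in> carrier M"
  using submoduleE(1) by blast

lemma submodule_minus: "submodule N R M \<Longrightarrow> x \<in> N \<Longrightarrow> y \<in> N \<Longrightarrow> x \<ominus>\<^bsub>M\<^esub> y \<in> N"
  unfolding a_minus_def using submoduleE(3,5) by blast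

lemmas submodule_add = submoduleE(5)
lemmas submodule_smult = submoduleE(4)
lemmas submodule_uminus = submoduleE(3)

lemma submodule_add_cancel:
  assumes "submodule N R M" "x \<in> N" "y \<in> carrier M" "x \<oplus>\<^bsub>M\<^esub> y \<in> N"
  shows "y \<in> N"
proof -
  have x: "x \<in> carrier M" using assms submodule_carrier by blast
  have "y = \<ominus>\<^bsub>M\<^esub> x \<oplus>\<^bsub>M\<^esub> (x \<oplus>\<^bsub>M\<^esub> y)" using x assms(3)
    by (simp add: M.r_neg1)
  then show ?thesis using submodule_add submodule_uminus assms by metis
qed

lemma submoduleI_no_uminus:
  assumes "H \<subseteq> carrier M" "\<zero>\<^bsub>M\<^esub> \<in> H" "\<And>a b. a \<in> H \<Longrightarrow> b \<in> H \<Longrightarrow> a \<oplus>\<^bsub>M\<^esub> b \<in> H"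
    and smult: "\<And>a x. a \<in> carrier R \<Longrightarrow> x \<in> H \<Longrightarrow> a \<odot>\<^bsub>M\<^esub> x \<in> H"
  shows "submodule H R M"
proof (rule submoduleI)
  fix a assume a: "a \<in> H"
  then have "(\<ominus> \<one>) \<odot>\<^bsub>M\<^esub> a = \<ominus>\<^bsub>M\<^esub> a" using assms(1) smult_l_minus[of \<one> a] by auto
  then show "\<ominus>\<^bsub>M\<^esub> a \<in> H" using smult[OF _ a, of "\<ominus> \<one>"] by simp
qed (use assms in auto)

lemma submodule_zero_set: "submodule {\<zero>\<^bsub>M\<^esub>} R M"
  by (rule submoduleI) auto

lemma submodule_Int: "submodule N R M \<Longrightarrow> submodule N' R M \<Longrightarrow> submodule (N \<inter> N') R M"
  by (rule submoduleI) (auto simp: submodule_zero submodule_uminus submodule_add submodule_smult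
      dest: submodule_carrier)

lemma mem_set_add: "z \<in> A <+>\<^bsub>M\<^esub> B \<longleftrightarrow> (\<exists>a\<in>A. \<exists>b\<in>B. z = a \<oplus>\<^bsub>M\<^esub> b)"
  by (auto simp: set_add_def' )

lemma submodule_set_add:
  assumes A: "submodule A R M" and B: "submodule B R M"
  shows "submodule (A <+>\<^bsub>M\<^esub> B) R M"
proof (rule submoduleI)
  note car = submodule_carrier[OF A] submodule_carrier[OF B]
  show "A <+>\<^bsub>M\<^esub> B \<subseteq> carrier M"
    using car by (auto simp: mem_set_add)
  show "\<zero>\<^bsub>M\<^esub> \<in> A <+>\<^bsub>M\<^esub> B"
    using submodule_zero[OF A] submodule_zero[OF B] by (force simp: mem_set_add)
  fix z assume "z \<in> A <+>\<^bsub>M\<^esub> B"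
  then obtain a b where ab: "a \<in> A" "b \<in> B" "z = a \<oplus>\<^bsub>M\<^esub> b" by (auto simp: mem_set_add)
  have "\<ominus>\<^bsub>M\<^esub> z = \<ominus>\<^bsub>M\<^esub> a \<oplus>\<^bsub>M\<^esub> \<ominus>\<^bsub>M\<^esub> b" using ab car by (simp add: M.minus_add)
  then show "\<ominus>\<^bsub>M\<^esub> z \<in> A <+>\<^bsub>M\<^esub> B"
    using submodule_uminus[OF A ab(1)] submodule_uminus[OF B ab(2)] by (auto simp: mem_set_add)
  show "r \<odot>\<^bsub>M\<^esub> z \<in> A <+>\<^bsub>M\<^esub> B" if r: "r \<in> carrier R" for r
  proof -
    have "r \<odot>\<^bsub>M\<^esub> z = r \<odot>\<^bsub>M\<^esub> a \<oplus>\<^bsub>M\<^esub> r \<odot>\<^bsub>M\<^esub> b" using ab car r by (simp add: smult_r_distr)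
    then show ?thesis
      using submodule_smult[OF A r ab(1)] submodule_smult[OF B r ab(2)] by (auto simp: mem_set_add)
  qed
  fix z' assume "z' \<in> A <+>\<^bsub>M\<^esub> B"
  then obtain a' b' where ab': "a' \<in> A" "b' \<in> B" "z' = a' \<oplus>\<^bsub>M\<^esub> b'" by (auto simp: mem_set_add)
  have "z \<oplus>\<^bsub>M\<^esub> z' = (a \<oplus>\<^bsub>M\<^esub> a') \<oplus>\<^bsub>M\<^esub> (b \<oplus>\<^bsub>M\<^esub> b')"
    using ab ab' car by (simp add: M.a_ac)
  then show "z \<oplus>\<^bsub>M\<^esub> z' \<in> A <+>\<^bsub>M\<^esub> B"
    using submodule_add[OF A ab(1) ab'(1)] submodule_add[OF B ab(2) ab'(2)]
    by (auto simp: mem_set_add)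
qed

lemma set_add_upper:
  assumes "submodule A R M" "submodule B R M"
  shows "A \<subseteq> A <+>\<^bsub>M\<^esub> B" "B \<subseteq> A <+>\<^bsub>M\<^esub> B"
proof -
  show "A \<subseteq> A <+>\<^bsub>M\<^esub> B"
  proof
    fix x assume "x \<in> A"
    then show "x \<in> A <+>\<^bsub>M\<^esub> B"
      using submodule_zero[OF assms(2)] submodule_carrier[OF assms(1)]
      by (force simp: mem_set_add)
  qed
  show "B \<subseteq> A <+>\<^bsub>M\<^esub> B"
  proof
    fix x assume "x \<in> B"
    then show "x \<in> A <+>\<^bsub>M\<^esub> B"
      using submodule_zero[OF assms(1)] submodule_carrier[OF assms(2)]
      by (force simp: mem_set_add)
  qed
qed

lemma set_add_least:
  "submodule C R M \<Longrightarrow> A \<subseteq> C \<Longrightarrow> B \<subseteq> C \<Longrightarrow> A <+>\<^bsub>M\<^esub> B \<subseteq> C"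
  using submodule_add[of C] by (auto simp: mem_set_add subset_iff)

lemma submodule_cyclic: "y \<in> carrier M \<Longrightarrow> submodule (cyclic_submodule R M y) R M"
proof (rule submoduleI)
  assume y: "y \<in> carrier M"
  show "cyclic_submodule R M y \<subseteq> carrier M" using y by (auto simp: cyclic_submodule_def)
  show "\<zero>\<^bsub>M\<^esub> \<in> cyclic_submodule R M y"
    unfolding cyclic_submodule_def using y smult_l_null by force
  show "\<ominus>\<^bsub>M\<^esub> a \<in> cyclic_submodule R M y" if "a \<in> cyclic_submodule R M y" for a
    using that y smult_l_minus[symmetric] unfolding cyclic_submodule_def by force
  show "a \<oplus>\<^bsub>M\<^esub> b \<in> cyclic_submodule R M y"
    if "a \<in> cyclic_submodule R M y" "b \<in> cyclic_submodule R M y" for a b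
    using that y smult_l_distr[symmetric] unfolding cyclic_submodule_def by force
  show "r \<odot>\<^bsub>M\<^esub> a \<in> cyclic_submodule R M y"
    if "r \<in> carrier R" "a \<in> cyclic_submodule R M y" for r a
    using that y smult_assoc1[symmetric] unfolding cyclic_submodule_def by force
qed

lemma cyclic_self: "y \<in> carrier M \<Longrightarrow> y \<in> cyclic_submodule R M y"
  unfolding cyclic_submodule_def using smult_one[of y] by (metis R.one_closed imageI)

lemma mem_adjoin:
  "z \<in> N <+>\<^bsub>M\<^esub> cyclic_submodule R M y \<longleftrightarrow>
    (\<exists>n\<in>N. \<exists>r\<in>carrier R. z = n \<oplus>\<^bsub>M\<^esub> r \<odot>\<^bsub>M\<^esub> y)"
  by (auto simp: mem_set_add cyclic_submodule_def)

lemma colon_ideal: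
  assumes N: "submodule N R M" and y: "y \<in> carrier M"
  shows "ideal (colon R M N y) R"
proof (rule idealI)
  show "ring R" by (rule R.ring_axioms)
  show "subgroup (colon R M N y) (add_monoid R)"
  proof (rule R.add.subgroupI)
    show "colon R M N y \<noteq> {}"
      using submodule_zero[OF N] y by (auto simp: colon_def intro: exI[of _ "\<zero>"])
    fix a assume a: "a \<in> colon R M N y"
    then show "\<ominus> a \<in> colon R M N y"
      using submodule_uminus[OF N] y by (simp add: colon_def smult_l_minus)
    fix b assume "b \<in> colon R M N y"
    then show "a \<oplus> b \<in> colon R M N y"
      using a submodule_add[OF N] y by (simp add: colon_def smult_l_distr)
  qed (auto simp: colon_def)
  fix a x assume a: "a \<in> colon R M N y" and x: "x \<in> carrier R"
  then show "x \<otimes> a \<in> colon R M N y"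
    using submodule_smult[OF N x] y by (simp add: colon_def smult_assoc1)
  then show "a \<otimes> x \<in> colon R M N y"
    using a x by (simp add: R.m_comm colon_def)
qed

lemma interval_length_add:
  assumes "submodule A R M" "submodule B R M" "submodule C R M" "A \<subseteq> B" "B \<subseteq> C"
  shows "interval_length R M A C = interval_length R M A B + interval_length R M B C"
  unfolding interval_length_def
proof (rule chain_length_add[where join = "\<lambda>U. U <+>\<^bsub>M\<^esub> B"])
  \<comment> \<open>the modular law\<close>
  fix U U' assume U: "U \<in> {N. submodule N R M}" and U': "U' \<in> {N. submodule N R M}"
    and le: "U \<subseteq> U'" and meet: "U \<inter> B = U' \<inter> B" and join: "U <+>\<^bsub>M\<^esub> B = U' <+>\<^bsub>M\<^esub> B"
  have "U' \<subseteq> U"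
  proof
    fix z assume z: "z \<in> U'"
    then have "z \<in> U <+>\<^bsub>M\<^esub> B" using set_add_upper[of U' B] U' assms join by auto
    then obtain u b where ub: "u \<in> U" "b \<in> B" "z = u \<oplus>\<^bsub>M\<^esub> b" by (auto simp: mem_set_add)
    then have "b \<in> U'"
      using submodule_add_cancel[of U' u b] U' z le assms submodule_carrier by blast
    then have "b \<in> U" using ub meet by blast
    then show "z \<in> U" using ub U submodule_add by blast
  qed
  then show "U = U'" using le by blast
next
  show "U <+>\<^bsub>M\<^esub> B \<subseteq> C" if "U \<in> {N. submodule N R M}" "U \<subseteq> C" for U
    using assms that by (intro set_add_least) auto
  show "U <+>\<^bsub>M\<^esub> B \<subseteq> U' <+>\<^bsub>M\<^esub> B" if "U \<subseteq> U'" for U U'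
    using that unfolding subset_iff mem_set_add by blast
qed (use assms submodule_Int submodule_set_add set_add_upper in auto)

lemma interval_length_mono:
  "A' \<subseteq> A \<Longrightarrow> B \<subseteq> B' \<Longrightarrow> interval_length R M A B \<le> interval_length R M A' B'"
  unfolding interval_length_def by (rule chain_length_mono)

lemma interval_length_eq_0:
  assumes "submodule A R M" "submodule B R M" "A \<subseteq> B" "interval_length R M A B = 0"
  shows "A = B"
  using one_le_chain_length[of A "{N. submodule N R M}" B] assms
  unfolding interval_length_def by (auto simp: psubset_eq)

end

lemma interval_length_self [simp]: "interval_length R M A A = 0"
  unfolding interval_length_def by (rule chain_length_self)

lemma module_length_eq:
  fixes M :: "('a, 'b) module"
  assumes "module R M"
  shows "module_length R M = interval_length R M {\<zero>\<^bsub>M\<^esub>} (carrier M)"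
proof -
  interpret module R M by fact
  have "has_chain {N. submodule N R M} {\<zero>\<^bsub>M\<^esub>} (carrier M) n \<longleftrightarrow>
      (\<exists>N :: nat \<Rightarrow> 'b set. (\<forall>i\<le>n. submodule (N i) R M) \<and> (\<forall>i<n. N i \<subset> N (Suc i)))" for n
    unfolding has_chain_def using submodule_zero submoduleE(1)
    by (simp, intro iff_exI conj_cong all_cong refl) blast+
  then show ?thesis
    unfolding module_length_def interval_length_def chain_length_def by simp
qed

lemma self_module_module: "cring R \<Longrightarrow> module R (self_module R)"
proof -
  assume "cring R"
  then interpret cring R .
  have "abelian_group (self_module R)"
    by (rule abelian_groupI)
      (auto simp: a_ac intro!: bexI[of _ "\<ominus>\<^bsub>R\<^esub> _"] simp: l_neg)
  then show ?thesis
    by (intro moduleI) (auto simp: l_distr r_distr m_assoc is_cring)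
qed

lemma ideal_iff_submodule:
  assumes "cring R"
  shows "ideal J R \<longleftrightarrow> submodule J R (self_module R)"
proof -
  interpret cring R by fact
  interpret S: module R "self_module R" by (rule self_module_module) fact
  have neg: "\<ominus>\<^bsub>self_module R\<^esub> x = \<ominus>\<^bsub>R\<^esub> x" for x
    by (simp add: a_inv_def m_inv_def self_module_def)
  show ?thesis
  proof
    assume "ideal J R"
    then interpret ideal J R .
    show "submodule J R (self_module R)"
      by (rule S.submoduleI) (auto simp: neg I_l_closed a_subset intro!: a_subset[THEN subsetD])
  next
    assume J: "submodule J R (self_module R)"
    show "ideal J R"
    proof (rule idealI)
      show "subgroup J (add_monoid R)"
        by (rule add.subgroupI)
          (use S.submoduleE[OF J] S.submodule_zero[OF J] in \<open>auto simp: neg\<close>)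
      show "x \<otimes>\<^bsub>R\<^esub> a \<in> J" if "a \<in> J" "x \<in> carrier R" for a x
        using S.submoduleE(4)[OF J] that by simp
      then show "a \<otimes>\<^bsub>R\<^esub> x \<in> J" if "a \<in> J" "x \<in> carrier R" for a x
        using that m_comm S.submodule_carrier[OF J] by simp
    qed (rule ring_axioms)
  qed
qed

lemma submodule_restrict_carrier:
  "submodule N R (M\<lparr>carrier := A\<rparr>) \<longleftrightarrow> submodule N R M \<and> N \<subseteq> A" if "module R M" "submodule A R M"
proof -
  interpret M: module R M by fact
  interpret A: module R "M\<lparr>carrier := A\<rparr>"
    using submodule.submodule_is_module that by blast
  have neg: "\<ominus>\<^bsub>M\<lparr>carrier := A\<rparr>\<^esub> x = \<ominus>\<^bsub>M\<^esub> x" if "x \<in> A" for x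
  proof -
    have x: "x \<in> carrier M" using that \<open>submodule A R M\<close> M.submodule_carrier by blast
    have "\<ominus>\<^bsub>M\<^esub> x \<in> A" using that \<open>submodule A R M\<close> M.submodule_uminus by blast
    moreover have "\<ominus>\<^bsub>M\<^esub> x \<oplus>\<^bsub>M\<^esub> x = \<zero>\<^bsub>M\<^esub>" using x by (simp add: M.M.l_neg)
    ultimately show ?thesis using A.M.minus_equality[of "\<ominus>\<^bsub>M\<^esub> x" x] that by simp
  qed
  have sub: "A \<subseteq> carrier M" using \<open>submodule A R M\<close> M.submoduleE(1) by blast
  show ?thesis
  proof
    assume N: "submodule N R (M\<lparr>carrier := A\<rparr>)"
    have NA: "N \<subseteq> A" using A.submoduleE(1)[OF N] by simp
    have "submodule N R M"
    proof (rule M.submoduleI)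
      show "\<ominus>\<^bsub>M\<^esub> a \<in> N" if "a \<in> N" for a
        using A.submodule_uminus[OF N that] neg NA that by auto
    qed (use A.submodule_zero[OF N] A.submoduleE(4,5)[OF N] NA sub in auto)
    then show "submodule N R M \<and> N \<subseteq> A" using NA by simp
  next
    assume N: "submodule N R M \<and> N \<subseteq> A"
    show "submodule N R (M\<lparr>carrier := A\<rparr>)"
    proof (rule A.submoduleI)
      show "\<ominus>\<^bsub>M\<lparr>carrier := A\<rparr>\<^esub> a \<in> N" if "a \<in> N" for a
        using M.submodule_uminus[of N a] neg N that by auto
    qed (use M.submodule_zero[of N] M.submoduleE(4,5)[of N] N in auto)
  qed
qed

context
  fixes R :: "('a, 'm) ring_scheme" and M :: "('a, 'b) module" and N :: "'b set"
  assumes M: "module R M" and N: "submodule N R M"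
begin

interpretation module R M by (rule M)

lemma abelian_subgroup_of_submodule: "abelian_subgroup N M"
proof (rule abelian_subgroupI3)
  show "additive_subgroup N M"
    by (rule additive_subgroupI) (rule submodule.axioms(1)[OF N])
qed (rule M.abelian_group_axioms)

interpretation N: abelian_subgroup N M by (rule abelian_subgroup_of_submodule)

lemma coset_eq_iff:
  assumes "x \<in> carrier M" "y \<in> carrier M"
  shows "N +>\<^bsub>M\<^esub> x = N +>\<^bsub>M\<^esub> y \<longleftrightarrow> x \<ominus>\<^bsub>M\<^esub> y \<in> N"
proof -
  have "N +>\<^bsub>M\<^esub> x = N +>\<^bsub>M\<^esub> y \<longleftrightarrow> x \<in> N +>\<^bsub>M\<^esub> y"
    using N.a_repr_independence'[of x y] N.a_rcos_self[OF assms(1)] assms by auto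
  also have "\<dots> \<longleftrightarrow> x \<ominus>\<^bsub>M\<^esub> y \<in> N"
    using N.a_rcos_module[OF assms(2,1)] by (simp add: M.minus_eq)
  finally show ?thesis .
qed

lemma quot_module_simps:
  "carrier (quot_module M N) = (\<lambda>x. N +>\<^bsub>M\<^esub> x) ` carrier M"
  "ring.zero (quot_module M N) = N"
  "ring.add (quot_module M N) = set_add M"
  by (auto simp: quot_module_def A_RCOSETS_def')

lemma coset_eq_self_iff: "x \<in> carrier M \<Longrightarrow> N +>\<^bsub>M\<^esub> x = N \<longleftrightarrow> x \<in> N"
proof -
  assume x: "x \<in> carrier M"
  have "\<ominus>\<^bsub>M\<^esub> \<zero>\<^bsub>M\<^esub> = \<zero>\<^bsub>M\<^esub>" by (metis M.a_inv_closed M.l_zero M.r_neg M.zero_closed)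
  then have "x \<ominus>\<^bsub>M\<^esub> \<zero>\<^bsub>M\<^esub> = x" using x by (metis M.minus_eq M.r_zero)
  then show "N +>\<^bsub>M\<^esub> x = N \<longleftrightarrow> x \<in> N"
    using coset_eq_iff[of x "\<zero>\<^bsub>M\<^esub>"] N.a_rcos_const[OF submodule_zero[OF N]] x
    by simp
qed

lemma quot_module_smult:
  assumes r: "r \<in> carrier R" and x: "x \<in> carrier M"
  shows "r \<odot>\<^bsub>quot_module M N\<^esub> (N +>\<^bsub>M\<^esub> x) = N +>\<^bsub>M\<^esub> (r \<odot>\<^bsub>M\<^esub> x)"
proof -
  have "N +>\<^bsub>M\<^esub> (r \<odot>\<^bsub>M\<^esub> y) = N +>\<^bsub>M\<^esub> (r \<odot>\<^bsub>M\<^esub> x)" if y: "y \<in> N +>\<^bsub>M\<^esub> x" for y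
  proof -
    have yc: "y \<in> carrier M" using N.a_elemrcos_carrier[OF x y] .
    have "y \<ominus>\<^bsub>M\<^esub> x \<in> N" using N.a_rcos_module_imp[OF x y] by (simp add: M.minus_eq)
    then have "r \<odot>\<^bsub>M\<^esub> (y \<ominus>\<^bsub>M\<^esub> x) \<in> N" using submodule_smult[OF N r] by blast
    then have "r \<odot>\<^bsub>M\<^esub> y \<ominus>\<^bsub>M\<^esub> r \<odot>\<^bsub>M\<^esub> x \<in> N"
      using r x yc by (simp add: M.minus_eq smult_r_distr smult_r_minus)
    then show ?thesis using coset_eq_iff r x yc by simp
  qed
  then have "(\<Union>y\<in>N +>\<^bsub>M\<^esub> x. N +>\<^bsub>M\<^esub> (r \<odot>\<^bsub>M\<^esub> y)) = N +>\<^bsub>M\<^esub> (r \<odot>\<^bsub>M\<^esub> x)"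
    using N.a_rcos_self[OF x] by blast
  then show ?thesis by (simp add: quot_module_def)
qed

lemma quot_module_add:
  assumes "x \<in> carrier M" "y \<in> carrier M"
  shows "(N +>\<^bsub>M\<^esub> x) \<oplus>\<^bsub>quot_module M N\<^esub> (N +>\<^bsub>M\<^esub> y) = N +>\<^bsub>M\<^esub> (x \<oplus>\<^bsub>M\<^esub> y)"
  using N.a_rcos_sum assms by (simp add: quot_module_simps)

lemma module_quot_module: "module R (quot_module M N)"
proof (rule moduleI)
  show "abelian_group (quot_module M N)"
  proof (rule abelian_groupI)
    have N0: "N = N +>\<^bsub>M\<^esub> \<zero>\<^bsub>M\<^esub>"
      using coset_eq_self_iff[of "\<zero>\<^bsub>M\<^esub>"] submodule_zero[OF N] by simp
    then show "\<zero>\<^bsub>quot_module M N\<^esub> \<in> carrier (quot_module M N)"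
      by (simp add: quot_module_simps)
    fix A assume "A \<in> carrier (quot_module M N)"
    then obtain x where x: "x \<in> carrier M" "A = N +>\<^bsub>M\<^esub> x" by (auto simp: quot_module_simps)
    show "\<zero>\<^bsub>quot_module M N\<^esub> \<oplus>\<^bsub>quot_module M N\<^esub> A = A"
      using quot_module_add[of "\<zero>\<^bsub>M\<^esub>" x] x N0 by (simp add: quot_module_simps(2))
    show "\<exists>B\<in>carrier (quot_module M N). B \<oplus>\<^bsub>quot_module M N\<^esub> A = \<zero>\<^bsub>quot_module M N\<^esub>"
      by (rule bexI[of _ "N +>\<^bsub>M\<^esub> (\<ominus>\<^bsub>M\<^esub> x)"])
        (use x N0 in \<open>auto simp: quot_module_add quot_module_simps(1,2) M.l_neg\<close>)
  qed (auto simp: quot_module_simps(1) quot_module_add M.a_ac)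
qed (auto simp: quot_module_simps(1) quot_module_smult quot_module_add R.is_cring
    smult_l_distr smult_r_distr smult_assoc1)

interpretation Q: module R "quot_module M N" by (rule module_quot_module)

text \<open>Submodules of \<open>M / N\<close> correspond to submodules between \<open>N\<close> and \<open>M\<close>.\<close>

lemma module_length_quot_module:
  "module_length R (quot_module M N) = interval_length R M N (carrier M)"
proof -
  have "interval_length R (quot_module M N) {N} (carrier (quot_module M N))
      = interval_length R M N (carrier M)"
    unfolding interval_length_def
  proof (rule antisym)
    let ?pre = "\<lambda>T. {x \<in> carrier M. N +>\<^bsub>M\<^esub> x \<in> T}"
    show "chain_length {N'. submodule N' R (quot_module M N)} {N} (carrier (quot_module M N))
        \<le> chain_length {N. submodule N R M} N (carrier M)"
    proof (rule chain_length_le_map[where f = ?pre])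
      fix T assume "T \<in> {N'. submodule N' R (quot_module M N)}" "{N} \<subseteq> T"
      then have T: "submodule T R (quot_module M N)" and NT: "N \<in> T" by auto
      have "submodule (?pre T) R M"
      proof (rule submoduleI_no_uminus)
        show "\<zero>\<^bsub>M\<^esub> \<in> ?pre T"
          using NT coset_eq_self_iff[of "\<zero>\<^bsub>M\<^esub>"] submodule_zero[OF N] by simp
        show "a \<oplus>\<^bsub>M\<^esub> b \<in> ?pre T" if "a \<in> ?pre T" "b \<in> ?pre T" for a b
          using that Q.submodule_add[OF T, of "N +>\<^bsub>M\<^esub> a" "N +>\<^bsub>M\<^esub> b"]
          by (simp add: quot_module_add)
        show "r \<odot>\<^bsub>M\<^esub> b \<in> ?pre T" if "r \<in> carrier R" "b \<in> ?pre T" for r b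
          using that Q.submodule_smult[OF T, of r "N +>\<^bsub>M\<^esub> b"] by (simp add: quot_module_smult)
      qed auto
      moreover have "N \<subseteq> ?pre T"
      proof
        fix x assume x: "x \<in> N"
        then have "x \<in> carrier M" using submodule_carrier[OF N] by blast
        then show "x \<in> ?pre T" using coset_eq_self_iff[of x] x NT by simp
      qed
      ultimately show "?pre T \<in> {N. submodule N R M} \<and> N \<subseteq> ?pre T \<and> ?pre T \<subseteq> carrier M" by auto
    next
      fix T T' assume T': "T' \<subseteq> carrier (quot_module M N)" and "T \<subset> T'"
      then obtain A where "A \<in> T'" "A \<notin> T" by blast
      with T' obtain x where "x \<in> carrier M" "N +>\<^bsub>M\<^esub> x \<in> T'" "N +>\<^bsub>M\<^esub> x \<notin> T"
        by (auto simp: quot_module_simps)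
      then show "?pre T \<subset> ?pre T'" using \<open>T \<subset> T'\<close> by blast
    qed
    let ?im = "\<lambda>U. (\<lambda>x. N +>\<^bsub>M\<^esub> x) ` U"
    show "chain_length {N. submodule N R M} N (carrier M) \<le>
        chain_length {N'. submodule N' R (quot_module M N)} {N} (carrier (quot_module M N))"
    proof (rule chain_length_le_map[where f = ?im])
      fix U assume "U \<in> {N. submodule N R M}" and NU: "N \<subseteq> U"
      then have U: "submodule U R M" by simp
      note car = submodule_carrier[OF U]
      have NimU: "N \<in> ?im U"
        using coset_eq_self_iff[of "\<zero>\<^bsub>M\<^esub>"] submodule_zero[OF U] submodule_zero[OF N]
        by (metis M.zero_closed image_eqI)
      have "submodule (?im U) R (quot_module M N)"
      proof (rule Q.submoduleI_no_uminus)
        show "a \<oplus>\<^bsub>quot_module M N\<^esub> b \<in> ?im U" if "a \<in> ?im U" "b \<in> ?im U" for a b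
          using that submodule_add[OF U] car by (auto simp: quot_module_add)
        show "r \<odot>\<^bsub>quot_module M N\<^esub> b \<in> ?im U" if "r \<in> carrier R" "b \<in> ?im U" for r b
          using that submodule_smult[OF U] car by (auto simp: quot_module_smult)
      qed (use car NimU in \<open>auto simp: quot_module_simps\<close>)
      then show "?im U \<in> {N'. submodule N' R (quot_module M N)} \<and> {N} \<subseteq> ?im U \<and>
          ?im U \<subseteq> carrier (quot_module M N)"
        using NimU car by (auto simp: quot_module_simps)
    next
      fix U U' assume "U \<in> {N. submodule N R M}" "N \<subseteq> U" and U'c: "U' \<subseteq> carrier M" and "U \<subset> U'"
      then obtain x where x: "x \<in> U'" "x \<notin> U" and U: "submodule U R M" and NU: "N \<subseteq> U" by blast
      have "N +>\<^bsub>M\<^esub> x \<notin> ?im U"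
      proof
        assume "N +>\<^bsub>M\<^esub> x \<in> ?im U"
        then obtain u where u: "u \<in> U" "N +>\<^bsub>M\<^esub> u = N +>\<^bsub>M\<^esub> x" by auto
        have uc: "u \<in> carrier M" and xc: "x \<in> carrier M"
          using u submodule_carrier[OF U] x U'c by auto
        have "u \<ominus>\<^bsub>M\<^esub> x \<in> U" using coset_eq_iff[OF uc xc] u NU by auto
        then have "u \<ominus>\<^bsub>M\<^esub> (u \<ominus>\<^bsub>M\<^esub> x) \<in> U" using submodule_minus[OF U] u by blast
        moreover have "u \<ominus>\<^bsub>M\<^esub> (u \<ominus>\<^bsub>M\<^esub> x) = x"
          using uc xc by (simp add: M.minus_eq M.minus_add M.r_neg2)
        ultimately show False using x by simp
      qed
      then show "?im U \<subset> ?im U'" using \<open>U \<subset> U'\<close> x by blast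
    qed
  qed
  then show ?thesis using module_length_eq[OF module_quot_module] by (simp add: quot_module_simps)
qed

end

section \<open>Modules of homomorphisms\<close>

lemma Hom_module_simps [simp]:
  "carrier (Hom_module R N M) = module_hom R N M"
  "ring.zero (Hom_module R N M) = (\<lambda>x\<in>carrier N. \<zero>\<^bsub>M\<^esub>)"
  "ring.add (Hom_module R N M) = (\<lambda>f g. \<lambda>x\<in>carrier N. f x \<oplus>\<^bsub>M\<^esub> g x)"
  "smult (Hom_module R N M) = (\<lambda>r f. \<lambda>x\<in>carrier N. r \<odot>\<^bsub>M\<^esub> f x)"
  by (simp_all add: Hom_module_def)

lemma module_homI:
  assumes "f \<in> extensional (carrier N)" "\<And>x. x \<in> carrier N \<Longrightarrow> f x \<in> carrier M"
    "\<And>x y. x \<in> carrier N \<Longrightarrow> y \<in> carrier N \<Longrightarrow> f (x \<oplus>\<^bsub>N\<^esub> y) = f x \<oplus>\<^bsub>M\<^esub> f y"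
    "\<And>r x. r \<in> carrier R \<Longrightarrow> x \<in> carrier N \<Longrightarrow> f (r \<odot>\<^bsub>N\<^esub> x) = r \<odot>\<^bsub>M\<^esub> f x"
  shows "f \<in> module_hom R N M"
  using assms unfolding module_hom_def by (auto simp: PiE_iff)

lemma module_homD:
  assumes "f \<in> module_hom R N M"
  shows "f \<in> extensional (carrier N)" "\<And>x. x \<in> carrier N \<Longrightarrow> f x \<in> carrier M"
    "\<And>x y. x \<in> carrier N \<Longrightarrow> y \<in> carrier N \<Longrightarrow> f (x \<oplus>\<^bsub>N\<^esub> y) = f x \<oplus>\<^bsub>M\<^esub> f y"
    "\<And>r x. r \<in> carrier R \<Longrightarrow> x \<in> carrier N \<Longrightarrow> f (r \<odot>\<^bsub>N\<^esub> x) = r \<odot>\<^bsub>M\<^esub> f x"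
  using assms unfolding module_hom_def by (auto simp: PiE_iff)

lemma module_hom_zero:
  assumes "module R N" "module R M" "f \<in> module_hom R N M"
  shows "f \<zero>\<^bsub>N\<^esub> = \<zero>\<^bsub>M\<^esub>"
proof -
  interpret N: module R N by fact
  interpret M: module R M by fact
  have "f (\<zero>\<^bsub>R\<^esub> \<odot>\<^bsub>N\<^esub> \<zero>\<^bsub>N\<^esub>) = \<zero>\<^bsub>R\<^esub> \<odot>\<^bsub>M\<^esub> f \<zero>\<^bsub>N\<^esub>"
    using module_homD(4)[OF assms(3)] by blast
  then show ?thesis using module_homD(2)[OF assms(3)] by simp
qed

lemma module_Hom_module:
  assumes "module R N" "module R M"
  shows "module R (Hom_module R N M)"
proof -
  interpret N: module R N by fact
  interpret M: module R M by fact
  note D = module_homD[of _ R N M]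
  have add: "(\<lambda>x\<in>carrier N. f x \<oplus>\<^bsub>M\<^esub> g x) \<in> module_hom R N M"
    if "f \<in> module_hom R N M" "g \<in> module_hom R N M" for f g
    using D[OF that(1)] D[OF that(2)]
    by (intro module_homI) (auto simp: M.M.a_ac M.smult_r_distr)
  have smult: "(\<lambda>x\<in>carrier N. r \<odot>\<^bsub>M\<^esub> f x) \<in> module_hom R N M"
    if "f \<in> module_hom R N M" "r \<in> carrier R" for f r
    using D[OF that(1)] that(2)
    by (intro module_homI) (auto simp: M.smult_r_distr M.smult_assoc1[symmetric] N.R.m_comm)
  have ext: "f = g" if "f \<in> module_hom R N M" "g \<in> extensional (carrier N)"
    "\<And>x. x \<in> carrier N \<Longrightarrow> f x = g x" for f g
    using that D(1) extensionalityI by blast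
  have "abelian_group (Hom_module R N M)"
  proof (rule abelian_groupI)
    fix f g assume f: "f \<in> carrier (Hom_module R N M)" and g: "g \<in> carrier (Hom_module R N M)"
    then show "f \<oplus>\<^bsub>Hom_module R N M\<^esub> g \<in> carrier (Hom_module R N M)" using add by simp
    show "f \<oplus>\<^bsub>Hom_module R N M\<^esub> g = g \<oplus>\<^bsub>Hom_module R N M\<^esub> f"
      using f g D(2) by (auto simp: fun_eq_iff restrict_def M.M.a_comm)
    fix h assume "h \<in> carrier (Hom_module R N M)"
    then show "f \<oplus>\<^bsub>Hom_module R N M\<^esub> g \<oplus>\<^bsub>Hom_module R N M\<^esub> h
        = f \<oplus>\<^bsub>Hom_module R N M\<^esub> (g \<oplus>\<^bsub>Hom_module R N M\<^esub> h)"
      using f g D(2) by (auto simp: fun_eq_iff restrict_def M.M.a_assoc)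
  next
    show "\<zero>\<^bsub>Hom_module R N M\<^esub> \<in> carrier (Hom_module R N M)"
      by (simp, rule module_homI) auto
    fix f assume "f \<in> carrier (Hom_module R N M)"
    then have f: "f \<in> module_hom R N M" by simp
    show "\<zero>\<^bsub>Hom_module R N M\<^esub> \<oplus>\<^bsub>Hom_module R N M\<^esub> f = f"
      using D[OF f] by (simp, intro ext[OF f, symmetric]) auto
    have "(\<lambda>x\<in>carrier N. (\<ominus>\<^bsub>R\<^esub> \<one>\<^bsub>R\<^esub>) \<odot>\<^bsub>M\<^esub> f x) \<oplus>\<^bsub>Hom_module R N M\<^esub> f = \<zero>\<^bsub>Hom_module R N M\<^esub>"
      using D(2)[OF f] by (auto simp: fun_eq_iff restrict_def M.smult_l_minus M.M.l_neg)
    then show "\<exists>g\<in>carrier (Hom_module R N M). g \<oplus>\<^bsub>Hom_module R N M\<^esub> f = \<zero>\<^bsub>Hom_module R N M\<^esub>"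
      using smult[OF f] by (intro bexI[of _ "\<lambda>x\<in>carrier N. (\<ominus>\<^bsub>R\<^esub> \<one>\<^bsub>R\<^esub>) \<odot>\<^bsub>M\<^esub> f x"]) auto
  qed
  then show ?thesis
  proof (rule moduleI[OF N.R.is_cring])
    fix r s f assume r: "r \<in> carrier R" and s: "s \<in> carrier R" and "f \<in> carrier (Hom_module R N M)"
    then have f: "f \<in> module_hom R N M" by simp
    show "(r \<oplus>\<^bsub>R\<^esub> s) \<odot>\<^bsub>Hom_module R N M\<^esub> f =
        r \<odot>\<^bsub>Hom_module R N M\<^esub> f \<oplus>\<^bsub>Hom_module R N M\<^esub> s \<odot>\<^bsub>Hom_module R N M\<^esub> f"
      using r s D(2)[OF f] by (auto simp: fun_eq_iff restrict_def M.smult_l_distr)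
    show "(r \<otimes>\<^bsub>R\<^esub> s) \<odot>\<^bsub>Hom_module R N M\<^esub> f =
        r \<odot>\<^bsub>Hom_module R N M\<^esub> (s \<odot>\<^bsub>Hom_module R N M\<^esub> f)"
      using r s D(2)[OF f] by (auto simp: fun_eq_iff restrict_def M.smult_assoc1)
  next
    fix r f g assume r: "r \<in> carrier R" and "f \<in> carrier (Hom_module R N M)"
      "g \<in> carrier (Hom_module R N M)"
    then show "r \<odot>\<^bsub>Hom_module R N M\<^esub> (f \<oplus>\<^bsub>Hom_module R N M\<^esub> g) =
        r \<odot>\<^bsub>Hom_module R N M\<^esub> f \<oplus>\<^bsub>Hom_module R N M\<^esub> r \<odot>\<^bsub>Hom_module R N M\<^esub> g"
      using D(2)[of f] D(2)[of g] by (auto simp: fun_eq_iff restrict_def M.smult_r_distr)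
  next
    fix f assume "f \<in> carrier (Hom_module R N M)"
    then have f: "f \<in> module_hom R N M" by simp
    show "\<one>\<^bsub>R\<^esub> \<odot>\<^bsub>Hom_module R N M\<^esub> f = f"
      using D[OF f] by (simp, intro ext[OF f, symmetric]) auto
  qed (use smult in auto)
qed

section \<open>One-dimensional Noetherian local domains\<close>

locale noetherian_local_domain = noetherian_domain R for R :: "('a, 'm) ring_scheme" (structure) +
  fixes m :: "'a set"
  assumes local: "local_ring R m"

locale one_dim_local_domain = noetherian_local_domain +
  assumes dim_one: "krull_dim R = 1"

lemma (in noetherian_ring) maximal_ideal_among:
  assumes "\<A> \<noteq> {}" "\<And>J. J \<in> \<A> \<Longrightarrow> ideal J R"
  shows "\<exists>J\<in>\<A>. \<forall>J'\<in>\<A>. J \<subseteq> J' \<longrightarrow> J' = J"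
proof (rule subset_Zorn_nonempty)
  fix C assume C: "C \<noteq> {}" "subset.chain \<A> C"
  then have "C \<subseteq> {I. ideal I R}" using assms(2) by (auto simp: pred_on.chain_def)
  then have "subset.chain {I. ideal I R} C" using C(2) by (simp add: pred_on.chain_def)
  then have "\<Union>C \<in> C" using ideal_chain_is_trivial C(1) by blast
  then show "\<Union>C \<in> \<A>" using C(2) by (auto simp: pred_on.chain_def)
qed (rule assms(1))

lemma (in noetherian_ring) ideal_induct [consumes 1, case_names ideal]:
  assumes J: "ideal J R"
    and step: "\<And>J. ideal J R \<Longrightarrow> (\<And>J'. ideal J' R \<Longrightarrow> J \<subset> J' \<Longrightarrow> P J') \<Longrightarrow> P J"
  shows "P J"
proof (rule ccontr)
  assume "\<not> P J"
  then have "\<exists>I\<in>{I. ideal I R \<and> \<not> P I}. \<forall>I'\<in>{I. ideal I R \<and> \<not> P I}. I \<subseteq> I' \<longrightarrow> I' = I"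
    using J by (intro maximal_ideal_among) auto
  then show False using step by blast
qed

context noetherian_local_domain
begin

lemma ideal_m: "ideal m R" and m_ne_carrier: "m \<noteq> carrier R"
  using local unfolding local_ring_def
  by (auto dest: maximalideal.axioms(1) maximalideal.I_notcarr)

lemma one_notin_m: "\<one> \<notin> m"
  using ideal.one_imp_carrier[OF ideal_m] m_ne_carrier by blast

lemma m_carrier: "x \<in> m \<Longrightarrow> x \<in> carrier R"
  using ideal.Icarr[OF ideal_m] .

lemma proper_ideal_le_m:
  assumes "ideal J R" "\<one> \<notin> J"
  shows "J \<subseteq> m"
proof -
  let ?A = "{I. ideal I R \<and> J \<subseteq> I \<and> \<one> \<notin> I}"
  have "J \<in> ?A" using assms by simp
  then have "\<exists>I\<in>?A. \<forall>I'\<in>?A. I \<subseteq> I' \<longrightarrow> I' = I"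
    by (intro maximal_ideal_among) blast+
  then obtain I where "I \<in> ?A" and M: "\<forall>I'\<in>?A. I \<subseteq> I' \<longrightarrow> I' = I" by (elim bexE)
  then have I: "ideal I R" "J \<subseteq> I" "\<one> \<notin> I" by simp_all
  have max: "I' = I" if "ideal I' R" "J \<subseteq> I'" "\<one> \<notin> I'" "I \<subseteq> I'" for I'
    using M that by simp
  have "maximalideal I R"
  proof (rule maximalidealI)
    show "carrier R \<noteq> I" using I by auto
    fix I' assume I': "ideal I' R" "I \<subseteq> I'" "I' \<subseteq> carrier R"
    show "I' = I \<or> I' = carrier R"
    proof (cases "\<one> \<in> I'")
      case True
      then show ?thesis using ideal.one_imp_carrier[OF I'(1)] by simp
    next
      case False
      then show ?thesis using max[OF I'(1) _ False I'(2)] I(2) I'(2) by auto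
    qed
  qed (rule I)
  then have "I = m" using local unfolding local_ring_def by blast
  then show ?thesis using I by simp
qed

lemma unit_if_notin_m:
  assumes "r \<in> carrier R" "r \<notin> m"
  shows "r \<in> Units R"
proof -
  have "r \<in> PIdl r" using assms by (rule_tac cgenideal_self)
  then have "\<one> \<in> PIdl r" using proper_ideal_le_m[OF cgenideal_ideal[OF assms(1)]] assms(2) by blast
  then obtain s where "s \<in> carrier R" "\<one> = s \<otimes> r" by (auto simp: cgenideal_def)
  then have "r divides \<one>" using m_comm[of s r] assms(1) by (intro dividesI[of s]) auto
  then show ?thesis using divides_one[OF assms(1)] by simp
qed

end

context one_dim_local_domain
begin

text \<open>
  If \<open>m\<close> were zero, so would be every prime ideal, and the dimension would be zero.
\<close>

lemma exists_nonzero_in_m: "\<exists>x\<in>m. x \<noteq> \<zero>"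
proof (rule ccontr)
  assume "\<not> ?thesis"
  moreover have "\<zero> \<in> m" by (rule additive_subgroup.zero_closed[OF ideal.axioms(1)[OF ideal_m]])
  ultimately have m0: "m = {\<zero>}" by blast
  have "n = 0" if "\<forall>i\<le>n. primeideal (P i) R" "\<forall>i<n. P i \<subset> P (Suc i)" for n and P :: "nat \<Rightarrow> 'a set"
  proof (rule ccontr)
    assume n: "n \<noteq> 0"
    have "P 0 \<subset> P 1" using that(2) n by simp
    have p: "primeideal (P 0) R" "primeideal (P 1) R" using that(1) n by simp_all
    have le: "P i \<subseteq> m" if "i \<le> 1" for i
    proof (rule proper_ideal_le_m)
      have "primeideal (P i) R" using p that by (cases i) simp_all
      then show "ideal (P i) R" "\<one> \<notin> P i"
        using primeideal.I_notcarr ideal.one_imp_carrier primeideal.axioms(1) by metis+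
    qed
    have "P 0 \<subseteq> m" "P 1 \<subseteq> m" using le by simp_all
    moreover have "\<zero> \<in> P 0"
      using p(1) primeideal.axioms(1) ideal.axioms(1) additive_subgroup.zero_closed by blast
    ultimately have "P 0 = P 1" using m0 \<open>P 0 \<subset> P 1\<close> by blast
    then show False using \<open>P 0 \<subset> P 1\<close> by simp
  qed
  then have "krull_dim R \<le> 0"
    unfolding krull_dim_def by (intro Sup_least) (clarsimp simp: zero_enat_def)
  then show False using dim_one by simp
qed

lemma nonzero_prime_eq_m:
  assumes P: "primeideal P R" and nz: "x \<in> P" "x \<noteq> \<zero>"
  shows "P = m"
proof (rule ccontr)
  assume ne: "P \<noteq> m"
  have id: "ideal P R" and "\<one> \<notin> P"
    using P primeideal.I_notcarr ideal.one_imp_carrier primeideal.axioms(1) by metis+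
  then have "P \<subseteq> m" by (rule proper_ideal_le_m)
  let ?C = "\<lambda>i::nat. if i = 0 then {\<zero>} else if i = 1 then P else m"
  have "primeideal m R"
    using local maximalideal_prime unfolding local_ring_def by blast
  moreover have "\<zero> \<in> P" using id ideal.axioms(1) additive_subgroup.zero_closed by blast
  ultimately have "(\<forall>i\<le>2. primeideal (?C i) R) \<and> (\<forall>i<2. ?C i \<subset> ?C (Suc i))"
    using P zeroprimeideal \<open>P \<subseteq> m\<close> ne nz by (auto simp: less_2_cases_iff)
  then have "enat 2 \<le> krull_dim R"
    unfolding krull_dim_def by (intro Sup_upper CollectI exI[of _ "2::nat"] exI[of _ ?C] conjI refl) simp_all
  then show False using dim_one by (simp add: one_enat_def)
qed

text \<open>
  Every nonzero prime being \<open>m\<close>, so is every associated prime of \<open>R / J\<close> for \<open>J \<noteq> 0\<close>; a maximal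
  annihilator is such a prime.
\<close>

lemma exists_colon_eq_m:
  assumes J: "ideal J R" "\<one> \<notin> J" and nz: "x \<in> J" "x \<noteq> \<zero>"
  shows "\<exists>y\<in>carrier R. y \<notin> J \<and> colon R (self_module R) J y = m"
proof -
  interpret S: module R "self_module R" by (rule self_module_module[OF is_cring])
  interpret J: ideal J R by (rule J(1))
  have Js: "submodule J R (self_module R)" using J ideal_iff_submodule[OF is_cring] by blast
  let ?A = "colon R (self_module R) J ` (carrier R - J)"
  have "x \<in> carrier R" using nz J.Icarr by blast
  have "\<one> \<in> carrier R - J" using J by simp
  then have "\<exists>P\<in>?A. \<forall>P'\<in>?A. P \<subseteq> P' \<longrightarrow> P' = P"
    using S.colon_ideal[OF Js] by (intro maximal_ideal_among) auto
  then obtain y where y: "y \<in> carrier R" "y \<notin> J"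
    and "\<forall>P'\<in>?A. colon R (self_module R) J y \<subseteq> P' \<longrightarrow> P' = colon R (self_module R) J y"
    by (elim bexE imageE) (simp, blast)
  then have max: "colon R (self_module R) J z = colon R (self_module R) J y"
    if "z \<in> carrier R" "z \<notin> J"
      "colon R (self_module R) J y \<subseteq> colon R (self_module R) J z" for z
    using that by simp
  let ?P = "colon R (self_module R) J y"
  have "primeideal ?P R"
  proof (rule primeidealI)
    show "ideal ?P R" using S.colon_ideal[OF Js] y by simp
    have "\<one> \<notin> ?P" using y by (simp add: colon_def)
    then show "carrier R \<noteq> ?P" by blast
    fix a b assume ab: "a \<in> carrier R" "b \<in> carrier R" "a \<otimes> b \<in> ?P"
    show "a \<in> ?P \<or> b \<in> ?P"
    proof (rule disjCI)
      \<comment> \<open>otherwise \<open>by\<close> would have an annihilator no smaller than \<open>y\<close>, hence the same one\<close>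
      assume "b \<notin> ?P"
      then have b: "b \<otimes> y \<notin> J" using ab by (simp add: colon_def)
      have "?P \<subseteq> colon R (self_module R) J (b \<otimes> y)"
      proof
        fix r assume r: "r \<in> ?P"
        then have "b \<otimes> (r \<otimes> y) \<in> J" using ab J.I_l_closed by (simp add: colon_def)
        then show "r \<in> colon R (self_module R) J (b \<otimes> y)"
          using r ab y m_lcomm[of b r y] by (simp add: colon_def)
      qed
      then have "colon R (self_module R) J (b \<otimes> y) = ?P" using max[of "b \<otimes> y"] b ab y by simp
      moreover have "a \<in> colon R (self_module R) J (b \<otimes> y)"
        using ab y by (simp add: colon_def m_assoc)
      ultimately show "a \<in> ?P" by simp
    qed
  qed (rule is_cring)
  moreover have "x \<in> ?P" using nz y J.I_r_closed J.Icarr by (simp add: colon_def)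
  ultimately show ?thesis using nonzero_prime_eq_m nz y by blast
qed

text \<open>
  In \<open>M / N\<close>, a torsion element has a multiple that spans a copy of the residue field.
\<close>

lemma exists_socle_multiple:
  assumes M: "module R M" and N: "submodule N R M" and y: "y \<in> carrier M" "y \<notin> N"
    and b: "b \<in> carrier R" "b \<noteq> \<zero>" "b \<odot>\<^bsub>M\<^esub> y \<in> N"
  shows "\<exists>s\<in>carrier R. s \<odot>\<^bsub>M\<^esub> y \<notin> N \<and> colon R M N (s \<odot>\<^bsub>M\<^esub> y) = m"
proof -
  interpret M: module R M by (rule M)
  have J: "ideal (colon R M N y) R" using M.colon_ideal N y by blast
  moreover have "\<one> \<notin> colon R M N y" using y by (simp add: colon_def)
  moreover have "b \<in> colon R M N y" using b by (simp add: colon_def)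
  ultimately obtain s where s: "s \<in> carrier R" "s \<notin> colon R M N y"
    "colon R (self_module R) (colon R M N y) s = m"
    using exists_colon_eq_m[of "colon R M N y" b] b(2) by blast
  have "s \<odot>\<^bsub>M\<^esub> y \<notin> N" using s by (simp add: colon_def)
  moreover have "colon R M N (s \<odot>\<^bsub>M\<^esub> y) = colon R (self_module R) (colon R M N y) s"
    using s y by (auto simp: colon_def M.smult_assoc1)
  ultimately show ?thesis using s by auto
qed

lemma interval_length_le_one:
  assumes M: "module R M" and N: "submodule N R M" and N': "submodule N' R M" "N \<subseteq> N'"
    and gen: "\<And>z z'. z \<in> N' \<Longrightarrow> z \<notin> N \<Longrightarrow> z' \<in> N' \<Longrightarrow>
      \<exists>r\<in>carrier R. \<exists>n\<in>N. z' = n \<oplus>\<^bsub>M\<^esub> r \<odot>\<^bsub>M\<^esub> z"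
  shows "interval_length R M N N' \<le> 1"
  unfolding interval_length_def
proof (rule chain_length_le_one)
  interpret M: module R M by (rule M)
  fix U assume "U \<in> {N. submodule N R M}" and NU: "N \<subseteq> U" and UN': "U \<subseteq> N'"
  then have U: "submodule U R M" by simp
  show "U = N \<or> U = N'"
  proof (rule disjCI)
    assume "U \<noteq> N'"
    have "z \<in> N" if z: "z \<in> U" for z
    proof (rule ccontr)
      assume zN: "z \<notin> N"
      have "N' \<subseteq> U"
      proof
        fix z' assume "z' \<in> N'"
        then obtain r n where "r \<in> carrier R" "n \<in> N" "z' = n \<oplus>\<^bsub>M\<^esub> r \<odot>\<^bsub>M\<^esub> z"
          using gen[of z z'] z zN UN' by blast
        then show "z' \<in> U"
          using M.submodule_add[OF U] M.submodule_smult[OF U] z NU by blast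
      qed
      then show False using UN' \<open>U \<noteq> N'\<close> by blast
    qed
    then show "U = N" using NU by blast
  qed
qed

text \<open>\<open>N + Ry / N\<close> is \<open>0\<close> or isomorphic to the residue field.\<close>

lemma interval_length_adjoin_socle:
  assumes M: "module R M" and N: "submodule N R M" and y: "y \<in> carrier M"
    and my: "\<And>a. a \<in> m \<Longrightarrow> a \<odot>\<^bsub>M\<^esub> y \<in> N"
  shows "interval_length R M N (N <+>\<^bsub>M\<^esub> cyclic_submodule R M y) \<le> 1"
proof (rule interval_length_le_one[OF M N])
  interpret M: module R M by (rule M)
  let ?N = "N <+>\<^bsub>M\<^esub> cyclic_submodule R M y"
  note cyc = M.submodule_cyclic[OF y]
  show "submodule ?N R M" using M.submodule_set_add[OF N cyc] .
  show "N \<subseteq> ?N" using M.set_add_upper(1)[OF N cyc] .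
  fix z z' assume z: "z \<in> ?N" "z \<notin> N" and z': "z' \<in> ?N"
  obtain n r where n: "n \<in> N" "r \<in> carrier R" "z = n \<oplus>\<^bsub>M\<^esub> r \<odot>\<^bsub>M\<^esub> y" using z M.mem_adjoin by blast
  obtain n' r' where n': "n' \<in> N" "r' \<in> carrier R" "z' = n' \<oplus>\<^bsub>M\<^esub> r' \<odot>\<^bsub>M\<^esub> y" using z' M.mem_adjoin by blast
  note car = M.submodule_carrier[OF N]
  have "r \<notin> m"
    using z(2) n my[of r] M.submodule_add[OF N] by auto
  then have ru: "r \<in> Units R" using unit_if_notin_m n by blast
  let ?s = "r' \<otimes> inv r"
  have s: "?s \<in> carrier R" using ru n' by simp
  have "?s \<odot>\<^bsub>M\<^esub> z = ?s \<odot>\<^bsub>M\<^esub> n \<oplus>\<^bsub>M\<^esub> (?s \<otimes> r) \<odot>\<^bsub>M\<^esub> y"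
    using n s car y by (simp add: M.smult_r_distr M.smult_assoc1)
  also have "?s \<otimes> r = r'" using ru n n' by (simp add: m_assoc)
  finally have sz: "?s \<odot>\<^bsub>M\<^esub> z = ?s \<odot>\<^bsub>M\<^esub> n \<oplus>\<^bsub>M\<^esub> r' \<odot>\<^bsub>M\<^esub> y" .
  let ?n = "n' \<ominus>\<^bsub>M\<^esub> ?s \<odot>\<^bsub>M\<^esub> n"
  have "?n \<in> N" using M.submodule_minus[OF N n'(1) M.submodule_smult[OF N s n(1)]] .
  moreover have "z' = ?n \<oplus>\<^bsub>M\<^esub> ?s \<odot>\<^bsub>M\<^esub> z"
  proof -
    have c: "n' \<in> carrier M" "?s \<odot>\<^bsub>M\<^esub> n \<in> carrier M" "r' \<odot>\<^bsub>M\<^esub> y \<in> carrier M"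
      using n n' s car y by auto
    have "?n \<oplus>\<^bsub>M\<^esub> ?s \<odot>\<^bsub>M\<^esub> z = n' \<oplus>\<^bsub>M\<^esub> (\<ominus>\<^bsub>M\<^esub> (?s \<odot>\<^bsub>M\<^esub> n) \<oplus>\<^bsub>M\<^esub> (?s \<odot>\<^bsub>M\<^esub> n \<oplus>\<^bsub>M\<^esub> r' \<odot>\<^bsub>M\<^esub> y))"
      unfolding sz M.minus_eq using c by (simp add: M.a_assoc)
    also have "\<dots> = n' \<oplus>\<^bsub>M\<^esub> r' \<odot>\<^bsub>M\<^esub> y" using c M.M.r_neg1 by simp
    finally show ?thesis using n' by simp
  qed
  ultimately show "\<exists>r\<in>carrier R. \<exists>n\<in>N. z' = n \<oplus>\<^bsub>M\<^esub> r \<odot>\<^bsub>M\<^esub> z" using s by blast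
qed

text \<open>
  By Noetherian induction: a proper ideal \<open>J \<noteq> 0\<close> has an extension \<open>J + Ry\<close> by a copy of the
  residue field.
\<close>

lemma finite_colength:
  assumes J: "ideal J R" and x: "x \<in> J" "x \<noteq> \<zero>"
  shows "interval_length R (self_module R) J (carrier R) \<noteq> \<infinity>"
  using J x(1)
proof (induction J rule: ideal_induct)
  case (ideal J)
  let ?S = "self_module R"
  have Sm: "module R ?S" by (rule self_module_module[OF is_cring])
  interpret S: module R ?S by (rule Sm)
  note iff = ideal_iff_submodule[OF is_cring]
  show ?case
  proof (cases "\<one> \<in> J")
    case True
    then have "J = carrier R" using ideal.one_imp_carrier[OF ideal(1)] by simp
    then show ?thesis by simp
  next
    case False
    then obtain y where y: "y \<in> carrier R" "y \<notin> J" "colon R ?S J y = m"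
      using exists_colon_eq_m[OF ideal(1) _ ideal.prems x(2)] by blast
    let ?J = "J <+>\<^bsub>?S\<^esub> cyclic_submodule R ?S y"
    have Js: "submodule J R ?S" using iff ideal(1) by simp
    have cy: "submodule (cyclic_submodule R ?S y) R ?S" using S.submodule_cyclic y by simp
    have J': "submodule ?J R ?S" using S.submodule_set_add[OF Js cy] .
    have sub: "J \<subset> ?J"
      using S.set_add_upper[OF Js cy] S.cyclic_self[of y] y by auto
    have le: "?J \<subseteq> carrier R" using S.submoduleE(1)[OF J'] by simp
    have cr: "submodule (carrier R) R ?S" using S.carrier_is_submodule by simp
    have le1: "interval_length R ?S J ?J \<le> 1"
      by (rule interval_length_adjoin_socle[OF Sm Js])
        (use y in \<open>auto simp: colon_def\<close>)
    have "interval_length R ?S J ?J \<noteq> \<infinity>" using le1 by (metis enat_ord_simps(5) infinity_ne_i1)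
    moreover have "interval_length R ?S ?J (carrier R) \<noteq> \<infinity>"
      using ideal.IH[of ?J] iff J' sub ideal.prems by auto
    moreover have "interval_length R ?S J (carrier R) =
        interval_length R ?S J ?J + interval_length R ?S ?J (carrier R)"
      by (rule S.interval_length_add) (use Js J' cr sub le in auto)
    ultimately show ?thesis by (simp add: plus_eq_infty_iff_enat)
  qed
qed

end

section \<open>Linear maps and injectivity\<close>

lemma (in abelian_group) minus_zero_right [simp]: "x \<in> carrier G \<Longrightarrow> x \<ominus> \<zero> = x"
  by (metis minus_eq r_zero add.inv_closed l_zero r_neg zero_closed)

lemma (in abelian_group) add_minus_cancel:
  assumes "a \<in> carrier G" "b \<in> carrier G"
  shows "a \<oplus> (b \<ominus> a) = b"
  using assms by (simp add: minus_eq a_lcomm[of a b] r_neg)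

text \<open>
  Maps defined on a subset of \<open>M\<close>, with arbitrary values outside: unlike elements of \<open>module_hom\<close>
  they can be extended and restricted without changing modules.
\<close>

definition linear_on ::
    "('a, 'm) ring_scheme \<Rightarrow> ('a, 'b) module \<Rightarrow> ('a, 'c) module \<Rightarrow> 'b set \<Rightarrow> ('b \<Rightarrow> 'c) \<Rightarrow> bool"
  where "linear_on R M K A f \<longleftrightarrow>
    (\<forall>x\<in>A. f x \<in> carrier K) \<and>
    (\<forall>x\<in>A. \<forall>y\<in>A. f (x \<oplus>\<^bsub>M\<^esub> y) = f x \<oplus>\<^bsub>K\<^esub> f y) \<and>
    (\<forall>r\<in>carrier R. \<forall>x\<in>A. f (r \<odot>\<^bsub>M\<^esub> x) = r \<odot>\<^bsub>K\<^esub> f x)"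

lemma linear_onD:
  assumes "linear_on R M K A f"
  shows "x \<in> A \<Longrightarrow> f x \<in> carrier K"
    and "x \<in> A \<Longrightarrow> y \<in> A \<Longrightarrow> f (x \<oplus>\<^bsub>M\<^esub> y) = f x \<oplus>\<^bsub>K\<^esub> f y"
    and "r \<in> carrier R \<Longrightarrow> x \<in> A \<Longrightarrow> f (r \<odot>\<^bsub>M\<^esub> x) = r \<odot>\<^bsub>K\<^esub> f x"
  using assms unfolding linear_on_def by auto

lemma linear_on_subset: "linear_on R M K A f \<Longrightarrow> B \<subseteq> A \<Longrightarrow> linear_on R M K B f"
  unfolding linear_on_def by blast

lemma linear_on_zero:
  assumes M: "module R M" and K: "module R K" and A: "submodule A R M" and f: "linear_on R M K A f"
  shows "f \<zero>\<^bsub>M\<^esub> = \<zero>\<^bsub>K\<^esub>"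
proof -
  interpret M: module R M by (rule M)
  interpret K: module R K by (rule K)
  have z: "\<zero>\<^bsub>M\<^esub> \<in> A" using M.submodule_zero[OF A] .
  have "f (\<zero>\<^bsub>R\<^esub> \<odot>\<^bsub>M\<^esub> \<zero>\<^bsub>M\<^esub>) = \<zero>\<^bsub>R\<^esub> \<odot>\<^bsub>K\<^esub> f \<zero>\<^bsub>M\<^esub>"
    using linear_onD(3)[OF f _ z] by blast
  then show ?thesis using linear_onD(1)[OF f z] by simp
qed

lemma linear_on_minus:
  assumes M: "module R M" and K: "module R K" and A: "submodule A R M" and f: "linear_on R M K A f"
    and x: "x \<in> A" and y: "y \<in> A"
  shows "f (x \<ominus>\<^bsub>M\<^esub> y) = f x \<ominus>\<^bsub>K\<^esub> f y"
proof -
  interpret M: module R M by (rule M)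
  interpret K: module R K by (rule K)
  have yc: "y \<in> carrier M" using M.submodule_carrier[OF A y] .
  have "\<ominus>\<^bsub>M\<^esub> y = (\<ominus>\<^bsub>R\<^esub> \<one>\<^bsub>R\<^esub>) \<odot>\<^bsub>M\<^esub> y" using M.smult_l_minus[of "\<one>\<^bsub>R\<^esub>" y] yc by simp
  then have "f (\<ominus>\<^bsub>M\<^esub> y) = (\<ominus>\<^bsub>R\<^esub> \<one>\<^bsub>R\<^esub>) \<odot>\<^bsub>K\<^esub> f y" using linear_onD(3)[OF f _ y] by simp
  then have "f (\<ominus>\<^bsub>M\<^esub> y) = \<ominus>\<^bsub>K\<^esub> f y"
    using K.smult_l_minus[of "\<one>\<^bsub>R\<^esub>" "f y"] linear_onD(1)[OF f y] by simp
  then show ?thesis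
    using linear_onD(2)[OF f x M.submodule_uminus[OF A y]]
    by (simp add: M.minus_eq K.minus_eq)
qed

lemma linear_on_ker:
  assumes M: "module R M" and K: "module R K" and A: "submodule A R M" and f: "linear_on R M K A f"
  shows "submodule {x \<in> A. f x = \<zero>\<^bsub>K\<^esub>} R M"
proof -
  interpret M: module R M by (rule M)
  interpret K: module R K by (rule K)
  show ?thesis
    by (rule M.submoduleI_no_uminus)
      (use M.submoduleE[OF A] M.submodule_zero[OF A] linear_on_zero[OF M K A f] linear_onD[OF f]
        in auto)
qed

lemma linear_on_module_hom: "f \<in> module_hom R M K \<Longrightarrow> linear_on R M K (carrier M) f"
  unfolding linear_on_def by (simp add: module_homD)

text \<open>
  A map on \<open>A\<close> extends to \<open>A + Ry\<close> with prescribed value \<open>k\<close> at \<open>y\<close> as soon as the relations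
  between \<open>y\<close> and \<open>A\<close> are respected.
\<close>

lemma linear_on_extend:
  assumes M: "module R M" and K: "module R K" and A: "submodule A R M"
    and f: "linear_on R M K A f" and y: "y \<in> carrier M" and k: "k \<in> carrier K"
    and rel: "\<forall>a\<in>carrier R. a \<odot>\<^bsub>M\<^esub> y \<in> A \<longrightarrow> f (a \<odot>\<^bsub>M\<^esub> y) = a \<odot>\<^bsub>K\<^esub> k"
  shows "\<exists>g. linear_on R M K (A <+>\<^bsub>M\<^esub> cyclic_submodule R M y) g \<and>
    (\<forall>x\<in>A. g x = f x) \<and> g y = k \<and>
    (\<forall>n\<in>A. \<forall>r\<in>carrier R. g (n \<oplus>\<^bsub>M\<^esub> r \<odot>\<^bsub>M\<^esub> y) = f n \<oplus>\<^bsub>K\<^esub> r \<odot>\<^bsub>K\<^esub> k)"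
proof -
  interpret M: module R M by (rule M)
  interpret K: module R K by (rule K)
  note car = M.submodule_carrier[OF A]
  note fc = linear_onD(1)[OF f]
  let ?A = "A <+>\<^bsub>M\<^esub> cyclic_submodule R M y"
  have wd: "f n \<oplus>\<^bsub>K\<^esub> r \<odot>\<^bsub>K\<^esub> k = f n' \<oplus>\<^bsub>K\<^esub> r' \<odot>\<^bsub>K\<^esub> k"
    if n: "n \<in> A" "n' \<in> A" and r: "r \<in> carrier R" "r' \<in> carrier R"
      and eq: "n \<oplus>\<^bsub>M\<^esub> r \<odot>\<^bsub>M\<^esub> y = n' \<oplus>\<^bsub>M\<^esub> r' \<odot>\<^bsub>M\<^esub> y" for n n' r r'
  proof -
    let ?a = "r \<oplus>\<^bsub>R\<^esub> \<ominus>\<^bsub>R\<^esub> r'"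
    let ?u = "r \<odot>\<^bsub>M\<^esub> y" and ?v = "r' \<odot>\<^bsub>M\<^esub> y"
    have c: "n \<in> carrier M" "n' \<in> carrier M" "?u \<in> carrier M" "?v \<in> carrier M"
      using n r y car by auto
    have ay: "?a \<odot>\<^bsub>M\<^esub> y = ?u \<oplus>\<^bsub>M\<^esub> \<ominus>\<^bsub>M\<^esub> ?v"
      using r y by (simp add: M.smult_l_distr M.smult_l_minus)
    have "n' \<ominus>\<^bsub>M\<^esub> n = (n' \<oplus>\<^bsub>M\<^esub> ?v) \<oplus>\<^bsub>M\<^esub> (\<ominus>\<^bsub>M\<^esub> ?v \<oplus>\<^bsub>M\<^esub> \<ominus>\<^bsub>M\<^esub> n)"
      using c by (simp add: M.minus_eq M.a_assoc M.r_neg2)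
    also have "\<dots> = (n \<oplus>\<^bsub>M\<^esub> ?u) \<oplus>\<^bsub>M\<^esub> (\<ominus>\<^bsub>M\<^esub> ?v \<oplus>\<^bsub>M\<^esub> \<ominus>\<^bsub>M\<^esub> n)" by (simp add: eq)
    also have "\<dots> = (?u \<oplus>\<^bsub>M\<^esub> \<ominus>\<^bsub>M\<^esub> ?v) \<oplus>\<^bsub>M\<^esub> (n \<oplus>\<^bsub>M\<^esub> \<ominus>\<^bsub>M\<^esub> n)"
      using c by (simp only: M.a_ac M.a_closed M.a_inv_closed)
    also have "\<dots> = ?a \<odot>\<^bsub>M\<^esub> y" using c ay by (simp add: M.r_neg)
    finally have d: "n' \<ominus>\<^bsub>M\<^esub> n = ?a \<odot>\<^bsub>M\<^esub> y" .
    have "?a \<odot>\<^bsub>M\<^esub> y \<in> A" using d M.submodule_minus[OF A n(2,1)] by simp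
    then have "?a \<odot>\<^bsub>K\<^esub> k = f (n' \<ominus>\<^bsub>M\<^esub> n)" using rel r d by simp
    also have "\<dots> = f n' \<ominus>\<^bsub>K\<^esub> f n" by (rule linear_on_minus[OF M K A f n(2,1)])
    finally have e: "f n' \<ominus>\<^bsub>K\<^esub> f n = r \<odot>\<^bsub>K\<^esub> k \<oplus>\<^bsub>K\<^esub> \<ominus>\<^bsub>K\<^esub> (r' \<odot>\<^bsub>K\<^esub> k)"
      using r k by (simp add: K.smult_l_distr K.smult_l_minus)
    have kc: "f n \<in> carrier K" "f n' \<in> carrier K" "r \<odot>\<^bsub>K\<^esub> k \<in> carrier K" "r' \<odot>\<^bsub>K\<^esub> k \<in> carrier K"
      using fc n r k by auto
    have "f n' \<oplus>\<^bsub>K\<^esub> r' \<odot>\<^bsub>K\<^esub> k = f n \<oplus>\<^bsub>K\<^esub> ((f n' \<ominus>\<^bsub>K\<^esub> f n) \<oplus>\<^bsub>K\<^esub> r' \<odot>\<^bsub>K\<^esub> k)"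
      using kc K.M.add_minus_cancel[of "f n" "f n'"] by (simp add: K.a_assoc[symmetric])
    also have "\<dots> = f n \<oplus>\<^bsub>K\<^esub> r \<odot>\<^bsub>K\<^esub> k"
      unfolding e using kc by (simp add: K.a_assoc K.l_neg)
    finally show ?thesis by simp
  qed
  define g where "g z = (SOME v. \<exists>n\<in>A. \<exists>r\<in>carrier R. z = n \<oplus>\<^bsub>M\<^esub> r \<odot>\<^bsub>M\<^esub> y \<and> v = f n \<oplus>\<^bsub>K\<^esub> r \<odot>\<^bsub>K\<^esub> k)" for z
  have gval: "g (n \<oplus>\<^bsub>M\<^esub> r \<odot>\<^bsub>M\<^esub> y) = f n \<oplus>\<^bsub>K\<^esub> r \<odot>\<^bsub>K\<^esub> k" if nr: "n \<in> A" "r \<in> carrier R" for n r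
    unfolding g_def
  proof (rule some_equality)
    show "\<exists>n'\<in>A. \<exists>r'\<in>carrier R. n \<oplus>\<^bsub>M\<^esub> r \<odot>\<^bsub>M\<^esub> y = n' \<oplus>\<^bsub>M\<^esub> r' \<odot>\<^bsub>M\<^esub> y \<and>
        f n \<oplus>\<^bsub>K\<^esub> r \<odot>\<^bsub>K\<^esub> k = f n' \<oplus>\<^bsub>K\<^esub> r' \<odot>\<^bsub>K\<^esub> k"
      using nr by blast
    show "v = f n \<oplus>\<^bsub>K\<^esub> r \<odot>\<^bsub>K\<^esub> k"
      if "\<exists>n'\<in>A. \<exists>r'\<in>carrier R. n \<oplus>\<^bsub>M\<^esub> r \<odot>\<^bsub>M\<^esub> y = n' \<oplus>\<^bsub>M\<^esub> r' \<odot>\<^bsub>M\<^esub> y \<and>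
        v = f n' \<oplus>\<^bsub>K\<^esub> r' \<odot>\<^bsub>K\<^esub> k" for v
      using that wd nr by metis
  qed
  show ?thesis
  proof (intro exI[of _ g] conjI ballI)
    show "g x = f x" if "x \<in> A" for x
      using gval[OF that, of "\<zero>\<^bsub>R\<^esub>"] car[OF that] fc[OF that] y k by simp
    have "\<zero>\<^bsub>M\<^esub> \<in> A" using M.submodule_zero[OF A] .
    then show "g y = k"
      using gval[of "\<zero>\<^bsub>M\<^esub>" "\<one>\<^bsub>R\<^esub>"] y k linear_on_zero[OF M K A f] by simp
    show "linear_on R M K ?A g"
      unfolding linear_on_def
    proof (intro conjI ballI)
      fix x assume "x \<in> ?A"
      then obtain n r where x: "n \<in> A" "r \<in> carrier R" "x = n \<oplus>\<^bsub>M\<^esub> r \<odot>\<^bsub>M\<^esub> y"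
        using M.mem_adjoin by blast
      then show "g x \<in> carrier K" using gval fc k by simp
      {
        fix x' assume "x' \<in> ?A"
        then obtain n' r' where x': "n' \<in> A" "r' \<in> carrier R" "x' = n' \<oplus>\<^bsub>M\<^esub> r' \<odot>\<^bsub>M\<^esub> y"
          using M.mem_adjoin by blast
        have "x \<oplus>\<^bsub>M\<^esub> x' = (n \<oplus>\<^bsub>M\<^esub> n') \<oplus>\<^bsub>M\<^esub> (r \<oplus>\<^bsub>R\<^esub> r') \<odot>\<^bsub>M\<^esub> y"
          using x x' car y by (simp add: M.smult_l_distr M.a_ac)
        then have "g (x \<oplus>\<^bsub>M\<^esub> x') = f (n \<oplus>\<^bsub>M\<^esub> n') \<oplus>\<^bsub>K\<^esub> (r \<oplus>\<^bsub>R\<^esub> r') \<odot>\<^bsub>K\<^esub> k"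
          using gval[of "n \<oplus>\<^bsub>M\<^esub> n'" "r \<oplus>\<^bsub>R\<^esub> r'"] x x' M.submodule_add[OF A] by simp
        also have "\<dots> = g x \<oplus>\<^bsub>K\<^esub> g x'"
          using x x' fc k gval linear_onD(2)[OF f] by (simp add: K.smult_l_distr K.a_ac)
        finally show "g (x \<oplus>\<^bsub>M\<^esub> x') = g x \<oplus>\<^bsub>K\<^esub> g x'" .
      }
      fix s assume s: "s \<in> carrier R"
      have "s \<odot>\<^bsub>M\<^esub> x = s \<odot>\<^bsub>M\<^esub> n \<oplus>\<^bsub>M\<^esub> (s \<otimes>\<^bsub>R\<^esub> r) \<odot>\<^bsub>M\<^esub> y"
        using x s car y by (simp add: M.smult_r_distr M.smult_assoc1)
      then have "g (s \<odot>\<^bsub>M\<^esub> x) = f (s \<odot>\<^bsub>M\<^esub> n) \<oplus>\<^bsub>K\<^esub> (s \<otimes>\<^bsub>R\<^esub> r) \<odot>\<^bsub>K\<^esub> k"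
        using gval[of "s \<odot>\<^bsub>M\<^esub> n" "s \<otimes>\<^bsub>R\<^esub> r"] x s M.submodule_smult[OF A] by simp
      also have "\<dots> = s \<odot>\<^bsub>K\<^esub> g x"
        using x s fc k gval linear_onD(3)[OF f] by (simp add: K.smult_r_distr K.smult_assoc1)
      finally show "g (s \<odot>\<^bsub>M\<^esub> x) = s \<odot>\<^bsub>K\<^esub> g x" .
    qed
  qed (rule gval)
qed

text \<open>
  Baer's criterion with an extension to \<open>R\<close> replaced by the image \<open>k\<close> of \<open>1\<close>. The cosyzygies to
  which it is applied are submodules \<open>K\<close> of the terms \<open>E\<close> of a resolution, so \<open>K\<close> is a set and need
  not be turned into a module.
\<close>

definition baer_injective :: "('a, 'm) ring_scheme \<Rightarrow> ('a, 'c) module \<Rightarrow> 'c set \<Rightarrow> bool"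
  where "baer_injective R E K \<longleftrightarrow>
    (\<forall>J f. ideal J R \<longrightarrow> linear_on R (self_module R) E J f \<longrightarrow> f ` J \<subseteq> K \<longrightarrow>
      (\<exists>k\<in>K. \<forall>x\<in>J. f x = x \<odot>\<^bsub>E\<^esub> k))"

lemma baer_injectiveD:
  assumes "baer_injective R E K" "ideal J R" "linear_on R (self_module R) E J f" "f ` J \<subseteq> K"
  obtains k where "k \<in> K" "\<And>x. x \<in> J \<Longrightarrow> f x = x \<odot>\<^bsub>E\<^esub> k"
  using assms unfolding baer_injective_def by blast

lemma baer_injective_carrier:
  assumes "cring R" "injective_module R E"
  shows "baer_injective R E (carrier E)"
  unfolding baer_injective_def
proof (intro allI impI)
  interpret cring R by fact
  interpret E: module R E using assms(2) by (simp add: injective_module_def)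
  fix J f assume J: "ideal J R" and f: "linear_on R (self_module R) E J f"
  interpret J: ideal J R by (rule J)
  have "restrict f J \<in> module_hom R (ideal_module R J) E"
    by (rule module_homI)
      (use linear_onD[OF f] J.I_l_closed in \<open>auto simp: ideal_module_def\<close>)
  then obtain g where g: "g \<in> module_hom R (self_module R) E" "\<forall>x\<in>J. g x = restrict f J x"
    using assms(2) J unfolding injective_module_def by blast
  have "f x = x \<odot>\<^bsub>E\<^esub> g \<one>\<^bsub>R\<^esub>" if "x \<in> J" for x
    using module_homD(4)[OF g(1), of x "\<one>\<^bsub>R\<^esub>"] g(2) that J.Icarr[OF that] by simp
  moreover have "g \<one>\<^bsub>R\<^esub> \<in> carrier E" using module_homD(2)[OF g(1)] by simp
  ultimately show "\<exists>k\<in>carrier E. \<forall>x\<in>J. f x = x \<odot>\<^bsub>E\<^esub> k" by blast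
qed

context one_dim_local_domain
begin

lemma module_self: "module R (self_module R)"
  by (rule self_module_module[OF is_cring])

lemma ideal_iff: "ideal J R \<longleftrightarrow> submodule J R (self_module R)"
  by (rule ideal_iff_submodule[OF is_cring])

text \<open>
  Since every proper nonzero ideal \<open>J\<close> is contained in some \<open>J + Ry\<close> with \<open>(J : y) = m\<close>, a map
  on \<open>J\<close> can be extended step by step once maps on \<open>m\<close> can be extended to \<open>R\<close>.
\<close>

lemma baer_injective_if_extends_from_m:
  assumes E: "module R E" and K: "submodule K R E"
    and ext: "\<And>f. linear_on R (self_module R) E m f \<Longrightarrow> f ` m \<subseteq> K \<Longrightarrow>
      \<exists>k\<in>K. \<forall>x\<in>m. f x = x \<odot>\<^bsub>E\<^esub> k"
  shows "baer_injective R E K"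
  unfolding baer_injective_def
proof (intro allI impI)
  fix J f assume "ideal J R" "linear_on R (self_module R) E J f" "f ` J \<subseteq> K"
  then show "\<exists>k\<in>K. \<forall>x\<in>J. f x = x \<odot>\<^bsub>E\<^esub> k"
  proof (induction J arbitrary: f rule: ideal_induct)
    case (ideal J)
    let ?S = "self_module R"
    interpret S: module R ?S by (rule module_self)
    interpret E: module R E by (rule E)
    interpret J: ideal J R by (rule ideal(1))
    note f = ideal.prems
    have Js: "submodule J R ?S" using ideal(1) ideal_iff by blast
    show ?case
    proof (cases "\<one> \<in> J")
      case True
      have "f x = x \<odot>\<^bsub>E\<^esub> f \<one>" if "x \<in> J" for x
        using linear_onD(3)[OF f(1) _ True, of x] J.Icarr[OF that] by simp
      then show ?thesis using True f(2) by blast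
    next
      case False
      show ?thesis
      proof (cases "\<exists>x\<in>J. x \<noteq> \<zero>")
        case False
        have "f \<zero> = \<zero>\<^bsub>E\<^esub>" using linear_on_zero[OF module_self E Js f(1)] by simp
        then have "\<forall>x\<in>J. f x = x \<odot>\<^bsub>E\<^esub> \<zero>\<^bsub>E\<^esub>" using False by auto
        then show ?thesis using E.submodule_zero[OF K] by blast
      next
        case True
        then obtain x where x: "x \<in> J" "x \<noteq> \<zero>" by blast
        obtain y where y: "y \<in> carrier R" "y \<notin> J" "colon R ?S J y = m"
          using exists_colon_eq_m[OF ideal(1) False x] by blast
        have my: "a \<otimes> y \<in> J" if "a \<in> m" for a
          using y(3) that by (auto simp: colon_def)
        have "linear_on R ?S E m (\<lambda>a. f (a \<otimes> y))"
          unfolding linear_on_def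
          using linear_onD[OF f(1)] my m_carrier y(1)
          by (simp add: l_distr m_assoc)
        moreover have "(\<lambda>a. f (a \<otimes> y)) ` m \<subseteq> K" using my f(2) by blast
        ultimately obtain k where k: "k \<in> K" "\<And>a. a \<in> m \<Longrightarrow> f (a \<otimes> y) = a \<odot>\<^bsub>E\<^esub> k"
          using ext by blast
        have kc: "k \<in> carrier E" using E.submodule_carrier[OF K k(1)] .
        let ?J = "J <+>\<^bsub>?S\<^esub> cyclic_submodule R ?S y"
        have rel: "\<forall>a\<in>carrier R. a \<odot>\<^bsub>?S\<^esub> y \<in> J \<longrightarrow> f (a \<odot>\<^bsub>?S\<^esub> y) = a \<odot>\<^bsub>E\<^esub> k"
          using k(2) y(3) by (auto simp: colon_def)
        have yS: "y \<in> carrier ?S" using y by simp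
        obtain g where g: "linear_on R ?S E ?J g" "\<forall>x\<in>J. g x = f x" "g y = k"
          "\<forall>n\<in>J. \<forall>r\<in>carrier R. g (n \<oplus>\<^bsub>?S\<^esub> r \<odot>\<^bsub>?S\<^esub> y) = f n \<oplus>\<^bsub>E\<^esub> r \<odot>\<^bsub>E\<^esub> k"
          using linear_on_extend[OF module_self E Js f(1) yS kc rel] by (elim exE conjE)
        have cy: "submodule (cyclic_submodule R ?S y) R ?S" using S.submodule_cyclic y by simp
        have J': "submodule ?J R ?S" using S.submodule_set_add[OF Js cy] .
        have sub: "J \<subset> ?J"
          using S.set_add_upper[OF Js cy] S.cyclic_self[of y] y by auto
        have "g ` ?J \<subseteq> K"
        proof
          fix v assume "v \<in> g ` ?J"
          then obtain z where "z \<in> ?J" and v: "v = g z" by blast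
          then obtain n r where nr: "n \<in> J" "r \<in> carrier R" and z: "z = n \<oplus>\<^bsub>?S\<^esub> r \<odot>\<^bsub>?S\<^esub> y"
            using S.mem_adjoin by blast
          have "f n \<in> K" using f(2) nr by blast
          then have "f n \<oplus>\<^bsub>E\<^esub> r \<odot>\<^bsub>E\<^esub> k \<in> K"
            using E.submodule_add[OF K] E.submodule_smult[OF K nr(2) k(1)] by blast
          then show "v \<in> K" using g(4) nr v z by simp
        qed
        then obtain k' where "k' \<in> K" "\<forall>x\<in>?J. g x = x \<odot>\<^bsub>E\<^esub> k'"
          using ideal.IH[of ?J g] J' sub ideal_iff g(1) by blast
        then show ?thesis using sub g(2) by (metis psubsetE subsetD)
      qed
    qed
  qed
qed

text \<open>
  The map \<open>J + Ry \<rightarrow> K\<close> that kills \<open>J\<close> and sends \<open>y\<close> to \<open>k\<close> is the multiplication by an element.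
\<close>

lemma baer_injective_adjoin:
  assumes E: "module R E" and K: "submodule K R E" "baer_injective R E K"
    and J: "ideal J R" and y: "y \<in> carrier R" and k: "k \<in> K"
    and rel: "\<And>a. a \<in> carrier R \<Longrightarrow> a \<otimes> y \<in> J \<Longrightarrow> a \<odot>\<^bsub>E\<^esub> k = \<zero>\<^bsub>E\<^esub>"
  obtains k' where "k' \<in> K" "\<And>x. x \<in> J \<Longrightarrow> x \<odot>\<^bsub>E\<^esub> k' = \<zero>\<^bsub>E\<^esub>" "y \<odot>\<^bsub>E\<^esub> k' = k"
proof -
  let ?S = "self_module R"
  interpret S: module R ?S by (rule module_self)
  interpret E: module R E by (rule E)
  have Js: "submodule J R ?S" using J ideal_iff by blast
  have yS: "y \<in> carrier ?S" using y by simp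
  have kc: "k \<in> carrier E" using E.submodule_carrier[OF K(1) k] .
  have f: "linear_on R ?S E J (\<lambda>_. \<zero>\<^bsub>E\<^esub>)" by (simp add: linear_on_def)
  let ?J = "J <+>\<^bsub>?S\<^esub> cyclic_submodule R ?S y"
  have r0: "\<forall>a\<in>carrier R. a \<odot>\<^bsub>?S\<^esub> y \<in> J \<longrightarrow> \<zero>\<^bsub>E\<^esub> = a \<odot>\<^bsub>E\<^esub> k"
    using rel by simp
  obtain g where g: "linear_on R ?S E ?J g" "\<forall>x\<in>J. g x = \<zero>\<^bsub>E\<^esub>" "g y = k"
    "\<forall>n\<in>J. \<forall>r\<in>carrier R. g (n \<oplus>\<^bsub>?S\<^esub> r \<odot>\<^bsub>?S\<^esub> y) = \<zero>\<^bsub>E\<^esub> \<oplus>\<^bsub>E\<^esub> r \<odot>\<^bsub>E\<^esub> k"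
    using linear_on_extend[OF module_self E Js f yS kc r0] by (elim exE conjE)
  have cy: "submodule (cyclic_submodule R ?S y) R ?S" using S.submodule_cyclic y by simp
  have J': "ideal ?J R" using S.submodule_set_add[OF Js cy] ideal_iff by simp
  have "g ` ?J \<subseteq> K"
  proof
    fix v assume "v \<in> g ` ?J"
    then obtain z where "z \<in> ?J" and v: "v = g z" by blast
    then obtain n r where nr: "n \<in> J" "r \<in> carrier R" and z: "z = n \<oplus>\<^bsub>?S\<^esub> r \<odot>\<^bsub>?S\<^esub> y"
      using S.mem_adjoin by blast
    then show "v \<in> K"
      using g(4) nr v z E.submodule_smult[OF K(1) nr(2) k] kc by simp
  qed
  then obtain k' where k': "k' \<in> K" "\<And>x. x \<in> ?J \<Longrightarrow> g x = x \<odot>\<^bsub>E\<^esub> k'"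
    using baer_injectiveD[OF K(2) J' g(1)] by blast
  have "J \<subseteq> ?J" "y \<in> ?J" using S.set_add_upper[OF Js cy] S.cyclic_self[OF yS] by auto
  then show thesis using that[of k'] k' g by (metis subsetD)
qed

lemma baer_injective_divisible:
  assumes E: "module R E" and K: "submodule K R E" "baer_injective R E K"
    and x: "x \<in> carrier R" "x \<noteq> \<zero>" and k: "k \<in> K"
  shows "\<exists>k'\<in>K. x \<odot>\<^bsub>E\<^esub> k' = k"
proof -
  interpret E: module R E by (rule E)
  have "a \<odot>\<^bsub>E\<^esub> k = \<zero>\<^bsub>E\<^esub>" if "a \<in> carrier R" "a \<otimes> x \<in> {\<zero>}" for a
    using that x integral[of a x] E.submodule_carrier[OF K(1) k] by auto
  then show ?thesis
    using baer_injective_adjoin[OF E K zeroideal x(1) k] by metis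
qed

lemma submodule_ker_module_hom:
  assumes "module R M" "module R N" "f \<in> module_hom R M N"
  shows "submodule {x \<in> carrier M. f x = \<zero>\<^bsub>N\<^esub>} R M"
  using linear_on_ker[OF assms(1,2) module.carrier_is_submodule[OF assms(1)]
      linear_on_module_hom[OF assms(3)]] .

text \<open>
  Injectivity passes to the kernel of a surjection if the kernel is divisible. Given \<open>f: m \<rightarrow> K\<close>,
  represented by \<open>e \<in> E\<close>, the obstruction is the element \<open>d e\<close>, which is killed by \<open>m\<close> and should lift to
  an element of \<open>E\<close> killed by \<open>m\<close>. Since \<open>R / m\<close> embeds into \<open>R / xR\<close> as the multiples of some \<open>y\<close>
  with \<open>(xR : y) = m\<close>, it is enough to lift elements killed by \<open>x\<close>, and this is divisibility.
\<close>

lemma baer_injective_kernel: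
  assumes E: "module R E" "baer_injective R E (carrier E)"
    and E': "module R E'" "submodule K' R E'" "baer_injective R E' K'"
    and d: "d \<in> module_hom R E E'" "d ` carrier E = K'"
    and K: "K = {x \<in> carrier E. d x = \<zero>\<^bsub>E'\<^esub>}"
    and div: "\<And>x k. x \<in> carrier R \<Longrightarrow> x \<noteq> \<zero> \<Longrightarrow> k \<in> K \<Longrightarrow> \<exists>k'\<in>K. x \<odot>\<^bsub>E\<^esub> k' = k"
  shows "baer_injective R E K"
proof -
  let ?S = "self_module R"
  interpret S: module R ?S by (rule module_self)
  interpret E: module R E by (rule E(1))
  interpret E': module R E' by (rule E'(1))
  have Ks: "submodule K R E" unfolding K by (rule submodule_ker_module_hom[OF E(1) E'(1) d(1)])
  note D = module_homD[OF d(1)]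
  have dl: "linear_on R E E' (carrier E) d" using linear_on_module_hom[OF d(1)] .
  note dminus = linear_on_minus[OF E(1) E'(1) E.carrier_is_submodule dl]
  show ?thesis
  proof (rule baer_injective_if_extends_from_m[OF E(1) Ks])
    fix f assume f: "linear_on R ?S E m f" "f ` m \<subseteq> K"
    have "f ` m \<subseteq> carrier E" using linear_onD(1)[OF f(1)] by blast
    then obtain e where e: "e \<in> carrier E" "\<And>a. a \<in> m \<Longrightarrow> f a = a \<odot>\<^bsub>E\<^esub> e"
      using baer_injectiveD[OF E(2) ideal_m f(1)] by blast
    have mde: "a \<odot>\<^bsub>E'\<^esub> d e = \<zero>\<^bsub>E'\<^esub>" if "a \<in> m" for a
    proof -
      have "a \<odot>\<^bsub>E\<^esub> e \<in> K" using e(2)[OF that] f(2) that by auto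
      then show ?thesis using D(4)[of a e] m_carrier[OF that] e(1) by (simp add: K)
    qed
    obtain x where x: "x \<in> m" "x \<noteq> \<zero>" using exists_nonzero_in_m by blast
    have xc: "x \<in> carrier R" using m_carrier x by blast
    have xI: "ideal (PIdl x) R" using cgenideal_ideal[OF xc] .
    have xx: "x \<in> PIdl x" using cgenideal_self[OF xc] .
    have "\<one> \<notin> PIdl x"
      using cgenideal_minimal[OF ideal_m x(1)] one_notin_m by blast
    then obtain y where y: "y \<in> carrier R" "y \<notin> PIdl x" "colon R ?S (PIdl x) y = m"
      using exists_colon_eq_m[OF xI _ xx x(2)] by blast
    have dK: "d e \<in> K'" using d(2) e(1) by blast
    have "a \<odot>\<^bsub>E'\<^esub> d e = \<zero>\<^bsub>E'\<^esub>" if "a \<in> carrier R" "a \<otimes> y \<in> PIdl x" for a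
    proof -
      have "a \<in> colon R ?S (PIdl x) y" using that by (simp add: colon_def)
      then show ?thesis using y(3) mde by blast
    qed
    then obtain e1' where e1': "e1' \<in> K'" "x \<odot>\<^bsub>E'\<^esub> e1' = \<zero>\<^bsub>E'\<^esub>" "y \<odot>\<^bsub>E'\<^esub> e1' = d e"
      using baer_injective_adjoin[OF E'(1,2,3) xI y(1) dK] xx by blast
    obtain e1 where e1: "e1 \<in> carrier E" "d e1 = e1'" using e1'(1) d(2) by blast
    \<comment> \<open>correct the lift \<open>e1\<close> by an element of \<open>K\<close> so that \<open>x\<close> kills it\<close>
    have "x \<odot>\<^bsub>E\<^esub> e1 \<in> K" using D(4)[OF xc e1(1)] e1 e1' xc by (simp add: K)
    then obtain k where k: "k \<in> K" "x \<odot>\<^bsub>E\<^esub> k = x \<odot>\<^bsub>E\<^esub> e1" using div[OF xc x(2)] by blast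
    have kc: "k \<in> carrier E" "d k = \<zero>\<^bsub>E'\<^esub>" using k(1) by (auto simp: K)
    let ?e2 = "e1 \<ominus>\<^bsub>E\<^esub> k"
    have e2: "?e2 \<in> carrier E" using e1 kc by simp
    have de2: "d ?e2 = e1'" using dminus[OF e1(1) kc(1)] kc(2) e1 D(2)[OF e1(1)] by simp
    have "x \<odot>\<^bsub>E\<^esub> ?e2 = x \<odot>\<^bsub>E\<^esub> e1 \<oplus>\<^bsub>E\<^esub> \<ominus>\<^bsub>E\<^esub> (x \<odot>\<^bsub>E\<^esub> k)"
      using xc e1 kc by (simp add: E.M.minus_eq E.smult_r_distr E.smult_r_minus)
    also have "\<dots> = \<zero>\<^bsub>E\<^esub>" using k(2) xc e1 by (simp add: E.M.r_neg)
    finally have xe2: "x \<odot>\<^bsub>E\<^esub> ?e2 = \<zero>\<^bsub>E\<^esub>" .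
    have aye2: "a \<odot>\<^bsub>E\<^esub> (y \<odot>\<^bsub>E\<^esub> ?e2) = \<zero>\<^bsub>E\<^esub>" if a: "a \<in> m" for a
    proof -
      have "a \<otimes> y \<in> PIdl x" using y(3) a by (auto simp: colon_def)
      then obtain r where r: "r \<in> carrier R" "a \<otimes> y = r \<otimes> x" by (auto simp: cgenideal_def)
      have "a \<odot>\<^bsub>E\<^esub> (y \<odot>\<^bsub>E\<^esub> ?e2) = (a \<otimes> y) \<odot>\<^bsub>E\<^esub> ?e2" using E.smult_assoc1 m_carrier[OF a] y(1) e2 by simp
      also have "\<dots> = r \<odot>\<^bsub>E\<^esub> (x \<odot>\<^bsub>E\<^esub> ?e2)" using r E.smult_assoc1 xc e2 by simp
      finally show ?thesis using xe2 r by simp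
    qed
    let ?k = "e \<ominus>\<^bsub>E\<^esub> y \<odot>\<^bsub>E\<^esub> ?e2"
    have ye2: "y \<odot>\<^bsub>E\<^esub> ?e2 \<in> carrier E" using y e2 by simp
    have "d ?k = d e \<ominus>\<^bsub>E'\<^esub> y \<odot>\<^bsub>E'\<^esub> e1'"
      using dminus[OF e(1) ye2] D(4)[OF y(1) e2] de2 by simp
    also have "\<dots> = \<zero>\<^bsub>E'\<^esub>" using e1'(3) D(2)[OF e(1)] by (simp add: E'.M.minus_eq E'.M.r_neg)
    finally have "?k \<in> K" using e ye2 by (simp add: K)
    moreover have "f a = a \<odot>\<^bsub>E\<^esub> ?k" if a: "a \<in> m" for a
    proof -
      have ac: "a \<in> carrier R" using m_carrier a by blast
      have "a \<odot>\<^bsub>E\<^esub> ?k = a \<odot>\<^bsub>E\<^esub> e \<ominus>\<^bsub>E\<^esub> (a \<odot>\<^bsub>E\<^esub> (y \<odot>\<^bsub>E\<^esub> ?e2))"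
        using ac e ye2 by (simp add: E.M.minus_eq E.smult_r_distr E.smult_r_minus)
      also have "\<dots> = a \<odot>\<^bsub>E\<^esub> e" using aye2[OF a] ac e by simp
      finally show ?thesis using e(2)[OF a] by simp
    qed
    ultimately show "\<exists>k\<in>K. \<forall>x\<in>m. f x = x \<odot>\<^bsub>E\<^esub> k" by blast
  qed
qed

text \<open>
  The cosyzygies of a finite injective resolution, from the first one on, are quotients of injective
  modules and therefore divisible, so that injectivity descends to them from the vanishing tail.
\<close>

lemma first_cosyzygy_injective:
  assumes res: "finite_injective_resolution R M E d e"
  shows "baer_injective R (E 1) {x \<in> carrier (E 1). d 1 x = \<zero>\<^bsub>E 2\<^esub>}"
proof -
  let ?K = "\<lambda>n. {x \<in> carrier (E n). d n x = \<zero>\<^bsub>E (Suc n)\<^esub>}"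
  have inj: "\<And>n. injective_module R (E n)" and dh: "\<And>n. d n \<in> module_hom R (E n) (E (Suc n))"
    and im: "\<And>n. d n ` carrier (E n) = ?K (Suc n)"
    using res unfolding finite_injective_resolution_def injective_resolution_def by auto
  have mE: "module R (E n)" for n using inj by (simp add: injective_module_def)
  have bE: "baer_injective R (E n) (carrier (E n))" for n
    using baer_injective_carrier[OF is_cring inj] .
  obtain N where N: "\<And>n. n > N \<Longrightarrow> carrier (E n) = {\<zero>\<^bsub>E n\<^esub>}"
    using res unfolding finite_injective_resolution_def by blast
  have sK: "submodule (?K n) R (E n)" for n
    by (rule submodule_ker_module_hom[OF mE mE dh])
  have "baer_injective R (E (Suc n)) (?K (Suc n))" for n
  proof (induction "Suc N - n" arbitrary: n)
    case 0
    then have c: "carrier (E (Suc n)) = {\<zero>\<^bsub>E (Suc n)\<^esub>}" using N by simp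
    have "?K (Suc n) = carrier (E (Suc n))"
      using module.submodule_zero[OF mE sK] c by auto
    then show ?case using bE by simp
  next
    case (Suc k)
    then have IH: "baer_injective R (E (Suc (Suc n))) (?K (Suc (Suc n)))" by simp
    show ?case
    proof (rule baer_injective_kernel[OF mE bE mE sK IH dh im refl])
      fix x k assume x: "x \<in> carrier R" "x \<noteq> \<zero>" and k: "k \<in> ?K (Suc n)"
      from k have "k \<in> d n ` carrier (E n)" unfolding im .
      then obtain z where z: "z \<in> carrier (E n)" "d n z = k" by blast
      obtain z' where z': "z' \<in> carrier (E n)" "x \<odot>\<^bsub>E n\<^esub> z' = z"
        using baer_injective_divisible[OF mE module.carrier_is_submodule[OF mE] bE x z(1)] by blast
      have "x \<odot>\<^bsub>E (Suc n)\<^esub> d n z' = k" using module_homD(4)[OF dh x(1) z'(1)] z z' by simp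
      moreover have "d n z' \<in> ?K (Suc n)" unfolding im[symmetric] using z' by blast
      ultimately show "\<exists>k'\<in>?K (Suc n). x \<odot>\<^bsub>E (Suc n)\<^esub> k' = k" by blast
    qed
  qed
  from this[of 0] show ?thesis by (simp add: numeral_2_eq_2)
qed

end

section \<open>The socle of the first cosyzygy\<close>

context one_dim_local_domain
begin

abbreviation residue :: "('a, 'a set) module" where "residue \<equiv> residue_module R m"

abbreviation residue_one :: "'a set" where "residue_one \<equiv> m +>\<^bsub>self_module R\<^esub> \<one>"

lemma submodule_m: "submodule m R (self_module R)"
  using ideal_m ideal_iff by blast

lemma module_residue: "module R residue"
  unfolding residue_module_def by (rule module_quot_module[OF module_self submodule_m])

lemma residue_smult_one:
  "r \<in> carrier R \<Longrightarrow> r \<odot>\<^bsub>residue\<^esub> residue_one = m +>\<^bsub>self_module R\<^esub> r"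
  using quot_module_smult[OF module_self submodule_m, of r \<one>] unfolding residue_module_def by simp

lemma residue_one_carrier: "residue_one \<in> carrier residue"
  unfolding residue_module_def by (auto simp: quot_module_simps[OF module_self submodule_m])

lemma residue_cases:
  assumes "A \<in> carrier residue"
  obtains r where "r \<in> carrier R" "A = r \<odot>\<^bsub>residue\<^esub> residue_one"
  using assms residue_smult_one unfolding residue_module_def
  by (auto simp: quot_module_simps[OF module_self submodule_m])

lemma residue_smult_one_eq_zero:
  assumes "r \<in> carrier R"
  shows "r \<odot>\<^bsub>residue\<^esub> residue_one = \<zero>\<^bsub>residue\<^esub> \<longleftrightarrow> r \<in> m"
  using coset_eq_self_iff[OF module_self submodule_m, of r] assms residue_smult_one[OF assms]
  unfolding residue_module_def by (simp add: quot_module_simps[OF module_self submodule_m])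

lemma residue_hom_eqI:
  assumes f: "f \<in> module_hom R residue E" and g: "g \<in> module_hom R residue E"
    and eq: "f residue_one = g residue_one"
  shows "f = g"
proof (rule extensionalityI)
  show "f \<in> extensional (carrier residue)" "g \<in> extensional (carrier residue)"
    using module_homD(1) f g by blast+
  fix A assume "A \<in> carrier residue"
  then obtain r where "r \<in> carrier R" "A = r \<odot>\<^bsub>residue\<^esub> residue_one" by (rule residue_cases)
  then show "f A = g A"
    using module_homD(4)[OF f] module_homD(4)[OF g] residue_one_carrier eq by simp
qed

lemma residue_hom_socle:
  assumes E: "module R E" and f: "f \<in> module_hom R residue E" and a: "a \<in> m"
  shows "a \<odot>\<^bsub>E\<^esub> f residue_one = \<zero>\<^bsub>E\<^esub>"
  using module_homD(4)[OF f m_carrier[OF a] residue_one_carrier]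
    residue_smult_one_eq_zero[OF m_carrier[OF a]] a module_hom_zero[OF module_residue E f]
  by simp

text \<open>
  Maps from the residue field to \<open>E\<close> are the same as elements of \<open>E\<close> killed by \<open>m\<close>.
\<close>

lemma residue_hom_exists:
  assumes E: "module R E" and u: "u \<in> carrier E" "\<And>a. a \<in> m \<Longrightarrow> a \<odot>\<^bsub>E\<^esub> u = \<zero>\<^bsub>E\<^esub>"
  shows "\<exists>f\<in>module_hom R residue E. f residue_one = u"
proof -
  interpret K: module R residue by (rule module_residue)
  interpret E: module R E by (rule E)
  let ?A = "{\<zero>\<^bsub>residue\<^esub>} <+>\<^bsub>residue\<^esub> cyclic_submodule R residue residue_one"
  have lin: "linear_on R residue E {\<zero>\<^bsub>residue\<^esub>} (\<lambda>_. \<zero>\<^bsub>E\<^esub>)"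
    by (simp add: linear_on_def)
  have rel: "\<forall>a\<in>carrier R. a \<odot>\<^bsub>residue\<^esub> residue_one \<in> {\<zero>\<^bsub>residue\<^esub>} \<longrightarrow> \<zero>\<^bsub>E\<^esub> = a \<odot>\<^bsub>E\<^esub> u"
    using residue_smult_one_eq_zero u(2) by simp
  obtain g where g: "linear_on R residue E ?A g" "g residue_one = u"
    using linear_on_extend[OF module_residue E K.submodule_zero_set lin residue_one_carrier u(1) rel]
    by (elim exE conjE)
  have cyc: "submodule (cyclic_submodule R residue residue_one) R residue"
    using K.submodule_cyclic[OF residue_one_carrier] .
  have "carrier residue \<subseteq> cyclic_submodule R residue residue_one"
    by (auto simp: cyclic_submodule_def elim!: residue_cases)
  then have le: "carrier residue \<subseteq> ?A"
    using K.set_add_upper(2)[OF K.submodule_zero_set cyc] by (rule order_trans)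
  have "restrict g (carrier residue) \<in> module_hom R residue E"
    by (rule module_homI)
      (use linear_onD[OF linear_on_subset[OF g(1) le]] K.smult_closed in auto)
  moreover have "restrict g (carrier residue) residue_one = u" using g(2) residue_one_carrier by simp
  ultimately show ?thesis by blast
qed

text \<open>
  Evaluation at the residue class of \<open>1\<close> identifies the cocycles with the socle \<open>Z\<close> of the kernel of
  \<open>d 1\<close>, and the coboundaries with the image \<open>B\<close> of the socle of \<open>E 0\<close>. As \<open>Ext\<^sup>1(R / m, M)\<close> has
  length one, \<open>Z / B\<close> is simple.
\<close>

lemma Ext_residue_socle:
  assumes E0: "module R (E 0)" and E1: "module R (E 1)" and E2: "module R (E 2)"
    and d0: "d 0 \<in> module_hom R (E 0) (E 1)" and d1: "d 1 \<in> module_hom R (E 1) (E 2)"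
    and dd: "\<forall>x\<in>carrier (E 0). d 1 (d 0 x) = \<zero>\<^bsub>E 2\<^esub>"
    and len: "module_length R (Ext R residue E d 1) = 1"
  defines "Z \<equiv> {u \<in> carrier (E 1). d 1 u = \<zero>\<^bsub>E 2\<^esub> \<and> (\<forall>a\<in>m. a \<odot>\<^bsub>E 1\<^esub> u = \<zero>\<^bsub>E 1\<^esub>)}"
    and "B \<equiv> d 0 ` {s \<in> carrier (E 0). \<forall>a\<in>m. a \<odot>\<^bsub>E 0\<^esub> s = \<zero>\<^bsub>E 0\<^esub>}"
  shows "\<exists>z\<in>Z. z \<notin> B"
    and "z \<in> Z \<Longrightarrow> z \<notin> B \<Longrightarrow> z' \<in> Z \<Longrightarrow> \<exists>r\<in>carrier R. \<exists>b\<in>B. z' = b \<oplus>\<^bsub>E 1\<^esub> r \<odot>\<^bsub>E 1\<^esub> z"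
proof -
  note One_nat_def [simp del]
  interpret E0: module R "E 0" by (rule E0)
  interpret E1: module R "E 1" by (rule E1)
  interpret E2: module R "E 2" by (rule E2)
  let ?H = "Hom_module R residue (E 1)"
  let ?C = "Ext_cocycles R residue E d 1"
  let ?D = "Ext_coboundaries R residue E d 1"
  have mH: "module R ?H" by (rule module_Hom_module[OF module_residue E1])
  interpret H: module R ?H by (rule mH)
  note D0 = module_homD[OF d0] and D1 = module_homD[OF d1]
  have C: "?C = {f \<in> module_hom R residue (E 1). \<forall>x\<in>carrier residue. d 1 (f x) = \<zero>\<^bsub>E 2\<^esub>}"
    by (simp add: Ext_cocycles_def numeral_2_eq_2 One_nat_def)
  have D: "?D = (\<lambda>g. compose (carrier residue) (d 0) g) ` module_hom R residue (E 0)"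
    by (simp add: Ext_coboundaries_def One_nat_def)
  have d10: "d 1 \<zero>\<^bsub>E 1\<^esub> = \<zero>\<^bsub>E 2\<^esub>" using module_hom_zero[OF E1 E2 d1] .
  have d00: "d 0 \<zero>\<^bsub>E 0\<^esub> = \<zero>\<^bsub>E 1\<^esub>" using module_hom_zero[OF E0 E1 d0] .
  have Cs: "submodule ?C R ?H"
  proof (rule H.submoduleI_no_uminus)
    show "?C \<subseteq> carrier ?H" by (auto simp: C)
    show "\<zero>\<^bsub>?H\<^esub> \<in> ?C" using H.M.zero_closed d10 by (auto simp: C)
    show "f \<oplus>\<^bsub>?H\<^esub> g \<in> ?C" if "f \<in> ?C" "g \<in> ?C" for f g
    proof -
      have h: "f \<in> module_hom R residue (E 1)" "g \<in> module_hom R residue (E 1)" using that C by auto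
      have "f \<oplus>\<^bsub>?H\<^esub> g \<in> module_hom R residue (E 1)" using H.M.add.m_closed[of f g] h by simp
      moreover have "d 1 ((f \<oplus>\<^bsub>?H\<^esub> g) x) = \<zero>\<^bsub>E 2\<^esub>" if "x \<in> carrier residue" for x
        using D1(3)[of "f x" "g x"] module_homD(2)[OF h(1) that] module_homD(2)[OF h(2) that]
          that \<open>f \<in> ?C\<close> \<open>g \<in> ?C\<close> by (simp add: C)
      ultimately show ?thesis by (simp add: C)
    qed
    show "r \<odot>\<^bsub>?H\<^esub> f \<in> ?C" if "r \<in> carrier R" "f \<in> ?C" for r f
    proof -
      have h: "f \<in> module_hom R residue (E 1)" using that C by auto
      have "r \<odot>\<^bsub>?H\<^esub> f \<in> module_hom R residue (E 1)" using H.smult_closed[of r f] h that(1) by simp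
      moreover have "d 1 ((r \<odot>\<^bsub>?H\<^esub> f) x) = \<zero>\<^bsub>E 2\<^esub>" if "x \<in> carrier residue" for x
        using D1(4)[of r "f x"] module_homD(2)[OF h that] that \<open>f \<in> ?C\<close> \<open>r \<in> carrier R\<close> by (simp add: C)
      ultimately show ?thesis by (simp add: C)
    qed
  qed
  have comp_hom: "compose (carrier residue) (d 0) g \<in> module_hom R residue (E 1)"
    if g: "g \<in> module_hom R residue (E 0)" for g
  proof -
    interpret K: module R residue by (rule module_residue)
    show ?thesis
      by (rule module_homI)
        (use module_homD[OF g] D0 K.smult_closed K.M.add.m_closed in \<open>auto simp: compose_def\<close>)
  qed
  have mem_D: "f \<in> ?D \<longleftrightarrow> f residue_one \<in> B" if f: "f \<in> module_hom R residue (E 1)" for f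
  proof
    assume "f \<in> ?D"
    then obtain g where g: "g \<in> module_hom R residue (E 0)" "f = compose (carrier residue) (d 0) g"
      by (auto simp: D)
    then have "f residue_one = d 0 (g residue_one)" using residue_one_carrier by (simp add: compose_def)
    moreover have "g residue_one \<in> carrier (E 0)"
      using module_homD(2)[OF g(1) residue_one_carrier] .
    ultimately show "f residue_one \<in> B" using residue_hom_socle[OF E0 g(1)] by (auto simp: B_def)
  next
    assume "f residue_one \<in> B"
    then obtain s where s: "s \<in> carrier (E 0)" "\<And>a. a \<in> m \<Longrightarrow> a \<odot>\<^bsub>E 0\<^esub> s = \<zero>\<^bsub>E 0\<^esub>"
      "f residue_one = d 0 s" by (auto simp: B_def)
    obtain g where g: "g \<in> module_hom R residue (E 0)" "g residue_one = s"
      using residue_hom_exists[OF E0 s(1,2)] by blast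
    have "f = compose (carrier residue) (d 0) g"
      using residue_hom_eqI[OF f comp_hom[OF g(1)]] residue_one_carrier g s by (simp add: compose_def)
    then show "f \<in> ?D" using g(1) by (auto simp: D)
  qed
  have mem_C: "f \<in> ?C \<longleftrightarrow> f residue_one \<in> Z" if f: "f \<in> module_hom R residue (E 1)" for f
  proof
    assume "f \<in> ?C"
    then show "f residue_one \<in> Z"
      using residue_hom_socle[OF E1 f] module_homD(2)[OF f residue_one_carrier] residue_one_carrier
      by (simp add: C Z_def)
  next
    assume z: "f residue_one \<in> Z"
    have "d 1 (f A) = \<zero>\<^bsub>E 2\<^esub>" if A: "A \<in> carrier residue" for A
    proof -
      obtain r where r: "r \<in> carrier R" "A = r \<odot>\<^bsub>residue\<^esub> residue_one"
        using residue_cases[OF A] by blast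
      then have "f A = r \<odot>\<^bsub>E 1\<^esub> f residue_one" using module_homD(4)[OF f r(1) residue_one_carrier] by simp
      then show ?thesis using D1(4)[OF r(1), of "f residue_one"] z r(1) by (simp add: Z_def)
    qed
    then show "f \<in> ?C" using f by (simp add: C)
  qed
  have Bs: "submodule B R (E 1)"
  proof (rule E1.submoduleI_no_uminus)
    show "B \<subseteq> carrier (E 1)" using D0(2) by (auto simp: B_def)
    show "\<zero>\<^bsub>E 1\<^esub> \<in> B" unfolding B_def
      by (rule image_eqI[of _ _ "\<zero>\<^bsub>E 0\<^esub>"]) (use d00 m_carrier in auto)
    show "x \<oplus>\<^bsub>E 1\<^esub> y \<in> B" if xy: "x \<in> B" "y \<in> B" for x y
    proof -
      obtain s t where st: "s \<in> carrier (E 0)" "t \<in> carrier (E 0)" "x = d 0 s" "y = d 0 t"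
        "\<forall>a\<in>m. a \<odot>\<^bsub>E 0\<^esub> s = \<zero>\<^bsub>E 0\<^esub>" "\<forall>a\<in>m. a \<odot>\<^bsub>E 0\<^esub> t = \<zero>\<^bsub>E 0\<^esub>"
        using xy by (auto simp: B_def)
      show ?thesis unfolding B_def
        by (rule image_eqI[of _ _ "s \<oplus>\<^bsub>E 0\<^esub> t"])
          (use st D0(3) m_carrier in \<open>auto simp: E0.smult_r_distr\<close>)
    qed
    show "r \<odot>\<^bsub>E 1\<^esub> x \<in> B" if rx: "r \<in> carrier R" "x \<in> B" for r x
    proof -
      obtain s where s: "s \<in> carrier (E 0)" "x = d 0 s" "\<forall>a\<in>m. a \<odot>\<^bsub>E 0\<^esub> s = \<zero>\<^bsub>E 0\<^esub>"
        using rx by (auto simp: B_def)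
      have "a \<odot>\<^bsub>E 0\<^esub> (r \<odot>\<^bsub>E 0\<^esub> s) = \<zero>\<^bsub>E 0\<^esub>" if a: "a \<in> m" for a
      proof -
        have "a \<odot>\<^bsub>E 0\<^esub> (r \<odot>\<^bsub>E 0\<^esub> s) = (r \<otimes> a) \<odot>\<^bsub>E 0\<^esub> s"
          using m_carrier[OF a] \<open>r \<in> carrier R\<close> s(1) by (simp add: E0.smult_assoc1[symmetric] m_comm)
        also have "\<dots> = \<zero>\<^bsub>E 0\<^esub>"
          using m_carrier[OF a] \<open>r \<in> carrier R\<close> s a by (simp add: E0.smult_assoc1)
        finally show ?thesis .
      qed
      then show ?thesis unfolding B_def
        by (intro image_eqI[of _ _ "r \<odot>\<^bsub>E 0\<^esub> s"]) (use s D0(4) rx(1) in auto)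
    qed
  qed
  have BZ: "B \<subseteq> Z"
  proof
    fix x assume "x \<in> B"
    then obtain s where s: "s \<in> carrier (E 0)" "x = d 0 s" "\<forall>a\<in>m. a \<odot>\<^bsub>E 0\<^esub> s = \<zero>\<^bsub>E 0\<^esub>"
      by (auto simp: B_def)
    have "a \<odot>\<^bsub>E 1\<^esub> x = \<zero>\<^bsub>E 1\<^esub>" if "a \<in> m" for a
      using D0(4)[OF m_carrier[OF that] s(1)] s that d00 by simp
    then show "x \<in> Z" using s dd D0(2) by (simp add: Z_def)
  qed
  have DH: "?D \<subseteq> module_hom R residue (E 1)" using comp_hom by (auto simp: D)
  then have DC: "?D \<subseteq> ?C" using mem_D mem_C BZ by blast
  have Ds: "submodule ?D R ?H"
  proof (rule H.submoduleI_no_uminus)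
    show "?D \<subseteq> carrier ?H" using DH by simp
    show "\<zero>\<^bsub>?H\<^esub> \<in> ?D"
      using mem_D[of "\<zero>\<^bsub>?H\<^esub>"] H.M.zero_closed E1.submodule_zero[OF Bs] residue_one_carrier by simp
    show "f \<oplus>\<^bsub>?H\<^esub> g \<in> ?D" if "f \<in> ?D" "g \<in> ?D" for f g
      using that mem_D[of f] mem_D[of g] mem_D[of "f \<oplus>\<^bsub>?H\<^esub> g"] H.M.add.m_closed[of f g] DH
        E1.submodule_add[OF Bs] residue_one_carrier by auto
    show "r \<odot>\<^bsub>?H\<^esub> f \<in> ?D" if "r \<in> carrier R" "f \<in> ?D" for r f
      using that mem_D[of f] mem_D[of "r \<odot>\<^bsub>?H\<^esub> f"] H.smult_closed[of r f] DH
        E1.submodule_smult[OF Bs] residue_one_carrier by auto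
  qed
  let ?H' = "?H\<lparr>carrier := ?C\<rparr>"
  have mH': "module R ?H'" using submodule.submodule_is_module[OF Cs mH] .
  interpret H': module R ?H' by (rule mH')
  have sub_iff: "submodule N R ?H' \<longleftrightarrow> submodule N R ?H \<and> N \<subseteq> ?C" for N
    by (rule submodule_restrict_carrier[OF mH Cs])
  have Ds': "submodule ?D R ?H'" using sub_iff Ds DC by blast
  have len1: "interval_length R ?H' ?D ?C = 1"
    using len module_length_quot_module[OF mH' Ds'] unfolding Ext_def by simp
  have "?D \<noteq> ?C" using len1 by auto
  then obtain f where f: "f \<in> ?C" "f \<notin> ?D" using DC by blast
  then have fh: "f \<in> module_hom R residue (E 1)" by (simp add: C)
  show "\<exists>z\<in>Z. z \<notin> B" using f mem_C[OF fh] mem_D[OF fh] by blast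
  assume z: "z \<in> Z" "z \<notin> B" and z': "z' \<in> Z"
  obtain f where f: "f \<in> module_hom R residue (E 1)" "f residue_one = z"
    using residue_hom_exists[OF E1, of z] z(1) by (auto simp: Z_def)
  obtain g where g: "g \<in> module_hom R residue (E 1)" "g residue_one = z'"
    using residue_hom_exists[OF E1, of z'] z' by (auto simp: Z_def)
  have fC: "f \<in> ?C" "f \<notin> ?D" using mem_C[OF f(1)] mem_D[OF f(1)] f(2) z by auto
  have gC: "g \<in> ?C" using mem_C[OF g(1)] g(2) z' by auto
  let ?N = "?D <+>\<^bsub>?H'\<^esub> cyclic_submodule R ?H' f"
  have cyc: "submodule (cyclic_submodule R ?H' f) R ?H'" using H'.submodule_cyclic fC by simp
  have N: "submodule ?N R ?H'" using H'.submodule_set_add[OF Ds' cyc] .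
  have up: "?D \<subseteq> ?N" "f \<in> ?N"
    using H'.set_add_upper[OF Ds' cyc] H'.cyclic_self[of f] fC by auto
  have "?N = ?D \<or> ?N = ?C"
    by (rule chain_length_less_two_cases[of "{N. submodule N R ?H'}"])
      (use len1 N Ds' up H'.carrier_is_submodule H'.submoduleE(1)[OF N] DC in
        \<open>auto simp: interval_length_def\<close>)
  then have "g \<in> ?N" using up fC gC by auto
  then obtain b r where br: "b \<in> ?D" "r \<in> carrier R" "g = b \<oplus>\<^bsub>?H'\<^esub> r \<odot>\<^bsub>?H'\<^esub> f"
    using H'.mem_adjoin by blast
  then have "z' = b residue_one \<oplus>\<^bsub>E 1\<^esub> r \<odot>\<^bsub>E 1\<^esub> z"
    using g f residue_one_carrier by auto
  moreover have "b residue_one \<in> B" using br(1) mem_D[of b] DH by auto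
  ultimately show "\<exists>r\<in>carrier R. \<exists>b\<in>B. z' = b \<oplus>\<^bsub>E 1\<^esub> r \<odot>\<^bsub>E 1\<^esub> z" using br(2) by blast
qed

end

section \<open>Canonical modules modulo a nonzero element\<close>

definition scaled :: "('a, 'b) module \<Rightarrow> 'a \<Rightarrow> 'b set \<Rightarrow> 'b set"
  where "scaled M x A = (\<lambda>w. x \<odot>\<^bsub>M\<^esub> w) ` A"

lemma submodule_scaled:
  assumes M: "module R M" and A: "submodule A R M" and x: "x \<in> carrier R"
  shows "submodule (scaled M x A) R M"
proof -
  interpret M: module R M by (rule M)
  note car = M.submodule_carrier[OF A]
  show ?thesis
  proof (rule M.submoduleI_no_uminus)
    show "scaled M x A \<subseteq> carrier M" using car x by (auto simp: scaled_def)
    show "\<zero>\<^bsub>M\<^esub> \<in> scaled M x A"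
      unfolding scaled_def using M.submodule_zero[OF A] x by (intro image_eqI[of _ _ "\<zero>\<^bsub>M\<^esub>"]) auto
    show "a \<oplus>\<^bsub>M\<^esub> b \<in> scaled M x A" if "a \<in> scaled M x A" "b \<in> scaled M x A" for a b
      using that M.submodule_add[OF A] car x M.smult_r_distr[OF x, symmetric]
      by (auto simp: scaled_def)
    fix r a assume r: "r \<in> carrier R" and "a \<in> scaled M x A"
    then obtain w where w: "w \<in> A" "a = x \<odot>\<^bsub>M\<^esub> w" by (auto simp: scaled_def)
    have "r \<odot>\<^bsub>M\<^esub> a = x \<odot>\<^bsub>M\<^esub> (r \<odot>\<^bsub>M\<^esub> w)"
      using w r x car by (simp add: M.smult_assoc1[symmetric] M.R.m_comm)
    then show "r \<odot>\<^bsub>M\<^esub> a \<in> scaled M x A"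
      using M.submodule_smult[OF A r w(1)] by (auto simp: scaled_def)
  qed
qed

text \<open>
  The properties of a canonical module \<open>W\<close> on which the whole argument rests: \<open>W\<close> is torsion-free,
  the socle of \<open>W / xW\<close> is simple, and the annihilator in \<open>W / xW\<close> of an ideal \<open>J\<close> containing \<open>x\<close>
  shrinks when \<open>J\<close> grows by a copy of the residue field. Here \<open>w\<close> stands for the fraction
  \<open>w / x\<close>, so that the annihilator of \<open>J\<close> is \<open>Hom(J, W)\<close>.
\<close>

locale canonical_over = one_dim_local_domain R m + W: module R W
  for R :: "('a, 'm) ring_scheme" (structure) and m and W :: "('a, 'w) module" +
  assumes torsion_free: "\<And>b w. b \<in> carrier R \<Longrightarrow> b \<noteq> \<zero> \<Longrightarrow> w \<in> carrier W \<Longrightarrow>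
      b \<odot>\<^bsub>W\<^esub> w = \<zero>\<^bsub>W\<^esub> \<Longrightarrow> w = \<zero>\<^bsub>W\<^esub>"
    and simple_socle: "\<And>x w w'. x \<in> m \<Longrightarrow> x \<noteq> \<zero> \<Longrightarrow> w \<in> carrier W \<Longrightarrow> w' \<in> carrier W \<Longrightarrow>
      (\<forall>a\<in>m. a \<odot>\<^bsub>W\<^esub> w \<in> scaled W x (carrier W)) \<Longrightarrow>
      (\<forall>a\<in>m. a \<odot>\<^bsub>W\<^esub> w' \<in> scaled W x (carrier W)) \<Longrightarrow>
      w \<notin> scaled W x (carrier W) \<Longrightarrow>
      \<exists>r\<in>carrier R. \<exists>v\<in>scaled W x (carrier W). w' = v \<oplus>\<^bsub>W\<^esub> r \<odot>\<^bsub>W\<^esub> w"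
    and separates: "\<And>J x z. ideal J R \<Longrightarrow> x \<in> J \<Longrightarrow> x \<noteq> \<zero> \<Longrightarrow> z \<in> carrier R \<Longrightarrow>
      colon R (self_module R) J z = m \<Longrightarrow>
      \<exists>w\<in>carrier W. (\<forall>j\<in>J. j \<odot>\<^bsub>W\<^esub> w \<in> scaled W x (carrier W)) \<and>
        z \<odot>\<^bsub>W\<^esub> w \<notin> scaled W x (carrier W)"
    and fin_gen: "finitely_generated_module R W"

context one_dim_local_domain
begin

text \<open>
  A torsion element would have a nonzero multiple killed by \<open>m\<close>, hence by a regular element.
\<close>

lemma torsion_free_if_depth_one:
  assumes M: "module R M" and depth: "module_depth R m M = 1"
    and b: "b \<in> carrier R" "b \<noteq> \<zero>" and w: "w \<in> carrier M" "b \<odot>\<^bsub>M\<^esub> w = \<zero>\<^bsub>M\<^esub>"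
  shows "w = \<zero>\<^bsub>M\<^esub>"
proof (rule ccontr)
  assume nz: "w \<noteq> \<zero>\<^bsub>M\<^esub>"
  interpret M: module R M by (rule M)
  have "\<exists>xs. set xs \<subseteq> m \<and> regular_sequence R M xs \<and> xs \<noteq> []"
  proof (rule ccontr)
    assume "\<not> ?thesis"
    then have "module_depth R m M \<le> 0"
      unfolding module_depth_def by (intro Sup_least) (auto simp: zero_enat_def)
    then show False using depth by simp
  qed
  then obtain x xs where x: "x \<in> m" and reg: "regular_sequence R M (x # xs)"
    by (metis list.exhaust list.set_intros(1) subsetD)
  have xc: "x \<in> carrier R" using m_carrier x by blast
  have span0: "sequence_submodule R M [] = {\<zero>\<^bsub>M\<^esub>}"
    unfolding sequence_submodule_def submodule_span_def
    using M.submodule_zero M.submodule_zero_set by auto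
  have xreg: "z = \<zero>\<^bsub>M\<^esub>" if "z \<in> carrier M" "x \<odot>\<^bsub>M\<^esub> z = \<zero>\<^bsub>M\<^esub>" for z
    using reg that span0 unfolding regular_sequence_def by force
  obtain s where s: "s \<in> carrier R" "s \<odot>\<^bsub>M\<^esub> w \<notin> {\<zero>\<^bsub>M\<^esub>}" "colon R M {\<zero>\<^bsub>M\<^esub>} (s \<odot>\<^bsub>M\<^esub> w) = m"
    using exists_socle_multiple[OF M M.submodule_zero_set w(1) _ b] nz w(2) by blast
  have "x \<odot>\<^bsub>M\<^esub> (s \<odot>\<^bsub>M\<^esub> w) = \<zero>\<^bsub>M\<^esub>" using s(3) x by (auto simp: colon_def)
  then show False using xreg[of "s \<odot>\<^bsub>M\<^esub> w"] s w(1) by simp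
qed

text \<open>
  View \<open>W\<close> as a submodule of \<open>E 0\<close>. If \<open>J w \<subseteq> xW\<close>, dividing by \<open>x\<close> gives a map \<open>J \<rightarrow> W\<close>, which by
  injectivity of \<open>E 0\<close> is the multiplication by some \<open>e\<close> with \<open>x e = w\<close>; the image of \<open>e\<close> in
  \<open>E 1\<close> is killed by \<open>J\<close>. For \<open>J = m\<close> this compares the socle of \<open>W / xW\<close> with the simple module
  of \<open>Ext_residue_socle\<close>. Conversely, if \<open>(J : z) = m\<close>, injectivity of the first cosyzygy
  provides an element that is killed by \<open>J\<close> and multiplied by \<open>z\<close> to a given socle element, and its
  preimage \<open>e\<close> yields \<open>w = x e\<close>.
\<close>

lemma canonical_over_if_canonical_module:
  assumes can: "canonical_module R m W"
  shows "canonical_over R m W"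
proof -
  note One_nat_def [simp del]
  obtain t E d \<epsilon> where t: "krull_dim R = enat t" "module_depth R m W = enat t"
    and fin: "finite_injective_resolution R W E d \<epsilon>"
    and len_t: "module_length R (Ext R residue E d t) = 1"
    using can unfolding canonical_module_def by (elim conjE exE)
  have "t = 1" using t(1) dim_one by (simp add: one_enat_def)
  then have depth: "module_depth R m W = 1" and len: "module_length R (Ext R residue E d 1) = 1"
    using t(2) len_t by (simp_all add: one_enat_def)
  have fg: "finitely_generated_module R W" using can unfolding canonical_module_def by blast
  then have mW: "module R W" unfolding finitely_generated_module_def by blast
  have inj: "\<And>n. injective_module R (E n)" and dh: "\<And>n. d n \<in> module_hom R (E n) (E (Suc n))"
    and \<epsilon>: "\<epsilon> \<in> module_hom R W (E 0)" and \<epsilon>inj: "inj_on \<epsilon> (carrier W)"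
    and im0: "\<epsilon> ` carrier W = {x \<in> carrier (E 0). d 0 x = \<zero>\<^bsub>E 1\<^esub>}"
    and im: "\<And>n. d n ` carrier (E n) = {x \<in> carrier (E (Suc n)). d (Suc n) x = \<zero>\<^bsub>E (Suc (Suc n))\<^esub>}"
    using fin unfolding finite_injective_resolution_def injective_resolution_def by simp_all
  have mE: "module R (E n)" for n using inj by (simp add: injective_module_def)
  let ?K = "{x \<in> carrier (E 1). d 1 x = \<zero>\<^bsub>E 2\<^esub>}"
  have im1: "d 0 ` carrier (E 0) = ?K" using im[of 0] by (simp add: One_nat_def numeral_2_eq_2)
  have d0: "d 0 \<in> module_hom R (E 0) (E 1)" and d1: "d 1 \<in> module_hom R (E 1) (E 2)"
    using dh[of 0] dh[of 1] by (simp_all add: One_nat_def numeral_2_eq_2)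
  have bK: "baer_injective R (E 1) ?K" by (rule first_cosyzygy_injective[OF fin])
  have sK: "submodule ?K R (E 1)" by (rule submodule_ker_module_hom[OF mE mE d1])
  have dd: "\<forall>x\<in>carrier (E 0). d 1 (d 0 x) = \<zero>\<^bsub>E 2\<^esub>" using im1 by blast
  define Z where "Z = {u \<in> carrier (E 1). d 1 u = \<zero>\<^bsub>E 2\<^esub> \<and> (\<forall>a\<in>m. a \<odot>\<^bsub>E 1\<^esub> u = \<zero>\<^bsub>E 1\<^esub>)}"
  define B where "B = d 0 ` {s \<in> carrier (E 0). \<forall>a\<in>m. a \<odot>\<^bsub>E 0\<^esub> s = \<zero>\<^bsub>E 0\<^esub>}"
  note soc = Ext_residue_socle[where E = E and d = d, OF mE mE mE d0 d1 dd len, folded Z_def B_def]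
  interpret W: module R W by (rule mW)
  interpret E0: module R "E 0" by (rule mE)
  interpret E1: module R "E 1" by (rule mE)
  note D = module_homD[OF \<epsilon>] and D0 = module_homD[OF d0]
  have l0: "linear_on R (E 0) (E 1) (carrier (E 0)) (d 0)" by (rule linear_on_module_hom[OF d0])
  note d0_minus = linear_on_minus[OF mE mE E0.carrier_is_submodule l0]
  have tf: "w = \<zero>\<^bsub>W\<^esub>" if "b \<in> carrier R" "b \<noteq> \<zero>" "w \<in> carrier W" "b \<odot>\<^bsub>W\<^esub> w = \<zero>\<^bsub>W\<^esub>" for b w
    using torsion_free_if_depth_one[OF mW depth that] .
  have cancel: "v = w" if x: "x \<in> carrier R" "x \<noteq> \<zero>" and vw: "v \<in> carrier W" "w \<in> carrier W"
    "x \<odot>\<^bsub>W\<^esub> v = x \<odot>\<^bsub>W\<^esub> w" for x v w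
  proof -
    have "x \<odot>\<^bsub>W\<^esub> (v \<ominus>\<^bsub>W\<^esub> w) = \<zero>\<^bsub>W\<^esub>"
      using x vw by (simp add: W.M.minus_eq W.smult_r_distr W.smult_r_minus W.M.r_neg)
    then have "v \<ominus>\<^bsub>W\<^esub> w = \<zero>\<^bsub>W\<^esub>" using tf[OF x, of "v \<ominus>\<^bsub>W\<^esub> w"] vw by simp
    then show ?thesis using vw by (simp add: W.M.minus_eq W.M.minus_equality W.M.minus_minus)
        (metis W.M.add_minus_cancel W.M.minus_eq W.M.r_zero)
  qed
  have ker: "e \<in> carrier (E 0) \<Longrightarrow> e' \<in> carrier (E 0) \<Longrightarrow> d 0 e = d 0 e' \<Longrightarrow>
      \<exists>v\<in>carrier W. e = e' \<oplus>\<^bsub>E 0\<^esub> \<epsilon> v" for e e'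
  proof -
    assume e: "e \<in> carrier (E 0)" "e' \<in> carrier (E 0)" "d 0 e = d 0 e'"
    have "d 0 (e \<ominus>\<^bsub>E 0\<^esub> e') = \<zero>\<^bsub>E 1\<^esub>"
      using d0_minus[OF e(1,2)] e(3) D0(2)[OF e(2)] by (simp add: E1.M.minus_eq E1.M.r_neg)
    then have "e \<ominus>\<^bsub>E 0\<^esub> e' \<in> \<epsilon> ` carrier W" using im0 e by simp
    then obtain v where "v \<in> carrier W" "e \<ominus>\<^bsub>E 0\<^esub> e' = \<epsilon> v" by blast
    then show ?thesis using E0.M.add_minus_cancel[OF e(2,1)] by metis
  qed
  have lift: "\<exists>e\<in>carrier (E 0). x \<odot>\<^bsub>E 0\<^esub> e = \<epsilon> w \<and> d 0 e \<in> Z"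
    if x: "x \<in> m" "x \<noteq> \<zero>" and w: "w \<in> carrier W"
      and mw: "\<forall>a\<in>m. a \<odot>\<^bsub>W\<^esub> w \<in> scaled W x (carrier W)" for x w
  proof -
    have xc: "x \<in> carrier R" using m_carrier x by blast
    have "\<forall>a\<in>m. \<exists>v\<in>carrier W. a \<odot>\<^bsub>W\<^esub> w = x \<odot>\<^bsub>W\<^esub> v" using mw by (auto simp: scaled_def)
    then obtain v where v: "\<And>a. a \<in> m \<Longrightarrow> v a \<in> carrier W" "\<And>a. a \<in> m \<Longrightarrow> a \<odot>\<^bsub>W\<^esub> w = x \<odot>\<^bsub>W\<^esub> v a"
      by metis
    interpret I: ideal m R by (rule ideal_m)
    have vadd: "v (a \<oplus> b) = v a \<oplus>\<^bsub>W\<^esub> v b" if ab: "a \<in> m" "b \<in> m" for a b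
    proof (rule cancel[OF xc x(2)])
      show "x \<odot>\<^bsub>W\<^esub> v (a \<oplus> b) = x \<odot>\<^bsub>W\<^esub> (v a \<oplus>\<^bsub>W\<^esub> v b)"
        using v(2)[of "a \<oplus> b"] v(2)[OF ab(1)] v(2)[OF ab(2)] v(1)[OF ab(1)] v(1)[OF ab(2)]
          I.a_closed[OF ab] ab m_carrier w xc
        by (simp add: W.smult_l_distr W.smult_r_distr)
    qed (use v ab in auto)
    have vsm: "v (r \<otimes> a) = r \<odot>\<^bsub>W\<^esub> v a" if ra: "r \<in> carrier R" "a \<in> m" for r a
    proof (rule cancel[OF xc x(2)])
      have "x \<odot>\<^bsub>W\<^esub> v (r \<otimes> a) = (r \<otimes> a) \<odot>\<^bsub>W\<^esub> w" using v(2)[of "r \<otimes> a"] ra I.I_l_closed by simp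
      also have "\<dots> = r \<odot>\<^bsub>W\<^esub> (x \<odot>\<^bsub>W\<^esub> v a)"
        using v(2)[of a] ra m_carrier w by (simp add: W.smult_assoc1)
      also have "\<dots> = x \<odot>\<^bsub>W\<^esub> (r \<odot>\<^bsub>W\<^esub> v a)"
        using ra v(1)[of a] xc by (simp add: W.smult_assoc1[symmetric] m_comm)
      finally show "x \<odot>\<^bsub>W\<^esub> v (r \<otimes> a) = x \<odot>\<^bsub>W\<^esub> (r \<odot>\<^bsub>W\<^esub> v a)" .
    qed (use v ra I.I_l_closed in auto)
    have "linear_on R (self_module R) (E 0) m (\<lambda>a. \<epsilon> (v a))"
      unfolding linear_on_def using v vadd vsm D by simp
    moreover have "(\<lambda>a. \<epsilon> (v a)) ` m \<subseteq> carrier (E 0)" using D(2) v by auto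
    ultimately obtain e where e: "e \<in> carrier (E 0)" "\<And>a. a \<in> m \<Longrightarrow> \<epsilon> (v a) = a \<odot>\<^bsub>E 0\<^esub> e"
      using baer_injectiveD[OF baer_injective_carrier[OF is_cring inj] ideal_m] by blast
    have "v x = w" using cancel[OF xc x(2), of "v x" w] v(1)[OF x(1)] v(2)[OF x(1)] w by simp
    then have "x \<odot>\<^bsub>E 0\<^esub> e = \<epsilon> w" using e(2)[OF x(1)] by simp
    moreover have "d 0 e \<in> Z"
    proof -
      have "a \<odot>\<^bsub>E 1\<^esub> d 0 e = \<zero>\<^bsub>E 1\<^esub>" if a: "a \<in> m" for a
      proof -
        have "a \<odot>\<^bsub>E 1\<^esub> d 0 e = d 0 (\<epsilon> (v a))" using D0(4)[OF m_carrier[OF a] e(1)] e(2)[OF a] by simp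
        also have "\<dots> = \<zero>\<^bsub>E 1\<^esub>" using im0 v(1)[OF a] by blast
        finally show ?thesis .
      qed
      then show ?thesis using dd e(1) D0(2)[OF e(1)] by (simp add: Z_def)
    qed
    ultimately show ?thesis using e(1) by blast
  qed
  show ?thesis
  proof (intro canonical_over.intro canonical_over_axioms.intro)
    show "one_dim_local_domain R m" by (rule one_dim_local_domain_axioms)
    show "module R W" by (rule mW)
    show "finitely_generated_module R W" by (rule fg)
    fix b w assume "b \<in> carrier R" "b \<noteq> \<zero>" "w \<in> carrier W" "b \<odot>\<^bsub>W\<^esub> w = \<zero>\<^bsub>W\<^esub>"
    then show "w = \<zero>\<^bsub>W\<^esub>" by (rule tf)
  next
    fix x w w'
    let ?xW = "scaled W x (carrier W)"
    assume x: "x \<in> m" "x \<noteq> \<zero>" and w: "w \<in> carrier W" "w' \<in> carrier W"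
      and mw: "\<forall>a\<in>m. a \<odot>\<^bsub>W\<^esub> w \<in> ?xW" "\<forall>a\<in>m. a \<odot>\<^bsub>W\<^esub> w' \<in> ?xW" and nw: "w \<notin> ?xW"
    have xc: "x \<in> carrier R" using m_carrier x by blast
    obtain e where e: "e \<in> carrier (E 0)" "x \<odot>\<^bsub>E 0\<^esub> e = \<epsilon> w" "d 0 e \<in> Z"
      using lift[OF x w(1) mw(1)] by blast
    obtain e' where e': "e' \<in> carrier (E 0)" "x \<odot>\<^bsub>E 0\<^esub> e' = \<epsilon> w'" "d 0 e' \<in> Z"
      using lift[OF x w(2) mw(2)] by blast
    \<comment> \<open>the image of \<open>e\<close> vanishes modulo \<open>B\<close> only if \<open>w\<close> lies in \<open>xW\<close>\<close>
    have "d 0 e \<notin> B"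
    proof
      assume "d 0 e \<in> B"
      then obtain s where s: "s \<in> carrier (E 0)" "\<forall>a\<in>m. a \<odot>\<^bsub>E 0\<^esub> s = \<zero>\<^bsub>E 0\<^esub>" "d 0 e = d 0 s"
        by (auto simp: B_def)
      obtain v where v: "v \<in> carrier W" "e = s \<oplus>\<^bsub>E 0\<^esub> \<epsilon> v" using ker[OF e(1) s(1,3)] by blast
      have "\<epsilon> w = \<epsilon> (x \<odot>\<^bsub>W\<^esub> v)"
        using e(2) v s x xc D(2)[OF v(1)] D(4)[OF xc v(1)] by (simp add: E0.smult_r_distr)
      then have "w = x \<odot>\<^bsub>W\<^esub> v" using \<epsilon>inj w v xc by (simp add: inj_on_eq_iff)
      then show False using nw v by (auto simp: scaled_def)
    qed
    then obtain r b where r: "r \<in> carrier R" "b \<in> B" "d 0 e' = b \<oplus>\<^bsub>E 1\<^esub> r \<odot>\<^bsub>E 1\<^esub> d 0 e"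
      using soc(2)[OF e(3) _ e'(3)] by blast
    obtain s where s: "s \<in> carrier (E 0)" "\<forall>a\<in>m. a \<odot>\<^bsub>E 0\<^esub> s = \<zero>\<^bsub>E 0\<^esub>" "b = d 0 s"
      using r(2) by (auto simp: B_def)
    have re: "r \<odot>\<^bsub>E 0\<^esub> e \<in> carrier (E 0)" using r e by simp
    have sre: "s \<oplus>\<^bsub>E 0\<^esub> r \<odot>\<^bsub>E 0\<^esub> e \<in> carrier (E 0)" using s re by simp
    have "d 0 e' = d 0 (s \<oplus>\<^bsub>E 0\<^esub> r \<odot>\<^bsub>E 0\<^esub> e)"
      using r s D0(3)[OF s(1) re] D0(4)[OF r(1) e(1)] by simp
    then obtain v where v: "v \<in> carrier W" "e' = s \<oplus>\<^bsub>E 0\<^esub> r \<odot>\<^bsub>E 0\<^esub> e \<oplus>\<^bsub>E 0\<^esub> \<epsilon> v"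
      using ker[OF e'(1) sre] by blast
    have "x \<odot>\<^bsub>E 0\<^esub> (r \<odot>\<^bsub>E 0\<^esub> e) = r \<odot>\<^bsub>E 0\<^esub> \<epsilon> w"
      using e(1,2) r xc by (metis E0.smult_assoc1 m_comm)
    then have "\<epsilon> w' = r \<odot>\<^bsub>E 0\<^esub> \<epsilon> w \<oplus>\<^bsub>E 0\<^esub> x \<odot>\<^bsub>E 0\<^esub> \<epsilon> v"
      using e'(2) v s x xc re sre r(1) D(2)[OF v(1)] D(2)[OF w(1)] by (simp add: E0.smult_r_distr)
    also have "\<dots> = \<epsilon> (x \<odot>\<^bsub>W\<^esub> v \<oplus>\<^bsub>W\<^esub> r \<odot>\<^bsub>W\<^esub> w)"
      using D v w r(1) xc by (simp add: E0.M.a_comm)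
    finally have "w' = x \<odot>\<^bsub>W\<^esub> v \<oplus>\<^bsub>W\<^esub> r \<odot>\<^bsub>W\<^esub> w"
      using \<epsilon>inj w v xc r(1) by (simp add: inj_on_eq_iff)
    then show "\<exists>r\<in>carrier R. \<exists>v\<in>?xW. w' = v \<oplus>\<^bsub>W\<^esub> r \<odot>\<^bsub>W\<^esub> w"
      using r(1) v(1) by (auto simp: scaled_def)
  next
    fix J x z
    let ?xW = "scaled W x (carrier W)"
    assume J: "ideal J R" and x: "x \<in> J" "x \<noteq> \<zero>" and z: "z \<in> carrier R"
      and col: "colon R (self_module R) J z = m"
    interpret J: ideal J R by (rule J)
    have xc: "x \<in> carrier R" using J.Icarr x by blast
    obtain z0 where z0: "z0 \<in> Z" "z0 \<notin> B" using soc(1) by blast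
    have z0K: "z0 \<in> ?K" using z0(1) by (simp add: Z_def)
    have rel: "a \<odot>\<^bsub>E 1\<^esub> z0 = \<zero>\<^bsub>E 1\<^esub>" if "a \<in> carrier R" "a \<otimes> z \<in> J" for a
    proof -
      have "a \<in> m" using col that by (auto simp: colon_def)
      then show ?thesis using z0(1) by (simp add: Z_def)
    qed
    obtain k where k: "k \<in> ?K" "\<And>j. j \<in> J \<Longrightarrow> j \<odot>\<^bsub>E 1\<^esub> k = \<zero>\<^bsub>E 1\<^esub>" "z \<odot>\<^bsub>E 1\<^esub> k = z0"
      using baer_injective_adjoin[OF mE sK bK J z z0K rel] by blast
    from k(1) obtain e where e: "e \<in> carrier (E 0)" "d 0 e = k" unfolding im1[symmetric] by blast
    have je: "\<exists>v\<in>carrier W. j \<odot>\<^bsub>E 0\<^esub> e = \<epsilon> v" if j: "j \<in> J" for j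
    proof -
      have "d 0 (j \<odot>\<^bsub>E 0\<^esub> e) = \<zero>\<^bsub>E 1\<^esub>" using D0(4)[OF J.Icarr[OF j] e(1)] e(2) k(2)[OF j] by simp
      then have "j \<odot>\<^bsub>E 0\<^esub> e \<in> \<epsilon> ` carrier W" using im0 e(1) J.Icarr[OF j] by simp
      then show ?thesis by blast
    qed
    obtain w where w: "w \<in> carrier W" "x \<odot>\<^bsub>E 0\<^esub> e = \<epsilon> w" using je[OF x(1)] by blast
    have "j \<odot>\<^bsub>W\<^esub> w \<in> ?xW" if j: "j \<in> J" for j
    proof -
      have jc: "j \<in> carrier R" using J.Icarr j by blast
      obtain v where v: "v \<in> carrier W" "j \<odot>\<^bsub>E 0\<^esub> e = \<epsilon> v" using je[OF j] by blast
      have "\<epsilon> (j \<odot>\<^bsub>W\<^esub> w) = j \<odot>\<^bsub>E 0\<^esub> (x \<odot>\<^bsub>E 0\<^esub> e)" using D(4)[OF jc w(1)] w(2) by simp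
      also have "\<dots> = x \<odot>\<^bsub>E 0\<^esub> (j \<odot>\<^bsub>E 0\<^esub> e)"
        using jc xc e(1) by (simp add: E0.smult_assoc1[symmetric] m_comm)
      also have "\<dots> = \<epsilon> (x \<odot>\<^bsub>W\<^esub> v)" using D(4)[OF xc v(1)] v(2) by simp
      finally have "j \<odot>\<^bsub>W\<^esub> w = x \<odot>\<^bsub>W\<^esub> v" using \<epsilon>inj jc xc w v by (simp add: inj_on_eq_iff)
      then show ?thesis using v(1) by (auto simp: scaled_def)
    qed
    moreover have "z \<odot>\<^bsub>W\<^esub> w \<notin> ?xW"
    proof
      assume "z \<odot>\<^bsub>W\<^esub> w \<in> ?xW"
      then obtain v where v: "v \<in> carrier W" "z \<odot>\<^bsub>W\<^esub> w = x \<odot>\<^bsub>W\<^esub> v" by (auto simp: scaled_def)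
      have \<epsilon>v: "\<epsilon> v \<in> carrier (E 0)" using D(2) v by blast
      have ze: "z \<odot>\<^bsub>E 0\<^esub> e \<in> carrier (E 0)" using z e by simp
      \<comment> \<open>a socle element of \<open>E 0\<close> that would map to \<open>z0\<close>\<close>
      let ?s = "z \<odot>\<^bsub>E 0\<^esub> e \<ominus>\<^bsub>E 0\<^esub> \<epsilon> v"
      have "a \<odot>\<^bsub>E 0\<^esub> ?s = \<zero>\<^bsub>E 0\<^esub>" if a: "a \<in> m" for a
      proof -
        have ac: "a \<in> carrier R" using m_carrier a by blast
        have "a \<otimes> z \<in> J" using col a by (auto simp: colon_def)
        then obtain v' where v': "v' \<in> carrier W" "(a \<otimes> z) \<odot>\<^bsub>E 0\<^esub> e = \<epsilon> v'" using je by blast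
        have "\<epsilon> (x \<odot>\<^bsub>W\<^esub> v') = x \<odot>\<^bsub>E 0\<^esub> ((a \<otimes> z) \<odot>\<^bsub>E 0\<^esub> e)" using D(4)[OF xc v'(1)] v'(2) by simp
        also have "\<dots> = (a \<otimes> z) \<odot>\<^bsub>E 0\<^esub> (x \<odot>\<^bsub>E 0\<^esub> e)"
          using ac z xc e(1) by (simp add: E0.smult_assoc1[symmetric] m_comm)
        also have "\<dots> = \<epsilon> ((a \<otimes> z) \<odot>\<^bsub>W\<^esub> w)" using D(4)[of "a \<otimes> z" w] w ac z by simp
        finally have "x \<odot>\<^bsub>W\<^esub> v' = (a \<otimes> z) \<odot>\<^bsub>W\<^esub> w" using \<epsilon>inj ac z xc w v' by (simp add: inj_on_eq_iff)
        also have "\<dots> = a \<odot>\<^bsub>W\<^esub> (x \<odot>\<^bsub>W\<^esub> v)" using ac z w v by (simp add: W.smult_assoc1)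
        also have "\<dots> = x \<odot>\<^bsub>W\<^esub> (a \<odot>\<^bsub>W\<^esub> v)" using ac xc v(1) by (simp add: W.smult_assoc1[symmetric] m_comm)
        finally have "v' = a \<odot>\<^bsub>W\<^esub> v" using cancel[OF xc x(2), of v' "a \<odot>\<^bsub>W\<^esub> v"] v' v ac by simp
        then have "a \<odot>\<^bsub>E 0\<^esub> (z \<odot>\<^bsub>E 0\<^esub> e) = a \<odot>\<^bsub>E 0\<^esub> \<epsilon> v"
          using v'(2) D(4)[OF ac v(1)] ac z e(1) by (simp add: E0.smult_assoc1)
        then show ?thesis using ac ze \<epsilon>v
          by (simp add: E0.M.minus_eq E0.smult_r_distr E0.smult_r_minus E0.M.r_neg)
      qed
      moreover have "d 0 ?s = z0"
      proof -
        have "d 0 (\<epsilon> v) = \<zero>\<^bsub>E 1\<^esub>" using im0 v(1) by blast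
        then show ?thesis
          using d0_minus[OF ze \<epsilon>v] D0(4)[OF z e(1)] e(2) k(3) z0K by simp
      qed
      moreover have "?s \<in> carrier (E 0)" using ze \<epsilon>v by simp
      ultimately have "z0 \<in> B" unfolding B_def by blast
      then show False using z0(2) by simp
    qed
    ultimately show "\<exists>w\<in>carrier W. (\<forall>j\<in>J. j \<odot>\<^bsub>W\<^esub> w \<in> ?xW) \<and> z \<odot>\<^bsub>W\<^esub> w \<notin> ?xW" using w(1) by blast
  qed
qed

end

context canonical_over
begin

text \<open>
  Every step of a composition series from an ideal \<open>J\<close> up to \<open>R\<close> enlarges the annihilator of the
  ideal in \<open>W / xW\<close> by at most a copy of the residue field, because the socle of \<open>W / xW\<close> is simple.
\<close>

lemma length_quotient_le:
  assumes x: "x \<in> m" "x \<noteq> \<zero>"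
  shows "interval_length R W (scaled W x (carrier W)) (carrier W)
    \<le> interval_length R (self_module R) (PIdl x) (carrier R)"
proof -
  let ?S = "self_module R"
  let ?xW = "scaled W x (carrier W)"
  let ?D = "\<lambda>J. {w \<in> carrier W. \<forall>j\<in>J. j \<odot>\<^bsub>W\<^esub> w \<in> ?xW}"
  interpret S: module R ?S by (rule module_self)
  have xc: "x \<in> carrier R" using m_carrier x by blast
  have xWs: "submodule ?xW R W"
    by (rule submodule_scaled[OF W.module_axioms W.carrier_is_submodule xc])
  have Ds: "submodule (?D J) R W" if J: "ideal J R" for J
  proof -
    interpret J: ideal J R by (rule J)
    show ?thesis
    proof (rule W.submoduleI_no_uminus)
      show "\<zero>\<^bsub>W\<^esub> \<in> ?D J" using W.submodule_zero[OF xWs] J.Icarr by simp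
      show "a \<oplus>\<^bsub>W\<^esub> b \<in> ?D J" if "a \<in> ?D J" "b \<in> ?D J" for a b
        using that W.submodule_add[OF xWs] J.Icarr by (simp add: W.smult_r_distr)
      fix r a assume r: "r \<in> carrier R" and a: "a \<in> ?D J"
      have "j \<odot>\<^bsub>W\<^esub> (r \<odot>\<^bsub>W\<^esub> a) \<in> ?xW" if j: "j \<in> J" for j
      proof -
        have "j \<odot>\<^bsub>W\<^esub> (r \<odot>\<^bsub>W\<^esub> a) = (j \<otimes> r) \<odot>\<^bsub>W\<^esub> a"
          using r a J.Icarr[OF j] by (simp add: W.smult_assoc1)
        then show ?thesis using a J.I_r_closed[OF j r] by simp
      qed
      then show "r \<odot>\<^bsub>W\<^esub> a \<in> ?D J" using r a by simp
    qed auto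
  qed
  have xWD: "?xW \<subseteq> ?D J" if J: "ideal J R" for J
  proof -
    interpret J: ideal J R by (rule J)
    show ?thesis
      using W.submodule_smult[OF xWs] J.Icarr W.submodule_carrier[OF xWs] by auto
  qed
  have main: "x \<in> J \<Longrightarrow> interval_length R W ?xW (?D J) \<le> interval_length R ?S J (carrier R)"
    if "ideal J R" for J
    using that
  proof (induction J rule: ideal_induct)
    case (ideal J)
    interpret J: ideal J R by (rule ideal(1))
    show ?case
    proof (cases "\<one> \<in> J")
      case True
      have "?D J \<subseteq> ?xW"
      proof
        fix w assume "w \<in> ?D J"
        then have "\<one> \<odot>\<^bsub>W\<^esub> w \<in> ?xW" "w \<in> carrier W" using True by blast+
        then show "w \<in> ?xW" by simp
      qed
      then have "interval_length R W ?xW (?D J) \<le> interval_length R W ?xW ?xW"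
        by (intro W.interval_length_mono) auto
      then show ?thesis by simp
    next
      case False
      then obtain y where y: "y \<in> carrier R" "y \<notin> J" "colon R ?S J y = m"
        using exists_colon_eq_m[OF ideal(1) _ ideal.prems x(2)] by blast
      let ?J = "J <+>\<^bsub>?S\<^esub> cyclic_submodule R ?S y"
      have Js: "submodule J R ?S" using ideal_iff ideal(1) by simp
      have cy: "submodule (cyclic_submodule R ?S y) R ?S" using S.submodule_cyclic y by simp
      have J': "submodule ?J R ?S" using S.submodule_set_add[OF Js cy] .
      have J'i: "ideal ?J R" using J' ideal_iff by simp
      have sub: "J \<subset> ?J" "y \<in> ?J"
        using S.set_add_upper[OF Js cy] S.cyclic_self[of y] y by auto
      have le: "?J \<subseteq> carrier R" using S.submoduleE(1)[OF J'] by simp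
      have cr: "submodule (carrier R) R ?S" using S.carrier_is_submodule by simp
      have my: "a \<otimes> y \<in> J" if "a \<in> m" for a using y(3) that by (auto simp: colon_def)
      have DD: "?D ?J \<subseteq> ?D J" using sub by auto
      have memD: "w \<in> ?D ?J" if w: "w \<in> ?D J" "y \<odot>\<^bsub>W\<^esub> w \<in> ?xW" for w
      proof -
        have wc: "w \<in> carrier W" using w by simp
        have "j \<odot>\<^bsub>W\<^esub> w \<in> ?xW" if j: "j \<in> ?J" for j
        proof -
          obtain n r where nr: "n \<in> J" "r \<in> carrier R" "j = n \<oplus> r \<otimes> y"
            using j S.mem_adjoin[of j J y] by auto
          then have "j \<odot>\<^bsub>W\<^esub> w = n \<odot>\<^bsub>W\<^esub> w \<oplus>\<^bsub>W\<^esub> r \<odot>\<^bsub>W\<^esub> (y \<odot>\<^bsub>W\<^esub> w)"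
            using y(1) wc J.Icarr by (simp add: W.smult_l_distr W.smult_assoc1)
          then show ?thesis
            using w nr W.submodule_add[OF xWs] W.submodule_smult[OF xWs] by simp
        qed
        then show ?thesis using wc by simp
      qed
      have my_soc: "\<forall>a\<in>m. a \<odot>\<^bsub>W\<^esub> (y \<odot>\<^bsub>W\<^esub> w) \<in> ?xW" if "w \<in> ?D J" for w
      proof
        fix a assume a: "a \<in> m"
        then have "a \<odot>\<^bsub>W\<^esub> (y \<odot>\<^bsub>W\<^esub> w) = (a \<otimes> y) \<odot>\<^bsub>W\<^esub> w"
          using m_carrier y that by (simp add: W.smult_assoc1)
        then show "a \<odot>\<^bsub>W\<^esub> (y \<odot>\<^bsub>W\<^esub> w) \<in> ?xW" using my[OF a] that by simp
      qed
      have l1: "interval_length R W (?D ?J) (?D J) \<le> 1"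
      proof (rule interval_length_le_one[OF W.module_axioms Ds[OF J'i] Ds[OF ideal(1)] DD])
        fix w w' assume w: "w \<in> ?D J" "w \<notin> ?D ?J" and w': "w' \<in> ?D J"
        have wc: "w \<in> carrier W" "w' \<in> carrier W" using w w' by simp_all
        have "y \<odot>\<^bsub>W\<^esub> w \<notin> ?xW" using memD w by blast
        then obtain r v where rv: "r \<in> carrier R" "v \<in> ?xW" "y \<odot>\<^bsub>W\<^esub> w' = v \<oplus>\<^bsub>W\<^esub> r \<odot>\<^bsub>W\<^esub> (y \<odot>\<^bsub>W\<^esub> w)"
          using simple_socle[OF x, of "y \<odot>\<^bsub>W\<^esub> w" "y \<odot>\<^bsub>W\<^esub> w'"] my_soc[OF w(1)] my_soc[OF w'] wc y(1)
          by blast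
        have vc: "v \<in> carrier W" using W.submodule_carrier[OF xWs rv(2)] .
        let ?n = "w' \<ominus>\<^bsub>W\<^esub> r \<odot>\<^bsub>W\<^esub> w"
        have rw: "r \<odot>\<^bsub>W\<^esub> w \<in> ?D J" using W.submodule_smult[OF Ds[OF ideal(1)] rv(1) w(1)] .
        have nD: "?n \<in> ?D J" using W.submodule_minus[OF Ds[OF ideal(1)] w' rw] .
        have "y \<odot>\<^bsub>W\<^esub> (r \<odot>\<^bsub>W\<^esub> w) = r \<odot>\<^bsub>W\<^esub> (y \<odot>\<^bsub>W\<^esub> w)"
          using y rv(1) wc by (simp add: W.smult_assoc1[symmetric] m_comm)
        then have "y \<odot>\<^bsub>W\<^esub> ?n = v"
          using y rv wc vc by (simp add: W.M.minus_eq W.smult_r_distr W.smult_r_minus W.M.a_assoc W.M.r_neg)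
        then have "?n \<in> ?D ?J" using memD nD rv(2) by blast
        moreover have "w' = ?n \<oplus>\<^bsub>W\<^esub> r \<odot>\<^bsub>W\<^esub> w"
          using W.M.add_minus_cancel[of "r \<odot>\<^bsub>W\<^esub> w" w'] wc rv(1) by (simp add: W.M.a_comm)
        ultimately show "\<exists>r\<in>carrier R. \<exists>n\<in>?D ?J. w' = n \<oplus>\<^bsub>W\<^esub> r \<odot>\<^bsub>W\<^esub> w" using rv(1) by blast
      qed
      have IH: "interval_length R W ?xW (?D ?J) \<le> interval_length R ?S ?J (carrier R)"
        using ideal.IH[OF J'i sub(1)] sub(1) ideal.prems by blast
      have "interval_length R W ?xW (?D J) = interval_length R W ?xW (?D ?J) + interval_length R W (?D ?J) (?D J)"
        by (rule W.interval_length_add[OF xWs Ds[OF J'i] Ds[OF ideal(1)] xWD[OF J'i] DD])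
      also have "\<dots> \<le> interval_length R ?S ?J (carrier R) + 1" by (rule add_mono[OF IH l1])
      also have "\<dots> \<le> interval_length R ?S ?J (carrier R) + interval_length R ?S J ?J"
        unfolding interval_length_def
        by (intro add_left_mono one_le_chain_length) (use Js J' sub in auto)
      also have "\<dots> = interval_length R ?S J (carrier R)"
        using S.interval_length_add[OF Js J' cr] sub le by (simp add: add.commute)
      finally show ?thesis .
    qed
  qed
  have xI: "ideal (PIdl x) R" "x \<in> PIdl x" using cgenideal_ideal[OF xc] cgenideal_self[OF xc] .
  have "w \<in> ?D (PIdl x)" if w: "w \<in> carrier W" for w
  proof -
    have "j \<odot>\<^bsub>W\<^esub> w \<in> ?xW" if j: "j \<in> PIdl x" for j
    proof -
      obtain r where r: "r \<in> carrier R" "j = r \<otimes> x" using j by (auto simp: cgenideal_def)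
      then have "j \<odot>\<^bsub>W\<^esub> w = x \<odot>\<^bsub>W\<^esub> (r \<odot>\<^bsub>W\<^esub> w)"
        using xc w by (simp add: W.smult_assoc1[symmetric] m_comm)
      then show ?thesis using r w by (auto simp: scaled_def)
    qed
    then show ?thesis using w by simp
  qed
  then have "?D (PIdl x) = carrier W" by auto
  then show ?thesis using main[OF xI] by simp
qed

end

section \<open>The fraction field as a module\<close>

locale one_dim_local_fractions = one_dim_local_domain R m + Q: field Q
  for R :: "'a ring" and m and Q :: "'a ring" (structure) +
  assumes fractions: "fraction_field R Q"
begin

abbreviation QM :: "('a, 'a) module" where "QM \<equiv> self_module Q"

lemma R_ops: "monoid.mult R = monoid.mult Q" "one R = one Q" "ring.zero R = ring.zero Q"
  "ring.add R = ring.add Q"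
proof -
  have eq: "R = Q\<lparr>carrier := carrier R\<rparr>" using fractions unfolding fraction_field_def by blast
  show "monoid.mult R = monoid.mult Q" "one R = one Q" "ring.zero R = ring.zero Q"
    "ring.add R = ring.add Q"
    by (subst eq, simp)+
qed

lemma R_subset: "carrier R \<subseteq> carrier Q"
  using fractions subringE(1) unfolding fraction_field_def by blast

lemma R_Q: "r \<in> carrier R \<Longrightarrow> r \<in> carrier Q"
  using R_subset by blast

lemma R_closed:
  "\<one> \<in> carrier R" "\<zero> \<in> carrier R"
  "a \<in> carrier R \<Longrightarrow> b \<in> carrier R \<Longrightarrow> a \<otimes> b \<in> carrier R"
  "a \<in> carrier R \<Longrightarrow> b \<in> carrier R \<Longrightarrow> a \<oplus> b \<in> carrier R"
  using one_closed zero_closed m_closed[of a b] a_closed[of a b] by (simp_all add: R_ops)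

lemma denominator:
  assumes "x \<in> carrier Q"
  shows "\<exists>b\<in>carrier R. b \<noteq> \<zero> \<and> b \<otimes> x \<in> carrier R"
proof -
  have "\<forall>x\<in>carrier Q. \<exists>a\<in>carrier R. \<exists>b\<in>carrier R - {\<zero>\<^bsub>R\<^esub>}. x = a \<otimes> inv b"
    using fractions unfolding fraction_field_def by (elim conjE)
  from bspec[OF this assms] obtain a b where "a \<in> carrier R" "b \<in> carrier R - {\<zero>\<^bsub>R\<^esub>}" "x = a \<otimes> inv b"
    by (elim bexE)
  then have ab: "a \<in> carrier R" "b \<in> carrier R" "b \<noteq> \<zero>" "x = a \<otimes> inv b" by (simp_all add: R_ops)
  then have "b \<in> Units Q" using Q.field_Units R_Q by auto
  then have "b \<otimes> x = a"
    using ab R_Q Q.m_lcomm[of b a "inv b"] by simp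
  then show ?thesis using ab by blast
qed

lemma module_QM: "module R QM"
proof -
  interpret S: module Q QM by (rule self_module_module[OF Q.is_cring])
  show ?thesis
    by (rule moduleI[OF is_cring S.M.abelian_group_axioms])
      (use R_Q in \<open>auto simp: R_ops Q.l_distr Q.r_distr Q.m_assoc\<close>)
qed

sublocale QM: module R QM by (rule module_QM)

lemma submodule_QM_I:
  assumes "A \<subseteq> carrier Q" "\<zero> \<in> A" "\<And>a b. a \<in> A \<Longrightarrow> b \<in> A \<Longrightarrow> a \<oplus> b \<in> A"
    "\<And>r a. r \<in> carrier R \<Longrightarrow> a \<in> A \<Longrightarrow> r \<otimes> a \<in> A"
  shows "submodule A R QM"
  by (rule QM.submoduleI_no_uminus) (use assms in auto)

lemma submodule_QM_D:
  assumes "submodule A R QM"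
  shows "a \<in> A \<Longrightarrow> a \<in> carrier Q" "\<zero> \<in> A" "a \<in> A \<Longrightarrow> b \<in> A \<Longrightarrow> a \<oplus> b \<in> A"
    "r \<in> carrier R \<Longrightarrow> a \<in> A \<Longrightarrow> r \<otimes> a \<in> A"
  using QM.submodule_carrier[OF assms] QM.submodule_zero[OF assms] QM.submodule_add[OF assms]
    QM.submodule_smult[OF assms] by auto

lemma submodule_R: "submodule (carrier R) R QM"
  by (rule submodule_QM_I) (use R_Q R_closed in auto)

lemma ideal_iff_QM: "ideal J R \<longleftrightarrow> submodule J R QM \<and> J \<subseteq> carrier R"
proof -
  have "self_module R = QM\<lparr>carrier := carrier R\<rparr>"
    by (simp add: self_module_def R_ops)
  then show ?thesis
    using submodule_restrict_carrier[OF module_QM submodule_R] ideal_iff by simp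
qed

lemma interval_length_self_module:
  assumes "B \<subseteq> carrier R"
  shows "interval_length R (self_module R) A B = interval_length R QM A B"
proof -
  have "submodule N R (self_module R) \<and> A \<subseteq> N \<and> N \<subseteq> B \<longleftrightarrow> submodule N R QM \<and> A \<subseteq> N \<and> N \<subseteq> B" for N
    using ideal_iff_QM[of N] ideal_iff[of N] assms by blast
  then show ?thesis
    unfolding interval_length_def chain_length_def has_chain_def by simp
qed

lemma nonzero_mult: "a \<in> carrier Q \<Longrightarrow> b \<in> carrier Q \<Longrightarrow> a \<noteq> \<zero> \<Longrightarrow> b \<noteq> \<zero> \<Longrightarrow> a \<otimes> b \<noteq> \<zero>"
  using Q.integral by blast

lemma inv_Q: "a \<in> carrier Q \<Longrightarrow> a \<noteq> \<zero> \<Longrightarrow> inv a \<in> carrier Q \<and> inv a \<noteq> \<zero> \<and> inv a \<otimes> a = \<one> \<and> a \<otimes> inv a = \<one>"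
  using Q.field_Units Q.Units_l_inv Q.Units_r_inv Q.Units_inv_closed
  by (metis DiffI Q.one_not_zero Q.r_null empty_iff insert_iff)

lemma inv_mult_cancel:
  "a \<in> carrier Q \<Longrightarrow> a \<noteq> \<zero> \<Longrightarrow> z \<in> carrier Q \<Longrightarrow> inv a \<otimes> (a \<otimes> z) = z"
  "a \<in> carrier Q \<Longrightarrow> a \<noteq> \<zero> \<Longrightarrow> z \<in> carrier Q \<Longrightarrow> a \<otimes> (inv a \<otimes> z) = z"
  using inv_Q by (metis Q.m_assoc Q.l_one)+

lemma submodule_scaled_QM:
  assumes A: "submodule A R QM" and a: "a \<in> carrier Q"
  shows "submodule (scaled QM a A) R QM"
proof (rule submodule_QM_I)
  note D = submodule_QM_D[OF A]
  show "scaled QM a A \<subseteq> carrier Q" using D a by (auto simp: scaled_def)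
  show "\<zero> \<in> scaled QM a A" unfolding scaled_def using D(2) a by (intro image_eqI[of _ _ \<zero>]) auto
  show "x \<oplus> y \<in> scaled QM a A" if xy: "x \<in> scaled QM a A" "y \<in> scaled QM a A" for x y
  proof -
    obtain u v where "u \<in> A" "v \<in> A" "x = a \<otimes> u" "y = a \<otimes> v" using xy by (auto simp: scaled_def)
    then show ?thesis using D a by (auto simp: scaled_def Q.r_distr[symmetric])
  qed
  show "r \<otimes> x \<in> scaled QM a A" if rx: "r \<in> carrier R" "x \<in> scaled QM a A" for r x
  proof -
    obtain u where "u \<in> A" "x = a \<otimes> u" using rx(2) by (auto simp: scaled_def)
    then show ?thesis using D a rx(1) R_Q by (auto simp: scaled_def Q.m_lcomm)
  qed
qed

lemma scaled_inv:
  assumes "submodule A R QM" "a \<in> carrier Q" "a \<noteq> \<zero>"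
  shows "scaled QM (inv a) (scaled QM a A) = A"
  using submodule_QM_D(1)[OF assms(1)] inv_mult_cancel[OF assms(2,3)]
  by (force simp: scaled_def image_image)

lemma scaled_strict_mono:
  assumes "submodule A R QM" "submodule B R QM" "a \<in> carrier Q" "a \<noteq> \<zero>" "A \<subset> B"
  shows "scaled QM a A \<subset> scaled QM a B"
proof -
  have "scaled QM a A \<subseteq> scaled QM a B" using assms(5) by (auto simp: scaled_def)
  moreover have "scaled QM a A \<noteq> scaled QM a B" using scaled_inv assms by (metis psubset_eq)
  ultimately show ?thesis by blast
qed

lemma interval_length_scaled:
  assumes A: "submodule A R QM" and B: "submodule B R QM" and a: "a \<in> carrier Q" "a \<noteq> \<zero>"
  shows "interval_length R QM (scaled QM a A) (scaled QM a B) = interval_length R QM A B"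
proof -
  have le: "interval_length R QM A B \<le> interval_length R QM (scaled QM a A) (scaled QM a B)"
    if "submodule A R QM" "submodule B R QM" "a \<in> carrier Q" "a \<noteq> \<zero>" for A B a
    unfolding interval_length_def
  proof (rule chain_length_le_map[where f = "scaled QM a"])
    show "scaled QM a N \<in> {N. submodule N R QM} \<and> scaled QM a A \<subseteq> scaled QM a N \<and>
        scaled QM a N \<subseteq> scaled QM a B"
      if "N \<in> {N. submodule N R QM}" "A \<subseteq> N" "N \<subseteq> B" for N
      using that submodule_scaled_QM \<open>a \<in> carrier Q\<close> by (auto simp: scaled_def)
  qed (use scaled_strict_mono that in auto)
  show ?thesis
  proof (rule antisym)
    show "interval_length R QM (scaled QM a A) (scaled QM a B) \<le> interval_length R QM A B"
      using le[of "scaled QM a A" "scaled QM a B" "inv a"] submodule_scaled_QM A B a inv_Q[OF a]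
      by (simp add: scaled_inv)
  qed (rule le[OF A B a])
qed

lemma finite_colength_QM:
  assumes J: "submodule J R QM" "J \<subseteq> carrier R" and x: "x \<in> J" "x \<noteq> \<zero>"
  shows "interval_length R QM J (carrier R) \<noteq> \<infinity>"
  using finite_colength[of J x] J x ideal_iff_QM interval_length_self_module[of "carrier R" J]
  by (simp add: R_ops)

end

section \<open>A canonical module is isomorphic to a fractional ideal\<close>

locale canonical_fractions = one_dim_local_fractions R m Q + canonical_over R m W
  for R :: "'a ring" and m and Q :: "'a ring" (structure) and W :: "('a, 'w) module"
begin

text \<open>
  \<open>Q\<close> is divisible and \<open>R\<close> is a domain, so that a functional on a submodule extends to one more
  generator of \<open>W\<close> at a time. It starts from \<open>Rw0\<close>, which is free because \<open>W\<close> is torsion-free.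
\<close>

lemma functional_exists:
  assumes w0: "w0 \<in> carrier W" "w0 \<noteq> \<zero>\<^bsub>W\<^esub>"
  shows "\<exists>\<phi>. linear_on R W QM (carrier W) \<phi> \<and> \<phi> w0 = \<one>"
proof -
  note mW = W.module_axioms
  obtain S where S: "finite S" "S \<subseteq> carrier W" "submodule_span R W S = carrier W"
    using fin_gen unfolding finitely_generated_module_def by blast
  have "\<exists>A \<phi>. submodule A R W \<and> T \<subseteq> A \<and> w0 \<in> A \<and> linear_on R W QM A \<phi> \<and> \<phi> w0 = \<one>"
    if "finite T" "T \<subseteq> carrier W" for T
    using that
  proof (induction T rule: finite_induct)
    case empty
    let ?A = "{\<zero>\<^bsub>W\<^esub>} <+>\<^bsub>W\<^esub> cyclic_submodule R W w0"
    have cyc: "submodule (cyclic_submodule R W w0) R W" by (rule W.submodule_cyclic[OF w0(1)])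
    have lin: "linear_on R W QM {\<zero>\<^bsub>W\<^esub>} (\<lambda>_. \<zero>)"
      unfolding linear_on_def using R_Q by simp
    have rel: "\<forall>a\<in>carrier R. a \<odot>\<^bsub>W\<^esub> w0 \<in> {\<zero>\<^bsub>W\<^esub>} \<longrightarrow> \<zero> = a \<odot>\<^bsub>QM\<^esub> \<one>"
      using torsion_free w0 R_Q by (force simp: R_ops)
    have one: "\<one> \<in> carrier QM" by simp
    obtain g where "linear_on R W QM ?A g" "g w0 = \<one>"
      using linear_on_extend[OF mW module_QM W.submodule_zero_set lin w0(1) one rel]
      by (elim exE conjE)
    moreover have "w0 \<in> ?A"
      using W.set_add_upper(2)[OF W.submodule_zero_set cyc] W.cyclic_self[OF w0(1)] by blast
    ultimately show ?case using W.submodule_set_add[OF W.submodule_zero_set cyc] by blast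
  next
    case (insert s T)
    then obtain A \<phi> where A: "submodule A R W" "T \<subseteq> A" "w0 \<in> A" and \<phi>: "linear_on R W QM A \<phi>" "\<phi> w0 = \<one>"
      by auto
    have s: "s \<in> carrier W" using insert by simp
    note L = linear_onD[OF \<phi>(1)]
    have "\<exists>k\<in>carrier Q. \<forall>a\<in>carrier R. a \<odot>\<^bsub>W\<^esub> s \<in> A \<longrightarrow> \<phi> (a \<odot>\<^bsub>W\<^esub> s) = a \<odot>\<^bsub>QM\<^esub> k"
    proof (cases "\<exists>b\<in>carrier R. b \<noteq> \<zero> \<and> b \<odot>\<^bsub>W\<^esub> s \<in> A")
      case True
      then obtain b where b: "b \<in> carrier R" "b \<noteq> \<zero>" "b \<odot>\<^bsub>W\<^esub> s \<in> A" by blast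
      have bQ: "b \<in> carrier Q" using R_Q b by blast
      have c: "\<phi> (b \<odot>\<^bsub>W\<^esub> s) \<in> carrier Q" using L(1)[OF b(3)] by simp
      show ?thesis
      proof (intro bexI[of _ "inv b \<otimes> \<phi> (b \<odot>\<^bsub>W\<^esub> s)"] ballI impI)
        show "inv b \<otimes> \<phi> (b \<odot>\<^bsub>W\<^esub> s) \<in> carrier Q" using inv_Q[OF bQ b(2)] c by simp
        fix a assume a: "a \<in> carrier R" "a \<odot>\<^bsub>W\<^esub> s \<in> A"
        have aQ: "a \<in> carrier Q" using R_Q a by blast
        have d: "\<phi> (a \<odot>\<^bsub>W\<^esub> s) \<in> carrier Q" using L(1)[OF a(2)] by simp
        have "b \<odot>\<^bsub>W\<^esub> (a \<odot>\<^bsub>W\<^esub> s) = a \<odot>\<^bsub>W\<^esub> (b \<odot>\<^bsub>W\<^esub> s)"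
          using a b s by (simp add: W.smult_assoc1[symmetric] m_comm)
        then have "b \<otimes> \<phi> (a \<odot>\<^bsub>W\<^esub> s) = a \<otimes> \<phi> (b \<odot>\<^bsub>W\<^esub> s)"
          using L(3)[OF b(1) a(2)] L(3)[OF a(1) b(3)] by simp
        then have "\<phi> (a \<odot>\<^bsub>W\<^esub> s) = inv b \<otimes> (a \<otimes> \<phi> (b \<odot>\<^bsub>W\<^esub> s))"
          using inv_mult_cancel(1)[OF bQ b(2) d] by simp
        also have "\<dots> = a \<otimes> (inv b \<otimes> \<phi> (b \<odot>\<^bsub>W\<^esub> s))"
          using aQ c inv_Q[OF bQ b(2)] by (simp add: Q.m_lcomm)
        finally show "\<phi> (a \<odot>\<^bsub>W\<^esub> s) = a \<odot>\<^bsub>QM\<^esub> (inv b \<otimes> \<phi> (b \<odot>\<^bsub>W\<^esub> s))" by simp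
      qed
    next
      case False
      have "\<phi> \<zero>\<^bsub>W\<^esub> = \<zero>" using linear_on_zero[OF mW module_QM A(1) \<phi>(1)] by simp
      moreover have "\<zero> \<odot>\<^bsub>W\<^esub> s = \<zero>\<^bsub>W\<^esub>" using W.smult_l_null[OF s] by (simp add: R_ops)
      ultimately show ?thesis using False by (intro bexI[of _ \<zero>]) auto
    qed
    then obtain k where k: "k \<in> carrier QM" "\<forall>a\<in>carrier R. a \<odot>\<^bsub>W\<^esub> s \<in> A \<longrightarrow> \<phi> (a \<odot>\<^bsub>W\<^esub> s) = a \<odot>\<^bsub>QM\<^esub> k"
      by auto
    let ?A = "A <+>\<^bsub>W\<^esub> cyclic_submodule R W s"
    have cyc: "submodule (cyclic_submodule R W s) R W" by (rule W.submodule_cyclic[OF s])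
    obtain g where g: "linear_on R W QM ?A g" "\<forall>x\<in>A. g x = \<phi> x"
      using linear_on_extend[OF mW module_QM A(1) \<phi>(1) s k] by (elim exE conjE)
    have "insert s T \<subseteq> ?A" "w0 \<in> ?A"
      using W.set_add_upper[OF A(1) cyc] W.cyclic_self[OF s] A by blast+
    moreover have "g w0 = \<one>" using g A \<phi> by simp
    ultimately show ?case using W.submodule_set_add[OF A(1) cyc] g(1) by blast
  qed
  from this[OF S(1,2)] obtain A \<phi> where A: "submodule A R W" "S \<subseteq> A" "w0 \<in> A"
    and \<phi>: "linear_on R W QM A \<phi>" "\<phi> w0 = \<one>" by blast
  have "carrier W \<subseteq> A" using A S(3) unfolding submodule_span_def by blast
  then show ?thesis using linear_on_subset[OF \<phi>(1)] \<phi>(2) by blast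
qed

lemma common_denominator:
  assumes \<phi>: "linear_on R W QM (carrier W) \<phi>"
  shows "\<exists>c\<in>carrier R. c \<noteq> \<zero> \<and> (\<forall>w\<in>carrier W. c \<otimes> \<phi> w \<in> carrier R)"
proof -
  note L = linear_onD[OF \<phi>]
  obtain S where S: "finite S" "S \<subseteq> carrier W" "submodule_span R W S = carrier W"
    using fin_gen unfolding finitely_generated_module_def by blast
  have "\<exists>c\<in>carrier R. c \<noteq> \<zero> \<and> (\<forall>w\<in>T. c \<otimes> \<phi> w \<in> carrier R)" if "finite T" "T \<subseteq> carrier W" for T
    using that
  proof (induction T rule: finite_induct)
    case empty
    show ?case using R_closed(1) Q.one_not_zero by blast
  next
    case (insert s T)
    then obtain c where c: "c \<in> carrier R" "c \<noteq> \<zero>" "\<forall>w\<in>T. c \<otimes> \<phi> w \<in> carrier R" by auto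
    have \<phi>s: "\<phi> s \<in> carrier Q" using L(1) insert by simp
    obtain b where b: "b \<in> carrier R" "b \<noteq> \<zero>" "b \<otimes> \<phi> s \<in> carrier R" using denominator[OF \<phi>s] by blast
    have "(b \<otimes> c) \<otimes> \<phi> w \<in> carrier R" if w: "w \<in> insert s T" for w
    proof -
      have \<phi>w: "\<phi> w \<in> carrier Q" using L(1) w insert by auto
      have "(b \<otimes> c) \<otimes> \<phi> w = b \<otimes> (c \<otimes> \<phi> w)" "(b \<otimes> c) \<otimes> \<phi> w = c \<otimes> (b \<otimes> \<phi> w)"
        using \<phi>w b c R_Q by (simp_all add: Q.m_assoc Q.m_lcomm)
      then show ?thesis using w b c R_closed(3) by (metis insertE)
    qed
    moreover have "b \<otimes> c \<noteq> \<zero>" using nonzero_mult b c R_Q by blast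
    ultimately show ?case using R_closed(3) b c by blast
  qed
  from this[OF S(1,2)] obtain c where c: "c \<in> carrier R" "c \<noteq> \<zero>" "\<forall>w\<in>S. c \<otimes> \<phi> w \<in> carrier R" by blast
  let ?N = "{w \<in> carrier W. c \<otimes> \<phi> w \<in> carrier R}"
  have "submodule ?N R W"
  proof (rule W.submoduleI_no_uminus)
    show "\<zero>\<^bsub>W\<^esub> \<in> ?N"
      using linear_on_zero[OF W.module_axioms module_QM W.carrier_is_submodule \<phi>] c(1) R_Q R_closed(2)
      by simp
    show "a \<oplus>\<^bsub>W\<^esub> b \<in> ?N" if "a \<in> ?N" "b \<in> ?N" for a b
      using that L c(1) R_Q R_closed(4) by (simp add: Q.r_distr)
    show "r \<odot>\<^bsub>W\<^esub> a \<in> ?N" if "r \<in> carrier R" "a \<in> ?N" for r a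
      using that L c(1) R_Q R_closed(3)[of r "c \<otimes> \<phi> a"] by (simp add: Q.m_lcomm)
  qed auto
  then have "submodule_span R W S \<subseteq> ?N" using c(3) S(2) unfolding submodule_span_def by blast
  then show ?thesis using S(3) c by blast
qed

lemma submodule_image:
  assumes \<phi>: "linear_on R W QM (carrier W) \<phi>"
  shows "submodule (\<phi> ` carrier W) R QM"
proof (rule submodule_QM_I)
  note L = linear_onD[OF \<phi>]
  show "\<zero> \<in> \<phi> ` carrier W"
    using linear_on_zero[OF W.module_axioms module_QM W.carrier_is_submodule \<phi>]
    by (metis W.M.zero_closed image_eqI self_module_simps(4))
  show "a \<oplus> b \<in> \<phi> ` carrier W" if "a \<in> \<phi> ` carrier W" "b \<in> \<phi> ` carrier W" for a b
    using that L(2)[symmetric] by auto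
  show "r \<otimes> a \<in> \<phi> ` carrier W" if "r \<in> carrier R" "a \<in> \<phi> ` carrier W" for r a
    using that L(3)[symmetric] by auto
qed (use linear_onD(1)[OF \<phi>] in auto)

text \<open>
  Scaling reduces the claim to the case of an ideal \<open>I \<subseteq> R\<close>. There \<open>R / xI\<close> is counted through
  \<open>I\<close> and through \<open>xR\<close>, and \<open>xR / xI\<close> is as long as \<open>R / I\<close>, which is finite and cancels.
\<close>

lemma length_fractional_mod_scaled:
  assumes I: "submodule I R QM" and z: "z \<in> I" "z \<noteq> \<zero>"
    and c: "c \<in> carrier R" "c \<noteq> \<zero>" "\<And>i. i \<in> I \<Longrightarrow> c \<otimes> i \<in> carrier R"
    and x: "x \<in> carrier R" "x \<noteq> \<zero>"
  shows "interval_length R QM (scaled QM x I) I = interval_length R QM (scaled QM x (carrier R)) (carrier R)"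
proof -
  have cQ: "c \<in> carrier Q" and xQ: "x \<in> carrier Q" using R_Q c x by auto
  let ?J = "scaled QM c I"
  have J: "submodule ?J R QM" by (rule submodule_scaled_QM[OF I cQ])
  have xJ: "submodule (scaled QM x ?J) R QM" by (rule submodule_scaled_QM[OF J xQ])
  have xI: "submodule (scaled QM x I) R QM" by (rule submodule_scaled_QM[OF I xQ])
  have xR: "submodule (scaled QM x (carrier R)) R QM" by (rule submodule_scaled_QM[OF submodule_R xQ])
  have JR: "?J \<subseteq> carrier R" using c(3) by (auto simp: scaled_def)
  have "c \<otimes> z \<in> ?J" "c \<otimes> z \<noteq> \<zero>"
    using z nonzero_mult[OF cQ _ c(2)] submodule_QM_D(1)[OF I] by (auto simp: scaled_def)
  then have fin: "interval_length R QM ?J (carrier R) \<noteq> \<infinity>" using finite_colength_QM[OF J JR] by blast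
  have "scaled QM x ?J = scaled QM c (scaled QM x I)"
    using submodule_QM_D(1)[OF I] cQ xQ Q.m_lcomm[of x c] by (auto simp: scaled_def image_image)
  then have "interval_length R QM (scaled QM x I) I = interval_length R QM (scaled QM x ?J) ?J"
    using interval_length_scaled[OF xI I cQ c(2)] by simp
  moreover have "interval_length R QM (scaled QM x ?J) ?J + interval_length R QM ?J (carrier R)
      = interval_length R QM ?J (carrier R) + interval_length R QM (scaled QM x (carrier R)) (carrier R)"
  proof -
    have xsub: "scaled QM x A \<subseteq> A" if "submodule A R QM" for A
      using submodule_QM_D(4)[OF that x(1)] by (auto simp: scaled_def)
    have "interval_length R QM (scaled QM x ?J) ?J + interval_length R QM ?J (carrier R)
        = interval_length R QM (scaled QM x ?J) (carrier R)"
      by (rule QM.interval_length_add[symmetric, OF xJ J submodule_R xsub[OF J] JR])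
    also have "\<dots> = interval_length R QM (scaled QM x ?J) (scaled QM x (carrier R))
        + interval_length R QM (scaled QM x (carrier R)) (carrier R)"
      by (rule QM.interval_length_add[OF xJ xR submodule_R _ xsub[OF submodule_R]])
        (use JR in \<open>auto simp: scaled_def\<close>)
    finally show ?thesis using interval_length_scaled[OF J submodule_R xQ x(2)] by simp
  qed
  ultimately show ?thesis using fin by (simp add: add.commute)
qed

lemma scaled_R: "x \<in> carrier R \<Longrightarrow> scaled QM x (carrier R) = PIdl\<^bsub>R\<^esub> x"
  using m_comm by (auto simp: scaled_def cgenideal_def R_ops)

end

lemma enat_add_le_imp_zero: "d + v \<le> a \<Longrightarrow> a \<le> v \<Longrightarrow> a \<noteq> \<infinity> \<Longrightarrow> d = (0::enat)"
  by (cases a; cases d; cases v) (auto simp: zero_enat_def)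

context canonical_fractions
begin

text \<open>
  Counting lengths shows that the kernel of a nonzero functional on \<open>W\<close> lies in \<open>xW\<close> for
  every nonzero \<open>x\<close> in \<open>m\<close>: \<open>W / xW\<close> is no longer than \<open>R / xR\<close>, which is as long as the quotient
  of the image by \<open>x\<close>.
\<close>

lemma kernel_subset_scaled:
  assumes \<phi>: "linear_on R W QM (carrier W) \<phi>" and w0: "w0 \<in> carrier W" "\<phi> w0 = \<one>"
    and x: "x \<in> m" "x \<noteq> \<zero>" and u: "u \<in> carrier W" "\<phi> u = \<zero>"
  shows "u \<in> scaled W x (carrier W)"
proof -
  let ?I = "\<phi> ` carrier W" and ?U = "{w \<in> carrier W. \<phi> w = \<zero>}" and ?xW = "scaled W x (carrier W)"
  note L = linear_onD[OF \<phi>]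
  have xc: "x \<in> carrier R" using m_carrier x by blast
  have xQ: "x \<in> carrier Q" using R_Q xc by blast
  have I: "submodule ?I R QM" by (rule submodule_image[OF \<phi>])
  have U: "submodule ?U R W"
    using linear_on_ker[OF W.module_axioms module_QM W.carrier_is_submodule \<phi>] by simp
  have xW: "submodule ?xW R W" by (rule submodule_scaled[OF W.module_axioms W.carrier_is_submodule xc])
  let ?V = "?xW <+>\<^bsub>W\<^esub> ?U"
  have V: "submodule ?V R W" by (rule W.submodule_set_add[OF xW U])
  obtain c where c: "c \<in> carrier R" "c \<noteq> \<zero>" "\<And>w. w \<in> carrier W \<Longrightarrow> c \<otimes> \<phi> w \<in> carrier R"
    using common_denominator[OF \<phi>] by blast
  have f1: "interval_length R QM (scaled QM x ?I) ?I = interval_length R QM (PIdl\<^bsub>R\<^esub> x) (carrier R)"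
    unfolding scaled_R[OF xc, symmetric]
  proof (rule length_fractional_mod_scaled[OF I _ Q.one_not_zero c(1,2) _ xc x(2)])
    show "\<one> \<in> ?I" using w0 by force
    show "c \<otimes> i \<in> carrier R" if "i \<in> ?I" for i using that c(3) by blast
  qed
  have f2: "interval_length R QM (PIdl\<^bsub>R\<^esub> x) (carrier R) \<noteq> \<infinity>"
    using finite_colength[OF cgenideal_ideal[OF xc] cgenideal_self[OF xc]] x(2)
      interval_length_self_module[of "carrier R"] by (simp add: R_ops)
  have f3: "interval_length R W ?xW (carrier W) \<le> interval_length R QM (PIdl\<^bsub>R\<^esub> x) (carrier R)"
    using length_quotient_le[of x] x interval_length_self_module[of "carrier R"] by (simp add: R_ops)
  have f4: "interval_length R QM (scaled QM x ?I) ?I \<le> interval_length R W ?V (carrier W)"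
    unfolding interval_length_def
  proof (rule chain_length_le_map[where f = "\<lambda>N. {w \<in> carrier W. \<phi> w \<in> N}"])
    fix N assume "N \<in> {N. submodule N R QM}" and xN: "scaled QM x ?I \<subseteq> N"
    then have N: "submodule N R QM" by simp
    note D = submodule_QM_D[OF N]
    have pre: "submodule {w \<in> carrier W. \<phi> w \<in> N} R W"
    proof (rule W.submoduleI_no_uminus)
      show "\<zero>\<^bsub>W\<^esub> \<in> {w \<in> carrier W. \<phi> w \<in> N}"
        using linear_on_zero[OF W.module_axioms module_QM W.carrier_is_submodule \<phi>] D(2) by simp
    qed (use L D in auto)
    moreover have "?V \<subseteq> {w \<in> carrier W. \<phi> w \<in> N}"
    proof (rule W.set_add_least[OF pre])
      show "?xW \<subseteq> {w \<in> carrier W. \<phi> w \<in> N}"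
        using L(3)[OF xc] xN xc by (auto simp: scaled_def)
      show "?U \<subseteq> {w \<in> carrier W. \<phi> w \<in> N}" using D(2) by auto
    qed
    ultimately show "{w \<in> carrier W. \<phi> w \<in> N} \<in> {N. submodule N R W} \<and>
        ?V \<subseteq> {w \<in> carrier W. \<phi> w \<in> N} \<and> {w \<in> carrier W. \<phi> w \<in> N} \<subseteq> carrier W" by auto
  next
    fix N N' assume "N \<subset> N'" "N' \<subseteq> ?I"
    then show "{w \<in> carrier W. \<phi> w \<in> N} \<subset> {w \<in> carrier W. \<phi> w \<in> N'}" by blast
  qed
  have add: "interval_length R W ?xW (carrier W)
      = interval_length R W ?xW ?V + interval_length R W ?V (carrier W)"
    using W.interval_length_add[OF xW V W.carrier_is_submodule W.set_add_upper(1)[OF xW U]]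
      W.submoduleE(1)[OF V] by blast
  have "interval_length R W ?xW ?V = 0"
    by (rule enat_add_le_imp_zero[OF f3[unfolded add] f4[unfolded f1] f2])
  then have "?xW = ?V" using W.interval_length_eq_0[OF xW V W.set_add_upper(1)[OF xW U]] by blast
  then show ?thesis using W.set_add_upper(2)[OF xW U] u by blast
qed

text \<open>
  An element of the kernel is divisible by every nonzero element of \<open>m\<close>, hence killed by all
  functionals, whose images are fractional ideals. But functionals separate the points of \<open>W\<close>.
\<close>

lemma functional_injective:
  assumes \<phi>: "linear_on R W QM (carrier W) \<phi>" and w0: "w0 \<in> carrier W" "\<phi> w0 = \<one>"
    and u: "u \<in> carrier W" "\<phi> u = \<zero>"
  shows "u = \<zero>\<^bsub>W\<^esub>"
proof (rule ccontr)
  assume "u \<noteq> \<zero>\<^bsub>W\<^esub>"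
  then obtain \<psi> where \<psi>: "linear_on R W QM (carrier W) \<psi>" "\<psi> u = \<one>"
    using functional_exists[OF u(1)] by blast
  obtain c where c: "c \<in> carrier R" "c \<noteq> \<zero>" "\<And>w. w \<in> carrier W \<Longrightarrow> c \<otimes> \<psi> w \<in> carrier R"
    using common_denominator[OF \<psi>(1)] by blast
  obtain y where y: "y \<in> m" "y \<noteq> \<zero>" using exists_nonzero_in_m by (auto simp: R_ops)
  have yc: "y \<in> carrier R" using m_carrier y by blast
  \<comment> \<open>\<open>c\<close> clears the denominators of \<open>\<psi>\<close>, and \<open>y\<close> makes the divisor too large for that\<close>
  have cy: "c \<otimes> y \<in> m" using ideal.I_l_closed[OF ideal_m y(1) c(1)] by (simp add: R_ops)
  have "c \<otimes> y \<noteq> \<zero>" using nonzero_mult R_Q c y yc by blast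
  then obtain v where v: "v \<in> carrier W" "u = (c \<otimes> y) \<odot>\<^bsub>W\<^esub> v"
    using kernel_subset_scaled[OF \<phi> w0 cy _ u] by (auto simp: scaled_def)
  have q: "c \<in> carrier Q" "y \<in> carrier Q" "\<psi> v \<in> carrier Q"
    using R_Q c yc linear_onD(1)[OF \<psi>(1) v(1)] by auto
  have "\<one> = (c \<otimes> y) \<otimes> \<psi> v"
    using linear_onD(3)[OF \<psi>(1) m_carrier[OF cy] v(1)] v(2) \<psi>(2) by simp
  also have "\<dots> = (c \<otimes> \<psi> v) \<otimes> y" using q by (simp add: Q.m_ac)
  finally have "\<one> \<in> m" using ideal.I_l_closed[OF ideal_m y(1) c(3)[OF v(1)]] by (simp add: R_ops)
  then show False using one_notin_m by (simp add: R_ops)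
qed

end

section \<open>The canonical ideal inside a discrete valuation ring\<close>

text \<open>
  In a local principal ideal domain, the ideal generated by \<open>S\<close> is generated by an element of \<open>S\<close>:
  otherwise \<open>S\<close> would lie in the product of that ideal with the maximal ideal.
\<close>

lemma (in noetherian_local_domain) divisor_of_all:
  assumes "principal_domain R" and S: "S \<subseteq> carrier R" and s0: "s0 \<in> S" "s0 \<noteq> \<zero>"
  shows "\<exists>s\<in>S. s \<noteq> \<zero> \<and> (\<forall>t\<in>S. \<exists>v\<in>carrier R. t = s \<otimes> v)"
proof -
  obtain g where g: "g \<in> carrier R" "genideal R S = PIdl g"
    using principal_domain.exists_gen[OF assms(1) genideal_ideal[OF S]] by blast
  have S_g: "\<exists>r\<in>carrier R. t = r \<otimes> g" if "t \<in> S" for t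
    using genideal_self[OF S] that g(2) by (auto simp: cgenideal_def)
  have g0: "g \<noteq> \<zero>" using S_g[OF s0(1)] s0(2) by auto
  let ?G = "scaled (self_module R) g m"
  have sm: "module R (self_module R)" by (rule self_module_module[OF is_cring])
  have iff: "ideal J R \<longleftrightarrow> submodule J R (self_module R)" for J
    by (rule ideal_iff_submodule[OF is_cring])
  have G: "ideal ?G R" using submodule_scaled[OF sm _ g(1)] ideal_m iff by blast
  have "\<not> S \<subseteq> ?G"
  proof
    assume "S \<subseteq> ?G"
    then have "genideal R S \<subseteq> ?G" by (rule genideal_minimal[OF G])
    then have "g \<in> ?G" using g cgenideal_self by blast
    then obtain a where a: "a \<in> m" "g = g \<otimes> a" by (auto simp: scaled_def)
    then have "g \<otimes> a = g \<otimes> \<one>" using g by simp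
    then have "a = \<one>" using m_lcancel[OF g0 g(1)] m_carrier[OF a(1)] by simp
    then show False using a one_notin_m by simp
  qed
  then obtain s where s: "s \<in> S" "s \<notin> ?G" by blast
  obtain u where u: "u \<in> carrier R" "s = u \<otimes> g" using S_g[OF s(1)] by blast
  have "u \<notin> m" using s(2) u g(1) m_comm[of u g] by (auto simp: scaled_def)
  then have uu: "u \<in> Units R" using unit_if_notin_m u by blast
  have "\<exists>v\<in>carrier R. t = s \<otimes> v" if t: "t \<in> S" for t
  proof -
    obtain r where r: "r \<in> carrier R" "t = r \<otimes> g" using S_g[OF t] by blast
    have "s \<otimes> (inv u \<otimes> r) = (u \<otimes> inv u) \<otimes> (g \<otimes> r)"
      using u r g uu by (simp add: m_ac)
    also have "\<dots> = t" using uu g r m_comm[of g r] by simp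
    finally show ?thesis using uu r by (intro bexI[of _ "inv u \<otimes> r"]) auto
  qed
  moreover have "s \<noteq> \<zero>"
    using s(2) additive_subgroup.zero_closed[OF ideal.axioms(1)[OF G]] by blast
  ultimately show ?thesis using s(1) by blast
qed

locale canonical_dvr = canonical_fractions +
  assumes dvr: "discrete_valuation_ring (integral_closure_ring R Q)"
begin

abbreviation V :: "'a set" where "V \<equiv> integral_closure R Q"

abbreviation VR :: "'a ring" where "VR \<equiv> integral_closure_ring R Q"

lemma VR_simps: "carrier VR = V" "monoid.mult VR = monoid.mult Q" "one VR = one Q"
  "ring.zero VR = ring.zero Q" "ring.add VR = ring.add Q"
  by (simp_all add: integral_closure_ring_def)

lemma V_Q: "v \<in> V \<Longrightarrow> v \<in> carrier Q"
  by (simp add: integral_closure_def)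

lemma VR_local_domain: "principal_domain VR" "\<exists>n. noetherian_local_domain VR n"
proof -
  show p: "principal_domain VR" using dvr by (simp add: discrete_valuation_ring_def)
  obtain n where "local_ring VR n" using dvr unfolding discrete_valuation_ring_def by blast
  interpret VR: principal_domain VR by (rule p)
  have "noetherian_local_domain VR n"
    by (intro noetherian_local_domain.intro noetherian_local_domain_axioms.intro VR.noetherian_domain_axioms) fact
  then show "\<exists>n. noetherian_local_domain VR n" by blast
qed

lemma V_closed: "a \<in> V \<Longrightarrow> b \<in> V \<Longrightarrow> a \<oplus> b \<in> V" "a \<in> V \<Longrightarrow> b \<in> V \<Longrightarrow> a \<otimes> b \<in> V"
  "\<one> \<in> V" "\<zero> \<in> V"
proof -
  interpret VR: principal_domain VR by (rule VR_local_domain)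
  show "a \<in> V \<Longrightarrow> b \<in> V \<Longrightarrow> a \<oplus> b \<in> V" "a \<in> V \<Longrightarrow> b \<in> V \<Longrightarrow> a \<otimes> b \<in> V" "\<one> \<in> V" "\<zero> \<in> V"
    using VR.a_closed[of a b] VR.m_closed[of a b] VR.one_closed VR.zero_closed by (simp_all add: VR_simps)
qed

lemma R_V: "r \<in> carrier R \<Longrightarrow> r \<in> V"
proof -
  assume r: "r \<in> carrier R"
  have rQ: "r \<in> carrier Q" using R_Q r .
  have "\<ominus> r \<in> carrier R"
  proof -
    have "\<ominus>\<^bsub>R\<^esub> r \<oplus> r = \<zero>" using l_neg[OF r] by (simp add: R_ops)
    then have "\<ominus> r = \<ominus>\<^bsub>R\<^esub> r" using Q.minus_equality rQ R_Q a_inv_closed[OF r] by blast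
    then show ?thesis using a_inv_closed[OF r] by simp
  qed
  then have "polynomial\<^bsub>Q\<^esub> (carrier R) [\<one>, \<ominus> r]"
    using R_closed(1) Q.one_not_zero by (simp add: polynomial_def)
  moreover have "Q.eval [\<one>, \<ominus> r] r = \<zero>" using rQ by (simp add: Q.r_neg)
  ultimately show "r \<in> V"
    unfolding integral_closure_def using rQ by (intro CollectI conjI exI[of _ "[\<one>, \<ominus> r]"]) auto
qed

lemma submodule_V: "submodule V R QM"
  by (rule submodule_QM_I) (use V_Q V_closed R_V in auto)

lemma V_divisor_of_all:
  assumes "S \<subseteq> V" "s0 \<in> S" "s0 \<noteq> \<zero>"
  shows "\<exists>s\<in>S. s \<noteq> \<zero> \<and> (\<forall>t\<in>S. \<exists>v\<in>V. t = s \<otimes> v)"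
proof -
  obtain n where "noetherian_local_domain VR n" using VR_local_domain by blast
  then show ?thesis
    using noetherian_local_domain.divisor_of_all[of VR n S s0] VR_local_domain(1) assms
    by (simp add: VR_simps)
qed

text \<open>
  Dividing a fractional ideal isomorphic to \<open>W\<close> by an element of least valuation places it between
  \<open>R\<close> and its integral closure.
\<close>

lemma normalized_functional_exists:
  "\<exists>\<phi> w1. linear_on R W QM (carrier W) \<phi> \<and> w1 \<in> carrier W \<and> \<phi> w1 = \<one> \<and> \<phi> ` carrier W \<subseteq> V"
proof -
  obtain x where x: "x \<in> m" "x \<noteq> \<zero>" using exists_nonzero_in_m by (auto simp: R_ops)
  have xc: "x \<in> carrier R" using m_carrier x by blast
  have "colon R (self_module R) m \<one> = m"
    using m_carrier by (auto simp: colon_def R_ops[symmetric])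
  then obtain w0 where "w0 \<in> carrier W" "\<one> \<odot>\<^bsub>W\<^esub> w0 \<notin> scaled W x (carrier W)"
    using separates[OF ideal_m x(1), of \<one>] x(2) R_closed(1) by (auto simp: R_ops)
  then have w0: "w0 \<in> carrier W" "w0 \<noteq> \<zero>\<^bsub>W\<^esub>"
    using W.submodule_zero[OF submodule_scaled[OF W.module_axioms W.carrier_is_submodule xc]]
    by (auto simp: R_ops[symmetric])
  obtain \<phi> where \<phi>: "linear_on R W QM (carrier W) \<phi>" "\<phi> w0 = \<one>" using functional_exists[OF w0] by blast
  note L = linear_onD[OF \<phi>(1)]
  obtain c where c: "c \<in> carrier R" "c \<noteq> \<zero>" "\<forall>w\<in>carrier W. c \<otimes> \<phi> w \<in> carrier R"
    using common_denominator[OF \<phi>(1)] by blast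
  have cQ: "c \<in> carrier Q" using R_Q c(1) .
  let ?S = "(\<lambda>w. c \<otimes> \<phi> w) ` carrier W"
  have SV: "?S \<subseteq> V" using c(3) R_V by auto
  have "c \<otimes> \<phi> w0 \<in> ?S" using w0 by blast
  moreover have "c \<otimes> \<phi> w0 \<noteq> \<zero>" using c cQ \<phi>(2) by simp
  ultimately obtain s where s: "s \<in> ?S" "s \<noteq> \<zero>" "\<forall>t\<in>?S. \<exists>v\<in>V. t = s \<otimes> v"
    using V_divisor_of_all[OF SV] by meson
  obtain w1 where w1: "w1 \<in> carrier W" "s = c \<otimes> \<phi> w1" using s(1) by blast
  have sQ: "s \<in> carrier Q" using SV s(1) V_Q by blast
  let ?d = "inv s \<otimes> c"
  have d: "?d \<in> carrier Q" using inv_Q[OF sQ s(2)] cQ by simp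
  let ?\<psi> = "\<lambda>w. ?d \<otimes> \<phi> w"
  have eq: "?\<psi> w = inv s \<otimes> (c \<otimes> \<phi> w)" if "w \<in> carrier W" for w
    using inv_Q[OF sQ s(2)] cQ L(1)[OF that] by (simp add: Q.m_assoc)
  have "linear_on R W QM (carrier W) ?\<psi>"
    unfolding linear_on_def using L d R_Q by (simp add: Q.r_distr Q.m_lcomm)
  moreover have "?\<psi> w1 = \<one>" using eq[OF w1(1)] w1(2) inv_Q[OF sQ s(2)] by simp
  moreover have "?\<psi> ` carrier W \<subseteq> V"
  proof
    fix y assume "y \<in> ?\<psi> ` carrier W"
    then obtain w where w: "w \<in> carrier W" "y = ?\<psi> w" by blast
    then obtain v where v: "v \<in> V" "c \<otimes> \<phi> w = s \<otimes> v" using s(3) by blast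
    have "y = inv s \<otimes> (s \<otimes> v)" using eq[OF w(1)] w(2) v(2) by simp
    then show "y \<in> V" using inv_mult_cancel(1)[OF sQ s(2) V_Q[OF v(1)]] v(1) by simp
  qed
  ultimately show ?thesis using w1(1) by blast
qed

end

locale normalized_canonical = canonical_dvr +
  fixes \<phi> :: "'b \<Rightarrow> 'a" and w1 :: 'b
  assumes \<phi>: "linear_on R W QM (carrier W) \<phi>" and w1: "w1 \<in> carrier W" "\<phi> w1 = \<one>"
    and \<phi>_V: "\<phi> ` carrier W \<subseteq> V"
begin

definition \<omega> :: "'a set" where "\<omega> = \<phi> ` carrier W"

text \<open>
  The colon \<open>\<omega> : A\<close> in \<open>Q\<close>.
\<close>

definition dual :: "'a set \<Rightarrow> 'a set" where "dual A = {q \<in> carrier Q. \<forall>a\<in>A. q \<otimes> a \<in> \<omega>}"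

lemmas \<phi>D = linear_onD[OF \<phi>]

lemma \<phi>_eqD:
  assumes "w \<in> carrier W" "w' \<in> carrier W" "\<phi> w = \<phi> w'"
  shows "w = w'"
proof -
  have "\<phi> (w \<ominus>\<^bsub>W\<^esub> w') = \<phi> w \<ominus>\<^bsub>QM\<^esub> \<phi> w'"
    by (rule linear_on_minus[OF W.module_axioms module_QM W.carrier_is_submodule \<phi> assms(1,2)])
  also have "\<dots> = \<zero>" using assms \<phi>D(1) by (simp add: QM.M.minus_eq)
      (metis QM.M.r_neg self_module_simps(1,4,5))
  finally have z: "w \<ominus>\<^bsub>W\<^esub> w' = \<zero>\<^bsub>W\<^esub>"
    using functional_injective[OF \<phi> w1] assms by simp
  then show ?thesis using W.M.add_minus_cancel[OF assms(2,1)] assms(2) by simp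
qed

lemma submodule_\<omega>: "submodule \<omega> R QM"
  unfolding \<omega>_def by (rule submodule_image[OF \<phi>])

lemmas \<omega>D = submodule_QM_D[OF submodule_\<omega>]

lemma one_\<omega>: "\<one> \<in> \<omega>"
  using w1 by (force simp: \<omega>_def)

lemma R_\<omega>: "r \<in> carrier R \<Longrightarrow> r \<in> \<omega>"
  using \<omega>D(4)[OF _ one_\<omega>, of r] R_Q by simp

lemma \<omega>_V: "\<omega> \<subseteq> V"
  using \<phi>_V by (simp add: \<omega>_def)

lemma dualI: "q \<in> carrier Q \<Longrightarrow> (\<And>a. a \<in> A \<Longrightarrow> q \<otimes> a \<in> \<omega>) \<Longrightarrow> q \<in> dual A"
  by (simp add: dual_def)

lemma dualD: "q \<in> dual A \<Longrightarrow> q \<in> carrier Q" "q \<in> dual A \<Longrightarrow> a \<in> A \<Longrightarrow> q \<otimes> a \<in> \<omega>"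
  by (simp_all add: dual_def)

lemma dual_antimono: "A \<subseteq> B \<Longrightarrow> dual B \<subseteq> dual A"
  by (auto simp: dual_def)

lemma submodule_dual:
  assumes A: "submodule A R QM"
  shows "submodule (dual A) R QM"
proof (rule submodule_QM_I)
  note D = submodule_QM_D[OF A]
  show "\<zero> \<in> dual A" using D(1) \<omega>D(2) by (intro dualI) auto
  show "a \<oplus> b \<in> dual A" if "a \<in> dual A" "b \<in> dual A" for a b
    using that D(1) \<omega>D(3) dualD by (intro dualI) (auto simp: Q.l_distr)
  show "r \<otimes> a \<in> dual A" if "r \<in> carrier R" "a \<in> dual A" for r a
    using that D(1) \<omega>D(4) dualD R_Q by (intro dualI) (auto simp: Q.m_assoc)
qed (auto simp: dual_def)

text \<open>
  Nonzero fractional ideals are reflexive with respect to \<open>\<omega>\<close>. Multiplying by an element of \<open>R\<close>, one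
  may assume that \<open>z\<close> and \<open>I\<close> lie in \<open>R\<close> and that \<open>(I : z) = m\<close>; then \<open>separates\<close> applies,
  the fraction \<open>w / x\<close> being the required element of \<open>\<omega> : I\<close>.
\<close>

lemma separates_fractional:
  assumes I: "submodule I R QM" and i: "i \<in> I" "i \<noteq> \<zero>"
    and b: "b \<in> carrier Q" "b \<noteq> \<zero>" "\<And>j. j \<in> I \<Longrightarrow> b \<otimes> j \<in> carrier R"
    and z: "z \<in> carrier Q" "z \<notin> I"
  shows "\<exists>q\<in>dual I. q \<otimes> z \<notin> \<omega>"
proof -
  have bQ: "b \<in> carrier Q" using b by blast
  obtain b' where b': "b' \<in> carrier R" "b' \<noteq> \<zero>" "b' \<otimes> (b \<otimes> z) \<in> carrier R"
    using denominator[of "b \<otimes> z"] bQ z(1) by auto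
  have b'Q: "b' \<in> carrier Q" using R_Q b'(1) .
  let ?b = "b' \<otimes> b"
  have bb: "?b \<in> carrier Q" "?b \<noteq> \<zero>" using bQ b'Q nonzero_mult b(2) b'(2) by auto
  let ?J = "scaled QM ?b I" and ?z = "?b \<otimes> z"
  have J: "submodule ?J R QM" by (rule submodule_scaled_QM[OF I bb(1)])
  have JR: "?J \<subseteq> carrier R"
  proof
    fix y assume "y \<in> ?J"
    then obtain j where j: "j \<in> I" "y = ?b \<otimes> j" by (auto simp: scaled_def)
    have "y = b' \<otimes> (b \<otimes> j)" using j bQ b'Q submodule_QM_D(1)[OF I j(1)] by (simp add: Q.m_assoc)
    then show "y \<in> carrier R" using R_closed(3)[OF b'(1) b(3)[OF j(1)]] by simp
  qed
  have zR: "?z \<in> carrier R" using b'(3) bQ b'Q z(1) by (simp add: Q.m_assoc)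
  have zJ: "?z \<notin> ?J"
  proof
    assume "?z \<in> ?J"
    then obtain j where j: "j \<in> I" "?b \<otimes> z = ?b \<otimes> j" by (auto simp: scaled_def)
    then have "z = j" using inv_mult_cancel(1)[OF bb] z(1) submodule_QM_D(1)[OF I] by metis
    then show False using j z by simp
  qed
  have iQ: "i \<in> carrier Q" using submodule_QM_D(1)[OF I i(1)] .
  let ?x = "?b \<otimes> i"
  have x: "?x \<in> ?J" "?x \<noteq> \<zero>" using i iQ bb nonzero_mult by (auto simp: scaled_def)
  have xR: "?x \<in> carrier R" using x JR by blast
  have xQ: "?x \<in> carrier Q" using xR R_Q by blast
  have "?x \<odot>\<^bsub>QM\<^esub> ?z \<in> ?J"
    using submodule_QM_D(4)[OF J zR x(1)] Q.m_comm[of ?z ?x] R_Q zR xR by simp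
  then obtain s where s: "s \<in> carrier R" "s \<otimes> ?z \<notin> ?J" "colon R QM ?J (s \<otimes> ?z) = m"
    using exists_socle_multiple[OF module_QM J, of ?z ?x] R_Q zR zJ xR x(2) by (auto simp: R_ops)
  have sQ: "s \<in> carrier Q" using R_Q s(1) .
  have szR: "s \<otimes> ?z \<in> carrier R" using R_closed(3) s(1) zR by blast
  have Ji: "ideal ?J R" using ideal_iff_QM J JR by blast
  have "colon R (self_module R) ?J (s \<otimes> ?z) = m" using s(3) by (simp add: colon_def R_ops)
  then obtain w where w: "w \<in> carrier W" "\<forall>j\<in>?J. j \<odot>\<^bsub>W\<^esub> w \<in> scaled W ?x (carrier W)"
    "(s \<otimes> ?z) \<odot>\<^bsub>W\<^esub> w \<notin> scaled W ?x (carrier W)"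
    using separates[OF Ji x(1) _ szR] x(2) by (auto simp: R_ops)
  have \<phi>w: "\<phi> w \<in> carrier Q" using \<phi>D(1)[OF w(1)] by simp
  let ?q = "inv ?x \<otimes> \<phi> w"
  have invx: "inv ?x \<in> carrier Q" using inv_Q[OF xQ x(2)] by blast
  have q: "?q \<in> carrier Q" using invx \<phi>w by simp
  have key: "?q \<otimes> y \<in> \<omega> \<longleftrightarrow> y \<odot>\<^bsub>W\<^esub> w \<in> scaled W ?x (carrier W)" if y: "y \<in> carrier R" for y
  proof
    have yQ: "y \<in> carrier Q" using R_Q y .
    have e: "?q \<otimes> y = inv ?x \<otimes> \<phi> (y \<odot>\<^bsub>W\<^esub> w)"
      using \<phi>D(3)[OF y w(1)] invx yQ \<phi>w by (simp add: Q.m_ac)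
    {
      assume "y \<odot>\<^bsub>W\<^esub> w \<in> scaled W ?x (carrier W)"
      then obtain v where v: "v \<in> carrier W" "y \<odot>\<^bsub>W\<^esub> w = ?x \<odot>\<^bsub>W\<^esub> v" by (auto simp: scaled_def)
      have "?q \<otimes> y = inv ?x \<otimes> (?x \<otimes> \<phi> v)" using e v \<phi>D(3)[OF xR v(1)] by simp
      also have "\<dots> = \<phi> v" using inv_mult_cancel(1)[OF xQ x(2)] \<phi>D(1)[OF v(1)] by simp
      finally show "?q \<otimes> y \<in> \<omega>" using v(1) by (simp add: \<omega>_def)
    next
      assume "?q \<otimes> y \<in> \<omega>"
      then obtain v where v: "v \<in> carrier W" "?q \<otimes> y = \<phi> v" by (auto simp: \<omega>_def)
      have yw: "y \<odot>\<^bsub>W\<^esub> w \<in> carrier W" using y w(1) by simp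
      have "\<phi> (?x \<odot>\<^bsub>W\<^esub> v) = ?x \<otimes> (inv ?x \<otimes> \<phi> (y \<odot>\<^bsub>W\<^esub> w))" using \<phi>D(3)[OF xR v(1)] v(2) e by simp
      also have "\<dots> = \<phi> (y \<odot>\<^bsub>W\<^esub> w)" using inv_mult_cancel(2)[OF xQ x(2)] \<phi>D(1)[OF yw] by simp
      finally have "y \<odot>\<^bsub>W\<^esub> w = ?x \<odot>\<^bsub>W\<^esub> v" using \<phi>_eqD yw v(1) xR by simp
      then show "y \<odot>\<^bsub>W\<^esub> w \<in> scaled W ?x (carrier W)" using v(1) by (simp add: scaled_def)
    }
  qed
  show ?thesis
  proof (intro bexI[of _ "?q \<otimes> ?b"] dualI)
    show "?q \<otimes> ?b \<in> carrier Q" using q bb by simp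
    show "?q \<otimes> ?b \<otimes> j \<in> \<omega>" if j: "j \<in> I" for j
    proof -
      have "?b \<otimes> j \<in> ?J" using j by (simp add: scaled_def)
      then have "?q \<otimes> (?b \<otimes> j) \<in> \<omega>" using key w(2) JR by blast
      then show ?thesis using q bb submodule_QM_D(1)[OF I j] by (simp add: Q.m_assoc)
    qed
    show "?q \<otimes> ?b \<otimes> z \<notin> \<omega>"
    proof
      assume "?q \<otimes> ?b \<otimes> z \<in> \<omega>"
      then have "s \<otimes> (?q \<otimes> ?b \<otimes> z) \<in> \<omega>" using \<omega>D(4) s(1) by blast
      moreover have "s \<otimes> (?q \<otimes> ?b \<otimes> z) = ?q \<otimes> (s \<otimes> ?z)" using sQ q bb z(1) by (simp add: Q.m_ac)
      ultimately show False using key[OF szR] w(3) by simp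
    qed
  qed
qed

lemma dual_R: "dual (carrier R) = \<omega>"
proof
  show "dual (carrier R) \<subseteq> \<omega>" using dualD R_closed(1) by (metis Q.r_one subsetI)
  show "\<omega> \<subseteq> dual (carrier R)"
    using \<omega>D(1,4) R_Q Q.m_comm by (metis dualI subsetI)
qed

lemma dual_\<omega>: "dual \<omega> = carrier R"
proof
  show "carrier R \<subseteq> dual \<omega>" using \<omega>D(4) R_Q by (auto intro: dualI)
  show "dual \<omega> \<subseteq> carrier R"
  proof
    fix z assume z: "z \<in> dual \<omega>"
    show "z \<in> carrier R"
    proof (rule ccontr)
      assume "z \<notin> carrier R"
      then obtain q where q: "q \<in> dual (carrier R)" "q \<otimes> z \<notin> \<omega>"
        using separates_fractional[OF submodule_R R_closed(1) Q.one_not_zero Q.one_closed Q.one_not_zero]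
          dualD(1)[OF z] R_Q by auto
      then show False
        using dualD(2)[OF z, of q] dualD(1)[OF z] \<omega>D(1) Q.m_comm[of q z] dual_R by simp
    qed
  qed
qed

abbreviation C :: "'a set" where "C \<equiv> conductor R Q"

text \<open>\<open>C = (\<omega> : \<omega>) : V = \<omega> : \<omega>V = \<omega> : V\<close>\<close>

lemma conductor_eq_dual: "C = dual V"
proof
  show "C \<subseteq> dual V" using R_\<omega> by (auto simp: conductor_def dual_def)
  show "dual V \<subseteq> C"
  proof
    fix q assume q: "q \<in> dual V"
    have "q \<otimes> v \<in> dual \<omega>" if v: "v \<in> V" for v
    proof (rule dualI)
      show "q \<otimes> v \<in> carrier Q" using dualD(1)[OF q] V_Q[OF v] by simp
      fix a assume a: "a \<in> \<omega>"
      then have "v \<otimes> a \<in> V" using v V_closed(2) \<omega>_V by blast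
      then have "q \<otimes> (v \<otimes> a) \<in> \<omega>" using dualD(2)[OF q] by blast
      then show "q \<otimes> v \<otimes> a \<in> \<omega>" using dualD(1)[OF q] V_Q[OF v] \<omega>D(1)[OF a] by (simp add: Q.m_assoc)
    qed
    then show "q \<in> C" using dual_\<omega> dualD(1)[OF q] by (simp add: conductor_def)
  qed
qed

lemma submodule_C: "submodule C R QM"
  unfolding conductor_eq_dual by (rule submodule_dual[OF submodule_V])

lemma C_R: "C \<subseteq> carrier R"
  using V_closed(3) unfolding conductor_def by (metis (no_types, lifting) Q.r_one mem_Collect_eq subsetI)

lemma C_V: "a \<in> C \<Longrightarrow> v \<in> V \<Longrightarrow> a \<otimes> v \<in> C"
proof -
  assume a: "a \<in> C" and v: "v \<in> V"
  have aQ: "a \<in> carrier Q" using a by (simp add: conductor_def)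
  have "a \<otimes> v \<otimes> y \<in> carrier R" if y: "y \<in> V" for y
  proof -
    have "a \<otimes> v \<otimes> y = a \<otimes> (v \<otimes> y)" using aQ v y V_Q by (simp add: Q.m_assoc)
    then show ?thesis using a V_closed(2)[OF v y] by (simp add: conductor_def)
  qed
  then show "a \<otimes> v \<in> C" using aQ V_Q[OF v] by (simp add: conductor_def)
qed

text \<open>The fractional ideal \<open>R : \<omega>\<close>.\<close>

definition \<omega>_inverse :: "'a set" where "\<omega>_inverse = {a \<in> carrier Q. \<forall>z\<in>\<omega>. a \<otimes> z \<in> carrier R}"

lemma \<omega>_inverse_R: "a \<in> \<omega>_inverse \<Longrightarrow> a \<in> carrier R"
  using one_\<omega> unfolding \<omega>_inverse_def by (metis (no_types, lifting) Q.r_one mem_Collect_eq)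

lemma C_\<omega>_inverse: "C \<subseteq> \<omega>_inverse"
  using \<omega>_V unfolding conductor_def \<omega>_inverse_def by blast

lemma \<omega>_inverse_nonzero: "\<exists>c\<in>\<omega>_inverse. c \<noteq> \<zero>"
proof -
  obtain c where "c \<in> carrier R" "c \<noteq> \<zero>" "\<forall>w\<in>carrier W. c \<otimes> \<phi> w \<in> carrier R"
    using common_denominator[OF \<phi>] by blast
  then show ?thesis using R_Q by (auto simp: \<omega>_inverse_def \<omega>_def)
qed

text \<open>
  Clearing denominators shows that a map between fractional ideals is a multiplication.
\<close>

lemma hom_to_R:
  assumes f: "f \<in> module_hom R W (self_module R)" and w: "w \<in> carrier W"
  shows "f w = f w1 \<otimes> \<phi> w"
proof -
  have c: "f w \<in> carrier Q" "f w1 \<in> carrier Q" using module_homD(2)[OF f] w w1(1) R_Q by auto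
  have \<phi>w: "\<phi> w \<in> carrier Q" using \<phi>D(1)[OF w] by simp
  obtain b where b: "b \<in> carrier R" "b \<noteq> \<zero>" "b \<otimes> \<phi> w \<in> carrier R" using denominator[OF \<phi>w] by blast
  have bQ: "b \<in> carrier Q" using R_Q b(1) .
  have "\<phi> (b \<odot>\<^bsub>W\<^esub> w) = \<phi> ((b \<otimes> \<phi> w) \<odot>\<^bsub>W\<^esub> w1)"
    using \<phi>D(3)[OF b(1) w] \<phi>D(3)[OF b(3) w1(1)] w1(2) bQ \<phi>w by simp
  then have "b \<odot>\<^bsub>W\<^esub> w = (b \<otimes> \<phi> w) \<odot>\<^bsub>W\<^esub> w1" using \<phi>_eqD b w w1(1) by simp
  then have "b \<otimes> f w = (b \<otimes> \<phi> w) \<otimes> f w1"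
    using module_homD(4)[OF f b(1) w] module_homD(4)[OF f b(3) w1(1)] by (simp add: R_ops)
  also have "\<dots> = b \<otimes> (f w1 \<otimes> \<phi> w)" using bQ \<phi>w c by (simp add: Q.m_ac)
  finally have "inv b \<otimes> (b \<otimes> f w) = inv b \<otimes> (b \<otimes> (f w1 \<otimes> \<phi> w))" by simp
  then show ?thesis using inv_mult_cancel(1)[OF bQ b(2)] c \<phi>w by simp
qed

lemma hom_to_R_coefficient:
  assumes f: "f \<in> module_hom R W (self_module R)"
  shows "f w1 \<in> \<omega>_inverse"
proof -
  have c: "f w \<in> carrier R" if "w \<in> carrier W" for w using module_homD(2)[OF f that] by simp
  have "f w1 \<otimes> \<phi> w \<in> carrier R" if "w \<in> carrier W" for w
    using c[OF that] hom_to_R[OF f that] by simp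
  then show ?thesis using R_Q[OF c[OF w1(1)]] by (simp add: \<omega>_inverse_def \<omega>_def)
qed

lemma hom_of_coefficient:
  assumes a: "a \<in> \<omega>_inverse" and J: "scaled QM a \<omega> \<subseteq> J" "J \<subseteq> carrier R"
  shows "(\<lambda>w\<in>carrier W. a \<otimes> \<phi> w) \<in> module_hom R W (ideal_module R J)"
proof (rule module_homI)
  have aQ: "a \<in> carrier Q" using a by (simp add: \<omega>_inverse_def)
  show "(\<lambda>w\<in>carrier W. a \<otimes> \<phi> w) x \<in> carrier (ideal_module R J)" if "x \<in> carrier W" for x
    using that J(1) by (auto simp: ideal_module_def scaled_def \<omega>_def)
qed (use a \<phi>D R_Q in \<open>auto simp: ideal_module_def R_ops Q.r_distr Q.m_lcomm \<omega>_inverse_def\<close>)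

lemma scaled_\<omega>_ideal:
  assumes a: "a \<in> \<omega>_inverse"
  shows "submodule (scaled QM a \<omega>) R QM" "scaled QM a \<omega> \<subseteq> carrier R"
  using submodule_scaled_QM[OF submodule_\<omega>, of a] a by (auto simp: \<omega>_inverse_def scaled_def)

lemma module_length_quot_ideal:
  assumes J: "ideal J R"
  shows "module_length R (quot_module (self_module R) J) = interval_length R QM J (carrier R)"
  using module_length_quot_module[OF module_self, of J] J ideal_iff interval_length_self_module[of "carrier R" J]
  by simp

lemma h_invariant_eq:
  "h_invariant R W = Inf ((\<lambda>a. interval_length R QM (scaled QM a \<omega>) (carrier R)) ` \<omega>_inverse)"
proof -
  have "{module_length R (quot_module (self_module R) J) | J.
      ideal J R \<and> (\<exists>f\<in>module_hom R W (ideal_module R J). f ` carrier W = J)}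
    = (\<lambda>a. interval_length R QM (scaled QM a \<omega>) (carrier R)) ` \<omega>_inverse" (is "?A = ?B")
  proof
    show "?A \<subseteq> ?B"
    proof
      fix l assume "l \<in> ?A"
      then obtain J f where J: "ideal J R" and l: "l = module_length R (quot_module (self_module R) J)"
        and f: "f \<in> module_hom R W (ideal_module R J)" "f ` carrier W = J" by blast
      have "J \<subseteq> carrier R" using ideal_iff_QM J by blast
      then have f': "f \<in> module_hom R W (self_module R)"
        using f(1) unfolding module_hom_def by (auto simp: ideal_module_def PiE_iff)
      have "J = scaled QM (f w1) \<omega>"
        using hom_to_R[OF f'] f(2) by (force simp: scaled_def \<omega>_def)
      then show "l \<in> ?B"
        using hom_to_R_coefficient[OF f'] l module_length_quot_ideal[OF J] by blast
    qed
    show "?B \<subseteq> ?A"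
    proof
      fix l assume "l \<in> ?B"
      then obtain a where a: "a \<in> \<omega>_inverse" and l: "l = interval_length R QM (scaled QM a \<omega>) (carrier R)"
        by blast
      let ?J = "scaled QM a \<omega>"
      have J: "ideal ?J R" using ideal_iff_QM scaled_\<omega>_ideal[OF a] by blast
      have f: "(\<lambda>w\<in>carrier W. a \<otimes> \<phi> w) \<in> module_hom R W (ideal_module R ?J)"
        using hom_of_coefficient[OF a subset_refl scaled_\<omega>_ideal(2)[OF a]] .
      have "(\<lambda>w\<in>carrier W. a \<otimes> \<phi> w) ` carrier W = ?J"
        by (auto simp: scaled_def \<omega>_def)
      then show "l \<in> ?A"
        by (intro CollectI exI[of _ ?J] conjI bexI[OF _ f])
          (simp_all add: J l module_length_quot_ideal[OF J])
    qed
  qed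
  then show ?thesis unfolding h_invariant_def by simp
qed

lemma ideal_C: "ideal C R"
  using ideal_iff_QM submodule_C C_R by blast

lemma trace_ideal_eq_conductor_iff: "trace_ideal R W = C \<longleftrightarrow> \<omega>_inverse \<subseteq> C"
proof -
  let ?T = "\<Union>f\<in>module_hom R W (self_module R). f ` carrier W"
  have T: "?T \<subseteq> carrier R" using module_homD(2)[of _ R W "self_module R"] by fastforce
  have inT: "a \<in> ?T" if a: "a \<in> \<omega>_inverse" for a
  proof -
    have "(\<lambda>w\<in>carrier W. a \<otimes> \<phi> w) \<in> module_hom R W (ideal_module R (carrier R))"
      using hom_of_coefficient[OF a scaled_\<omega>_ideal(2)[OF a]] by simp
    then have "(\<lambda>w\<in>carrier W. a \<otimes> \<phi> w) \<in> module_hom R W (self_module R)"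
      by (simp add: ideal_module_def self_module_def)
    moreover have "(\<lambda>w\<in>carrier W. a \<otimes> \<phi> w) w1 = a" using w1 a by (simp add: \<omega>_inverse_def)
    ultimately show ?thesis using w1(1) by (metis UN_iff image_eqI)
  qed
  show ?thesis
  proof
    assume "trace_ideal R W = C"
    then show "\<omega>_inverse \<subseteq> C"
      using inT genideal_self[OF T] unfolding trace_ideal_def by blast
  next
    assume sub: "\<omega>_inverse \<subseteq> C"
    have "?T \<subseteq> C"
    proof
      fix y assume "y \<in> ?T"
      then obtain f w where f: "f \<in> module_hom R W (self_module R)" "w \<in> carrier W" "y = f w" by blast
      then have "y = f w1 \<otimes> \<phi> w" using hom_to_R by blast
      moreover have "f w1 \<in> C" using hom_to_R_coefficient[OF f(1)] sub by blast
      moreover have "\<phi> w \<in> V" using \<phi>_V f(2) by blast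
      ultimately show "y \<in> C" using C_V by simp
    qed
    then have "trace_ideal R W \<subseteq> C" unfolding trace_ideal_def by (rule genideal_minimal[OF ideal_C])
    moreover have "C \<subseteq> trace_ideal R W"
      using C_\<omega>_inverse inT genideal_self[OF T] unfolding trace_ideal_def by blast
    ultimately show "trace_ideal R W = C" by blast
  qed
qed

end

section \<open>Counting lengths\<close>

lemma enat_eq_add_imp_infinity: "a = a + d \<Longrightarrow> 1 \<le> d \<Longrightarrow> a = (\<infinity>::enat)"
  by (cases a; cases d) (auto simp: one_enat_def)

lemma enat_le_finite: "a \<le> b \<Longrightarrow> b \<noteq> \<infinity> \<Longrightarrow> a \<noteq> (\<infinity>::enat)"
  by (cases a; cases b) auto

lemma enat_add_eq_cancel: "enat (q + p) = enat p + d \<Longrightarrow> d = enat q"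
  by (cases d) auto

lemma enat_add_eq_double: "d + enat p = enat q + enat (q + p) \<Longrightarrow> d = enat (2 * q)"
  by (cases d) auto

lemma enat_less_double:
  "1 \<le> e \<Longrightarrow> enat (q + p) = e + v \<Longrightarrow> d + enat p = enat q + v \<Longrightarrow> d < enat (2 * q)"
  by (cases d; cases e; cases v) (auto simp: one_enat_def)

lemma enat_double_le: "enat (q + p) \<le> v \<Longrightarrow> d + enat p = enat q + v \<Longrightarrow> enat (2 * q) \<le> d"
  by (cases d; cases v) auto

context normalized_canonical
begin

abbreviation len :: "'a set \<Rightarrow> 'a set \<Rightarrow> enat" where "len \<equiv> interval_length R QM"

text \<open>
  Multiplication by \<open>x \<in> m\<close> makes the proper submodule \<open>xR\<close> as long as \<open>R\<close>.
\<close>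

lemma len_zero_R: "len {\<zero>} (carrier R) = \<infinity>"
proof (rule ccontr)
  assume fin: "len {\<zero>} (carrier R) \<noteq> \<infinity>"
  obtain x where x: "x \<in> m" "x \<noteq> \<zero>" using exists_nonzero_in_m by (auto simp: R_ops)
  have xc: "x \<in> carrier R" using m_carrier x by blast
  have xQ: "x \<in> carrier Q" using R_Q xc .
  have z: "submodule {\<zero>} R QM" using QM.submodule_zero_set by simp
  let ?xR = "scaled QM x (carrier R)"
  have xR: "submodule ?xR R QM" by (rule submodule_scaled_QM[OF submodule_R xQ])
  have xm: "?xR \<subseteq> m" unfolding scaled_R[OF xc] by (rule cgenideal_minimal[OF ideal_m x(1)])
  have sub: "?xR \<subset> carrier R"
    using xm m_carrier one_notin_m R_closed(1) by (auto simp: R_ops)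
  have "scaled QM x {\<zero>} = {\<zero>}" using xQ by (simp add: scaled_def)
  then have "len {\<zero>} ?xR = len {\<zero>} (carrier R)"
    using interval_length_scaled[OF z submodule_R xQ x(2)] by simp
  moreover have "len {\<zero>} (carrier R) = len {\<zero>} ?xR + len ?xR (carrier R)"
    by (rule QM.interval_length_add[OF z xR submodule_R]) (use submodule_QM_D(2)[OF xR] sub in auto)
  moreover have "1 \<le> len ?xR (carrier R)"
    unfolding interval_length_def by (rule one_le_chain_length) (use xR submodule_R sub in auto)
  ultimately show False using fin enat_eq_add_imp_infinity by metis
qed

lemma len_finite:
  assumes "a \<in> \<omega>_inverse" "a \<noteq> \<zero>"
  shows "len (scaled QM a \<omega>) (carrier R) \<noteq> \<infinity>"
proof (rule finite_colength_QM[OF scaled_\<omega>_ideal[OF assms(1)]])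
  show "a \<in> scaled QM a \<omega>"
    using one_\<omega> \<omega>_inverse_R[OF assms(1)] R_Q by (force simp: scaled_def)
qed (rule assms(2))

text \<open>
  On the fractional ideals between \<open>R\<close> and \<open>V\<close>, or between \<open>C\<close> and \<open>\<omega>\<close>, the map
  \<open>I \<mapsto> \<omega> : I\<close> is injective and reverses inclusions; it exchanges the two intervals.
\<close>

lemma length_duality:
  assumes \<gamma>: "\<gamma> \<in> C" "\<gamma> \<noteq> \<zero>"
  shows "len (carrier R) V = len C \<omega>"
proof -
  have \<gamma>Q: "\<gamma> \<in> carrier Q" using \<gamma>(1) by (simp add: conductor_def)
  have frac: "\<gamma> \<otimes> v \<in> carrier R" if "v \<in> V" for v using \<gamma>(1) that by (simp add: conductor_def)
  have strict: "dual N' \<subset> dual N"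
    if N: "submodule N R QM" "i \<in> N" "i \<noteq> \<zero>" and N': "N' \<subseteq> V" "N \<subset> N'" for N N' i
  proof -
    obtain z where z: "z \<in> N'" "z \<notin> N" using N' by blast
    have zQ: "z \<in> carrier Q" using V_Q z N' by blast
    obtain q where q: "q \<in> dual N" "q \<otimes> z \<notin> \<omega>"
      using separates_fractional[OF N \<gamma>Q \<gamma>(2) _ zQ z(2)] frac N' by blast
    then have "q \<notin> dual N'" using z(1) dualD(2) by blast
    then show ?thesis using q(1) dual_antimono[of N N'] N'(2) by blast
  qed
  have dual_C: "dual C \<subseteq> V"
  proof
    fix z assume z: "z \<in> dual C"
    show "z \<in> V"
    proof (rule ccontr)
      assume "z \<notin> V"
      then obtain q where q: "q \<in> C" "q \<otimes> z \<notin> \<omega>"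
        using separates_fractional[OF submodule_V V_closed(3) Q.one_not_zero \<gamma>Q \<gamma>(2) frac dualD(1)[OF z]]
          conductor_eq_dual by blast
      then show False
        using dualD(2)[OF z q(1)] dualD(1)[OF z] submodule_QM_D(1)[OF submodule_C q(1)] Q.m_comm[of q z]
        by simp
    qed
  qed
  show ?thesis
    unfolding interval_length_def
  proof (rule antisym)
    show "chain_length {N. submodule N R QM} (carrier R) V \<le> chain_length {N. submodule N R QM} C \<omega>"
    proof (rule chain_length_le_antitone_map[where f = dual])
      fix N assume "N \<in> {N. submodule N R QM}" "carrier R \<subseteq> N" "N \<subseteq> V"
      then show "dual N \<in> {N. submodule N R QM} \<and> C \<subseteq> dual N \<and> dual N \<subseteq> \<omega>"
        using submodule_dual dual_antimono[of N V] dual_antimono[of "carrier R" N]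
        by (simp add: conductor_eq_dual dual_R)
    next
      fix N N' assume "N \<in> {N. submodule N R QM}" "carrier R \<subseteq> N" "N' \<subseteq> V" "N \<subset> N'"
      then show "dual N' \<subset> dual N" using strict[of N \<one> N'] R_closed(1) Q.one_not_zero by blast
    qed
    show "chain_length {N. submodule N R QM} C \<omega> \<le> chain_length {N. submodule N R QM} (carrier R) V"
    proof (rule chain_length_le_antitone_map[where f = dual])
      fix N assume "N \<in> {N. submodule N R QM}" "C \<subseteq> N" "N \<subseteq> \<omega>"
      then show "dual N \<in> {N. submodule N R QM} \<and> carrier R \<subseteq> dual N \<and> dual N \<subseteq> V"
        using submodule_dual dual_antimono[of N \<omega>] dual_antimono[of C N] dual_C
        by (simp add: dual_\<omega>)
    next
      fix N N' assume "N \<in> {N. submodule N R QM}" "C \<subseteq> N" "N' \<subseteq> \<omega>" "N \<subset> N'"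
      then show "dual N' \<subset> dual N" using strict[of N \<gamma> N'] \<gamma> \<omega>_V by blast
    qed
  qed
qed

lemma conductor_principal:
  assumes "\<gamma>0 \<in> C" "\<gamma>0 \<noteq> \<zero>"
  shows "\<exists>\<gamma>\<in>C. \<gamma> \<noteq> \<zero> \<and> C = scaled QM \<gamma> V"
proof -
  have "C \<subseteq> V" using C_R R_V by blast
  then obtain \<gamma> where \<gamma>: "\<gamma> \<in> C" "\<gamma> \<noteq> \<zero>" "\<forall>t\<in>C. \<exists>v\<in>V. t = \<gamma> \<otimes> v"
    using V_divisor_of_all assms by meson
  have "C = scaled QM \<gamma> V"
    using \<gamma>(3) C_V[OF \<gamma>(1)] by (auto simp: scaled_def)
  then show ?thesis using \<gamma> by blast
qed

text \<open>
  If \<open>\<gamma>\<close> generates \<open>C\<close> over \<open>V\<close>, then \<open>\<gamma>\<omega>\<close> has colength \<open>2q\<close>, where \<open>q\<close> is the colength of \<open>C\<close>.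
  Since \<open>V\<close> is a valuation ring, every \<open>a\<close> in \<open>R : \<omega>\<close> satisfies \<open>aV \<subseteq> C\<close> or \<open>C \<subset> aV\<close>,
  and the colength of \<open>a\<omega>\<close> is accordingly at least or less than \<open>2q\<close>.
\<close>

lemma h_invariant_iff_nonzero_conductor:
  assumes nz: "\<gamma>0 \<in> C" "\<gamma>0 \<noteq> \<zero>"
  shows "h_invariant R W = 2 * len C (carrier R) \<longleftrightarrow> \<omega>_inverse \<subseteq> C"
proof -
  obtain \<gamma> where \<gamma>: "\<gamma> \<in> C" "\<gamma> \<noteq> \<zero>" and C: "C = scaled QM \<gamma> V"
    using conductor_principal[OF nz] by blast
  have CV: "C \<subseteq> V" and RV: "carrier R \<subseteq> V" and R\<omega>: "carrier R \<subseteq> \<omega>" using C_R R_V R_\<omega> by blast+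
  have \<gamma>Q: "\<gamma> \<in> carrier Q" using submodule_QM_D(1)[OF submodule_C \<gamma>(1)] .
  have q_fin: "len C (carrier R) \<noteq> \<infinity>" by (rule finite_colength_QM[OF submodule_C C_R \<gamma>])
  have \<gamma>R: "submodule (scaled QM \<gamma> (carrier R)) R QM" by (rule submodule_scaled_QM[OF submodule_R \<gamma>Q])
  have p_fin: "len (carrier R) V \<noteq> \<infinity>"
  proof -
    have sub: "scaled QM \<gamma> (carrier R) \<subseteq> carrier R"
      using C_R \<gamma>(1) R_closed(3) by (auto simp: scaled_def)
    have g: "\<gamma> \<in> scaled QM \<gamma> (carrier R)" using R_closed(1) \<gamma>Q by (force simp: scaled_def)
    have "len (carrier R) V = len (scaled QM \<gamma> (carrier R)) C"
      using interval_length_scaled[OF submodule_R submodule_V \<gamma>Q \<gamma>(2)] C by simp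
    also have "\<dots> \<le> len (scaled QM \<gamma> (carrier R)) (carrier R)"
      by (rule QM.interval_length_mono) (use C_R in auto)
    finally show ?thesis by (rule enat_le_finite) (rule finite_colength_QM[OF \<gamma>R sub g \<gamma>(2)])
  qed
  obtain p q where p: "len (carrier R) V = enat p" and q: "len C (carrier R) = enat q"
    using p_fin q_fin by auto
  have CVlen: "len C V = enat (q + p)"
    using QM.interval_length_add[OF submodule_C submodule_R submodule_V C_R RV] p q by simp
  have \<omega>V: "len \<omega> V = enat q"
  proof -
    have "len C V = len C \<omega> + len \<omega> V"
      by (rule QM.interval_length_add[OF submodule_C submodule_\<omega> submodule_V]) (use C_R R\<omega> \<omega>_V in auto)
    then show ?thesis unfolding length_duality[OF \<gamma>, symmetric] p CVlen by (rule enat_add_eq_cancel)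
  qed
  \<comment> \<open>the length of \<open>V / a\<omega>\<close>, counted through \<open>R\<close> and through \<open>aV\<close>\<close>
  have count: "len (scaled QM a \<omega>) (carrier R) + enat p = enat q + len (scaled QM a V) V"
    if a: "a \<in> \<omega>_inverse" "a \<noteq> \<zero>" for a
  proof -
    have aR: "a \<in> carrier R" using \<omega>_inverse_R a(1) .
    have aQ: "a \<in> carrier Q" using R_Q aR .
    note s\<omega> = scaled_\<omega>_ideal[OF a(1)]
    have sV: "submodule (scaled QM a V) R QM" by (rule submodule_scaled_QM[OF submodule_V aQ])
    have "len (scaled QM a \<omega>) V = len (scaled QM a \<omega>) (carrier R) + len (carrier R) V"
      by (rule QM.interval_length_add[OF s\<omega>(1) submodule_R submodule_V s\<omega>(2) RV])
    moreover have "len (scaled QM a \<omega>) V = len (scaled QM a \<omega>) (scaled QM a V) + len (scaled QM a V) V"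
      by (rule QM.interval_length_add[OF s\<omega>(1) sV submodule_V])
        (use \<omega>_V V_closed(2) R_V[OF aR] in \<open>auto simp: scaled_def\<close>)
    ultimately show ?thesis
      using interval_length_scaled[OF submodule_\<omega> submodule_V aQ a(2)] p \<omega>V by simp
  qed
  have \<gamma>len: "len (scaled QM \<gamma> \<omega>) (carrier R) = enat (2 * q)"
  proof (rule enat_add_eq_double)
    have "\<gamma> \<in> \<omega>_inverse" using \<gamma>(1) C_\<omega>_inverse by blast
    from count[OF this \<gamma>(2)] show "len (scaled QM \<gamma> \<omega>) (carrier R) + enat p = enat q + enat (q + p)"
      unfolding C[symmetric] CVlen .
  qed
  have two: "2 * len C (carrier R) = enat (2 * q)" using q by (simp add: mult_2)
  show ?thesis
  proof
    assume h: "h_invariant R W = 2 * len C (carrier R)"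
    show "\<omega>_inverse \<subseteq> C"
    proof
      fix a assume a: "a \<in> \<omega>_inverse"
      show "a \<in> C"
      proof (rule ccontr)
        assume aC: "a \<notin> C"
        have a0: "a \<noteq> \<zero>" using aC submodule_QM_D(2)[OF submodule_C] by blast
        have aR: "a \<in> carrier R" using \<omega>_inverse_R a .
        have aQ: "a \<in> carrier Q" using R_Q aR .
        let ?aV = "scaled QM a V"
        have sV: "submodule ?aV R QM" by (rule submodule_scaled_QM[OF submodule_V aQ])
        have "{a, \<gamma>} \<subseteq> V" using R_V aR CV \<gamma>(1) by blast
        then have "\<exists>s\<in>{a, \<gamma>}. s \<noteq> \<zero> \<and> (\<forall>t\<in>{a, \<gamma>}. \<exists>v\<in>V. t = s \<otimes> v)"
          by (rule V_divisor_of_all[OF _ _ \<gamma>(2)]) simp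
        then obtain s where s: "s \<in> {a, \<gamma>}" "\<exists>v\<in>V. a = s \<otimes> v" "\<exists>v\<in>V. \<gamma> = s \<otimes> v"
          by (elim bexE conjE) simp
        have "s \<noteq> \<gamma>"
        proof
          assume "s = \<gamma>"
          with s(2) obtain v where "v \<in> V" "a = \<gamma> \<otimes> v" by (elim bexE) simp
          then show False using aC C_V[OF \<gamma>(1)] by simp
        qed
        then have "s = a" using s(1) by simp
        with s(3) obtain v where v: "v \<in> V" "\<gamma> = a \<otimes> v" by (elim bexE) simp
        have "C \<subseteq> ?aV"
        proof
          fix t assume "t \<in> C"
          then obtain u where u: "u \<in> V" "t = \<gamma> \<otimes> u" using C by (auto simp: scaled_def)
          have "t = a \<otimes> (v \<otimes> u)" using u v aQ V_Q by (simp add: Q.m_assoc)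
          then show "t \<in> ?aV" using V_closed(2)[OF v(1) u(1)] by (simp add: scaled_def)
        qed
        moreover have "a \<in> ?aV" using aQ V_closed(3) by (force simp: scaled_def)
        ultimately have sub: "C \<subset> ?aV" using aC by blast
        have l1: "1 \<le> len C ?aV"
          unfolding interval_length_def by (rule one_le_chain_length) (use submodule_C sV sub in auto)
        have l2: "len C V = len C ?aV + len ?aV V"
          by (rule QM.interval_length_add[OF submodule_C sV submodule_V])
            (use sub V_closed(2) R_V[OF aR] in \<open>auto simp: scaled_def\<close>)
        have "len (scaled QM a \<omega>) (carrier R) < enat (2 * q)"
          by (rule enat_less_double[OF l1 l2[unfolded CVlen] count[OF a a0]])
        moreover have "h_invariant R W \<le> len (scaled QM a \<omega>) (carrier R)"
          unfolding h_invariant_eq by (rule Inf_lower) (use a in blast)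
        ultimately show False using h two by simp
      qed
    qed
  next
    assume sub: "\<omega>_inverse \<subseteq> C"
    show "h_invariant R W = 2 * len C (carrier R)"
      unfolding two
    proof (rule antisym)
      show "h_invariant R W \<le> enat (2 * q)"
        unfolding h_invariant_eq \<gamma>len[symmetric] by (rule Inf_lower) (use \<gamma>(1) C_\<omega>_inverse in blast)
      show "enat (2 * q) \<le> h_invariant R W"
        unfolding h_invariant_eq
      proof (rule Inf_greatest, elim imageE)
        fix l a assume l: "l = len (scaled QM a \<omega>) (carrier R)" and a: "a \<in> \<omega>_inverse"
        show "enat (2 * q) \<le> l"
        proof (cases "a = \<zero>")
          \<comment> \<open>the zero ideal is an admissible image of \<open>W\<close>\<close>
          case True
          have "scaled QM a \<omega> = {\<zero>}" using True \<omega>D(1,2) by (force simp: scaled_def)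
          then show ?thesis using l len_zero_R by simp
        next
          case False
          have "scaled QM a V \<subseteq> C" using C_V a sub by (auto simp: scaled_def)
          then have "len C V \<le> len (scaled QM a V) V" by (rule QM.interval_length_mono) simp
          then show ?thesis
            unfolding CVlen l by (rule enat_double_le[OF _ count[OF a False]])
        qed
      qed
    qed
  qed
qed

lemma trace_conductor_iff_h_invariant:
  "trace_ideal R W = C \<longleftrightarrow> h_invariant R W = 2 * module_length R (quot_module (self_module R) C)"
proof (cases "\<exists>\<gamma>\<in>C. \<gamma> \<noteq> \<zero>")
  case True
  then show ?thesis
    using h_invariant_iff_nonzero_conductor trace_ideal_eq_conductor_iff module_length_quot_ideal[OF ideal_C]
    by auto
next
  \<comment> \<open>\<open>C = 0\<close>: both sides are false\<close>
  case False
  then have C0: "C = {\<zero>}" using submodule_QM_D(2)[OF submodule_C] by blast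
  obtain c where c: "c \<in> \<omega>_inverse" "c \<noteq> \<zero>" using \<omega>_inverse_nonzero by blast
  have "h_invariant R W \<le> len (scaled QM c \<omega>) (carrier R)"
    unfolding h_invariant_eq by (rule Inf_lower) (use c in blast)
  then have "h_invariant R W \<noteq> \<infinity>" using len_finite[OF c] by (rule enat_le_finite)
  moreover have "2 * module_length R (quot_module (self_module R) C) = \<infinity>"
    using module_length_quot_ideal[OF ideal_C] C0 len_zero_R by (simp add: mult_2)
  moreover have "trace_ideal R W \<noteq> C" using trace_ideal_eq_conductor_iff c C0 by blast
  ultimately show ?thesis by simp
qed

end

theorem theorem3:
  fixes R Q :: "'a ring" and m :: "'a set" and W :: "('a, 'w) module"
  assumes "noetherian_domain R"
    and "local_ring R m"
    and "krull_dim R = 1"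
    and "analytically_unramified R m"
    and "\<not> gorenstein R"
    and "infinite (carrier (R Quot m))"
    and "fraction_field R Q"
    and "discrete_valuation_ring (integral_closure_ring R Q)"
    and "canonical_module R m W"
  shows "trace_ideal R W = conductor R Q \<longleftrightarrow>
    h_invariant R W = 2 * module_length R (quot_module (self_module R) (conductor R Q))"
proof -
  have R: "one_dim_local_domain R m"
    by (intro one_dim_local_domain.intro noetherian_local_domain.intro
        noetherian_local_domain_axioms.intro one_dim_local_domain_axioms.intro assms)
  have Q: "field Q" using assms(7) by (simp add: fraction_field_def)
  have "one_dim_local_fractions R m Q"
    by (intro one_dim_local_fractions.intro one_dim_local_fractions_axioms.intro R Q assms(7))
  moreover have "canonical_over R m W"
    by (rule one_dim_local_domain.canonical_over_if_canonical_module[OF R assms(9)])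
  ultimately have "canonical_fractions R m Q W" by (rule canonical_fractions.intro)
  then have dvr: "canonical_dvr R m Q W"
    by (intro canonical_dvr.intro canonical_dvr_axioms.intro assms(8))
  obtain \<phi> w1 where "linear_on R W (self_module Q) (carrier W) \<phi>" "w1 \<in> carrier W"
    "\<phi> w1 = \<one>\<^bsub>Q\<^esub>" "\<phi> ` carrier W \<subseteq> integral_closure R Q"
    using canonical_dvr.normalized_functional_exists[OF dvr] by (elim exE conjE)
  then have "normalized_canonical R m Q W \<phi> w1"
    by (intro normalized_canonical.intro normalized_canonical_axioms.intro dvr)
  then show ?thesis by (rule normalized_canonical.trace_conductor_iff_h_invariant)
qed

end
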